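(* Consider the Lagrangian system with Lagrangian $L(t,z,\dot z)=\frac12 g_{ij}(t,z)\dot z^i\dot z^j+a_i(t,z)\dot z^i-V(t,z)$ on $\Sigma=\mathbb{R}^{m+n}\setminus\sigma$, subject to the ideal constraints $f_j(t,z)=0$, $j=1,\dots,l$, where all data satisfy the standing assumptions listed in the context. Assume that 1) for all $i,j$ and all $(t,z)\in\mathbb{R}\times\Sigma$: $g_{ij}(-t,-z)=g_{ij}(t,z)$, $a_i(-t,-z)=a_i(t,z)$, $V(-t,-z)=V(t,z)$; 2) $K-\dfrac{M\omega}{\sqrt2}-\dfrac{A\omega^2}{2}>0$; 3) for some $\nu\in\mathbb{Z}^n$ the set $\mathcal V_\nu$ is non-void and there is a function $\tilde z\in\mathcal V_\nu\cap C^1(\mathbb{R},\Sigma)$ with $\tilde z(-t)=-\tilde z(t)$ for all $t$; 4) $\inf\{\|z-\sigma'\|_{C[0,\omega]}\mid z\in[\tilde z],\ \sigma'\in\sigma\}>0$, where $\|z-\sigma'\|_{C[0,\omega]}=\max_{t\in[0,\omega]}|z(t)-\sigma'|$. Then the constrained system has a solution $z_*$ such that $z_*\in[\tilde z]$ and $z_*(-t)=-z_*(t)$ for all $t\in\mathbb{R}$. This assertion remains valid in the absence of constraints. When $\sigma=\emptyset$ the assertion remains valid with condition 4) omitted.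
   Context: Notation. $x=(x^1,\dots,x^m)\in\mathbb{R}^m$, $\varphi=(\varphi^1,\dots,\varphi^n)\in\mathbb{R}^n$, $z=(z^1,\dots,z^{m+n})=(x,\varphi)\in\mathbb{R}^{m+n}$ (either group of variables may be absent); $|\cdot|$ is the Euclidean norm; repeated indices are summed. A number $\omega>0$ is fixed. The set $\sigma\subset\mathbb{R}^{m+n}$ has no accumulation points and satisfies: if $z=(x,\varphi)\in\sigma$ then $-z\in\sigma$ and $(x,\varphi+2\pi p)\in\sigma$ for every $p\in\mathbb{Z}^n$. Put $\Sigma=\mathbb{R}^{m+n}\setminus\sigma$. The functions $g_{ij}=g_{ji}$, $a_i$, $V$ belong to $C^2(\mathbb{R}\times\Sigma)$ as functions of $(t,z)$, and are $2\pi$-periodic in each $\varphi^j$ and $\omega$-periodic in $t$. There are positive constants $C,M,A,K,P$ and a constant $C_1$ such that for all $(t,z)\in\mathbb{R}\times\Sigma$ and $\xi\in\mathbb{R}^{m+n}$ $$|a_i(t,z)|\le C+M|z|,\qquad \tfrac12 g_{ij}(t,z)\xi^i\xi^j\ge K|\xi|^2,$$ and for all $(t,z)\in\mathbb{R}\times\Sigma$ and $\sigma'\in\sigma$ $$V(t,z)\le A|z|^2-\frac{P}{|z-\sigma'|^2}+C_1 .$$ If $\sigma=\emptyset$, the last condition is replaced by $V(t,z)\le A|z|^2+C_1$. Constraints: $f_j\in C^2(\mathbb{R}^{m+n+1})$, $j=1,\dots,l$, $l<m+n$, are functions of $(t,z)$, $2\pi$-periodic in each $\varphi^j$ and $\omega$-periodic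 in $t$. Put $F(t)=\{z\in\mathbb{R}^{m+n}\mid f_j(t,z)=0,\ j=1,\dots,l\}$. It is assumed that $\operatorname{rank}\big(\partial f_j/\partial z^k(t,z)\big)=l$ for all $t$ and all $z\in F(t)$; that either all $f_j$ satisfy $f_j(-t,-z)=-f_j(t,z)$ or all $f_j$ satisfy $f_j(-t,-z)=f_j(t,z)$; and that $\sigma\subset F(t)$ for all $t$ (this last condition being void if $\sigma=\emptyset$). In the absence of constraints all conditions involving $f_j$ or $F(t)$ are dropped. Solution: a function $z\in C^2(\mathbb{R},\Sigma)$ is a solution of the constrained system if there are functions $\alpha^1,\dots,\alpha^l\in C(\mathbb{R})$ such that for all $t\in\mathbb{R}$ and all $i$ $$\frac{d}{dt}\frac{\partial L}{\partial\dot z^i}(t,z(t),\dot z(t))-\frac{\partial L}{\partial z^i}(t,z(t),\dot z(t))=\alpha^j(t)\frac{\partial f_j}{\partial z^i}(t,z(t)),\qquad z(t)\in F(t).$$ In the absence of constraints the right-hand side is $0$ and the condition $z(t)\in F(t)$ is dropped. For $p\in\mathbb{Z}^n$, $\mathcal V_p\subset C(\mathbb{R},\Sigma)$ is the set of functions $z(t)=(x(t),\varphi(t))$ such that for all $t\in\mathbb{R}$: $x(t+\omega)=x(t)$, $\varphi(t+\omega)=\varphi(t)+2\pi p$, and $z(t)\in F(t)$ (the last condition omitted in the absence of constraints). Two functions $z_1,z_2\in\mathcal V_p$ are homotopic if there is $z(s,t)\in C([0,1]\times\mathbb{R},\Sigma)$ with $z(s,\cdot)\in\mathcal V_p$ for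 all $s\in[0,1]$, $z(0,t)=z_1(t)$, $z(1,t)=z_2(t)$. $[z]$ denotes the homotopy class of $z$ in this sense. *)

theory Defs
  imports "HOL-Analysis.Analysis"
begin

text \<open>
  The configuration space of dimension \<open>m + n\<close> is \<open>real ^ 'k\<close>, and \<open>ang :: 'k set\<close> is the set of
  indices of the angular coordinates \<open>\<phi>\<close>; the remaining coordinates are the \<open>x\<close>. Taking \<open>ang = {}\<close>
  or \<open>ang = UNIV\<close> makes one of the two groups of variables absent.

  Functions on \<open>\<real> \<times> \<Sigma>\<close>, \<open>\<Sigma> = - \<sigma>\<close>, are represented by total functions whose values for \<open>z \<in> \<sigma>\<close>
  are irrelevant. There are \<open>l\<close> constraint functions \<open>f j\<close>, \<open>j < l\<close>; the unconstrained system is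
  the case \<open>l = 0\<close>, for which every condition on the \<open>f j\<close> or on the constraint set is void.
\<close>

definition C1_on :: "'a::real_normed_vector set \<Rightarrow> ('a \<Rightarrow> 'b::real_normed_vector) \<Rightarrow> bool" where
  "C1_on S h \<longleftrightarrow>
     (\<exists>h'. (\<forall>x\<in>S. (h has_derivative blinfun_apply (h' x)) (at x)) \<and> continuous_on S h')"

text \<open>Derivatives are taken in the full space, so these two notions are meant for open \<open>S\<close>.\<close>

definition C2_on :: "'a::real_normed_vector set \<Rightarrow> ('a \<Rightarrow> 'b::real_normed_vector) \<Rightarrow> bool" where
  "C2_on S h \<longleftrightarrow>
     (\<exists>h'. (\<forall>x\<in>S. (h has_derivative blinfun_apply (h' x)) (at x)) \<and> C1_on S h')"

definition partial :: "'k::finite \<Rightarrow> (real ^ 'k \<Rightarrow> real) \<Rightarrow> real ^ 'k \<Rightarrow> real" where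
  "partial i h z = deriv (\<lambda>s. h (z + s *\<^sub>R axis i 1)) 0"

text \<open>The vector \<open>(0, 2 \<pi> p)\<close>; only the angular components of \<open>p\<close> matter.\<close>

definition ang_shift :: "'k::finite set \<Rightarrow> int ^ 'k \<Rightarrow> real ^ 'k" where
  "ang_shift ang p = (\<chi> i. if i \<in> ang then 2 * pi * of_int (p $ i) else 0)"

definition tz_periodic ::
    "real \<Rightarrow> 'k::finite set \<Rightarrow> (real ^ 'k) set \<Rightarrow> (real \<Rightarrow> real ^ 'k \<Rightarrow> 'b) \<Rightarrow> bool" where
  "tz_periodic \<omega> ang D h \<longleftrightarrow>
     (\<forall>t. \<forall>z\<in>D. h (t + \<omega>) z = h t z \<and> (\<forall>j\<in>ang. h t (z + (2 * pi) *\<^sub>R axis j 1) = h t z))"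

text \<open>
  The coefficients \<open>a\<^sub>i\<close> form one vector \<open>a t z\<close>, and a bound on \<open>\<bar>a\<^sub>i(t, z)\<bar>\<close> is meant as a bound on its
  Euclidean norm. With a componentwise bound, \<open>K - M \<omega> / \<surd>2 - A \<omega>\<^sup>2 / 2 > 0\<close> would not control
  \<open>a\<^sub>i v\<^sup>i\<close> independently of the dimension.
\<close>

definition Lagrangian ::
    "(real \<Rightarrow> real ^ 'k \<Rightarrow> real ^ 'k ^ 'k) \<Rightarrow> (real \<Rightarrow> real ^ 'k \<Rightarrow> real ^ 'k)
      \<Rightarrow> (real \<Rightarrow> real ^ 'k \<Rightarrow> real) \<Rightarrow> real \<Rightarrow> real ^ 'k \<Rightarrow> real ^ 'k::finite \<Rightarrow> real" where
  "Lagrangian g a V t z v =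
     1/2 * (\<Sum>i\<in>UNIV. \<Sum>j\<in>UNIV. g t z $ i $ j * v $ i * v $ j)
       + (\<Sum>i\<in>UNIV. a t z $ i * v $ i) - V t z"

definition constraint_set ::
    "nat \<Rightarrow> (nat \<Rightarrow> real \<Rightarrow> real ^ 'k \<Rightarrow> real) \<Rightarrow> real \<Rightarrow> (real ^ 'k::finite) set" where
  "constraint_set l f t = {z. \<forall>j<l. f j t z = 0}"

text \<open>The row rank of the \<open>l \<times> (m + n)\<close> matrix \<open>\<partial>f\<^sub>j/\<partial>z\<^sup>k (t, z)\<close>, which is how \<^const>\<open>rank\<close> is
  defined; the number of rows is not a type here, so \<^const>\<open>rank\<close> itself does not apply.\<close>

definition constraint_rank ::
    "nat \<Rightarrow> (nat \<Rightarrow> real \<Rightarrow> real ^ 'k \<Rightarrow> real) \<Rightarrow> real \<Rightarrow> real ^ 'k::finite \<Rightarrow> nat" where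
  "constraint_rank l f t z = dim {(\<chi> k. partial k (f j t) z) |j. j < l}"

definition is_solution ::
    "(real \<Rightarrow> real ^ 'k \<Rightarrow> real ^ 'k \<Rightarrow> real) \<Rightarrow> (real ^ 'k) set
      \<Rightarrow> nat \<Rightarrow> (nat \<Rightarrow> real \<Rightarrow> real ^ 'k \<Rightarrow> real) \<Rightarrow> (real \<Rightarrow> real ^ 'k::finite) \<Rightarrow> bool" where
  "is_solution L \<sigma> l f z \<longleftrightarrow>
     C2_on UNIV z \<and> (\<forall>t. z t \<notin> \<sigma>) \<and>
     (\<exists>\<alpha>. (\<forall>j<l. continuous_on UNIV (\<alpha> j)) \<and>
       (\<forall>t. z t \<in> constraint_set l f t \<and>
         (\<forall>i. \<exists>D.
            ((\<lambda>s. partial i (\<lambda>v. L s (z s) v) (vector_derivative z (at s))) has_real_derivative D) (at t) \<and>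
            D - partial i (\<lambda>y. L t y (vector_derivative z (at t))) (z t)
              = (\<Sum>j<l. \<alpha> j t * partial i (f j t) (z t)))))"

text \<open>The set \<open>\<V>\<^sub>p\<close>.\<close>

definition curves ::
    "real \<Rightarrow> 'k::finite set \<Rightarrow> (real ^ 'k) set \<Rightarrow> nat \<Rightarrow> (nat \<Rightarrow> real \<Rightarrow> real ^ 'k \<Rightarrow> real)
      \<Rightarrow> int ^ 'k \<Rightarrow> (real \<Rightarrow> real ^ 'k) set" where
  "curves \<omega> ang \<sigma> l f p =
     {z. continuous_on UNIV z \<and>
         (\<forall>t. z t \<notin> \<sigma> \<and> z (t + \<omega>) = z t + ang_shift ang p \<and> z t \<in> constraint_set l f t)}"

text \<open>The homotopy class of \<open>w\<close> in \<open>\<V>\<^sub>p\<close>: all intermediate curves lie in \<open>\<V>\<^sub>p\<close>.\<close>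

definition curve_class ::
    "real \<Rightarrow> 'k::finite set \<Rightarrow> (real ^ 'k) set \<Rightarrow> nat \<Rightarrow> (nat \<Rightarrow> real \<Rightarrow> real ^ 'k \<Rightarrow> real)
      \<Rightarrow> int ^ 'k \<Rightarrow> (real \<Rightarrow> real ^ 'k) \<Rightarrow> (real \<Rightarrow> real ^ 'k) set" where
  "curve_class \<omega> ang \<sigma> l f p w =
     {z \<in> curves \<omega> ang \<sigma> l f p.
        homotopic_with_canon (\<lambda>y. y \<in> curves \<omega> ang \<sigma> l f p) UNIV (- \<sigma>) w z}"

end

theory Submission
  imports Defs "HOL-Complex_Analysis.Great_Picard"
begin

text \<open>
  Write \<open>T = \<omega>/2\<close>. An odd curve of \<open>\<V>\<^sub>\<nu>\<close> is determined by its restriction to \<open>[0, T]\<close>, which joins \<open>0\<close>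
  to the fixed point \<open>e\<close>, half the shift by \<open>2 \<pi> \<nu>\<close>; so the solution is sought as a minimiser of the
  action with fixed ends. Minimise, over sequences of points of \<open>F(k T/N)\<close> whose interpolation stays in
  the homotopy class, the discrete action with step \<open>T/N\<close>. The coercivity condition bounds the energy of
  the minimisers and the term \<open>- P / \<bar>z - \<sigma>'\<bar>\<^sup>2\<close> (the strong force) keeps them away from \<open>\<sigma>\<close>, uniformly
  in \<open>N\<close>. The discrete Euler--Lagrange equations then bound first the total variation and next the
  Lipschitz constant of the discrete velocities, and a subsequence converges to a \<open>C\<^sup>2\<close> solution on
  \<open>[0, T]\<close>. Its odd quasi-periodic extension solves the system everywhere, because the maps
  \<open>(t, z) \<mapsto> (-t, -z)\<close> and \<open>(t, z) \<mapsto> (t + \<omega>, z + 2 e)\<close> leave the equations invariant. Full rank at the origin excludes even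
  constraint functions, so the \<open>f\<^sub>j\<close> are odd.
\<close>

section \<open>Uniform differentiability on compact sets\<close>

text \<open>Discretising replaces weak compactness in a Sobolev space: each discrete problem is a
  minimisation in finite dimension, and the limit needs only Arzela-Ascoli. There are two prices. A
  polygon with vertices in the constraint sets leaves them between the vertices, so homotopy classes
  are read off after a retraction, defined near a compact set that holds the vertices of all
  competitors of bounded action. And the discrete equations bound a velocity jump only quadratically
  in the velocities, while the energy controls only their mean square; the jumps carry a factor
  \<open>h\<close>, and summing them closes the gap. Fixing the ends serves twice. The condition
  \<open>z 0 = 0\<close> bounds the square of the displacement by \<open>T\<close> times the energy,
  which is where \<open>K - M * T - A * T\<^sup>2\<close> comes from; and the ends have positive
  distance from \<sigma>, so the strong force estimate has a place to start. Acceleration and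
  multiplier are found together from one square linear system: the projection \<open>E\<close> fills
  the equations that carry no constraint, and orthogonality of its kernel and range separates the
  two parts again.\<close>

lemma compact_uniform_strict_derivative:
  fixes h :: "'a::euclidean_space \<Rightarrow> 'b::real_normed_vector"
    and h' :: "'a \<Rightarrow> 'a \<Rightarrow>\<^sub>L 'b"
  assumes "open U"
    and deriv: "\<And>x. x \<in> U \<Longrightarrow> (h has_derivative blinfun_apply (h' x)) (at x)"
    and cont: "continuous_on U h'"
    and "compact K" "K \<subseteq> U" "0 < e"
  obtains d where "0 < d"
    "\<And>x y z. x \<in> K \<Longrightarrow> norm y < d \<Longrightarrow> norm z < d \<Longrightarrow>
       x + y \<in> U \<and> norm (h (x + y) - h (x + z) - h' x (y - z)) \<le> e * norm (y - z)"
proof -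
  obtain d0 where d0: "0 < d0" "(\<Union>x\<in>K. ball x d0) \<subseteq> U"
    using compact_subset_open_imp_ball_epsilon_subset[OF \<open>compact K\<close> \<open>open U\<close> \<open>K \<subseteq> U\<close>] by blast
  define K' where "K' = {x + y |x y. x \<in> K \<and> y \<in> cball 0 (d0/2)}"
  have "compact K'"
    unfolding K'_def by (intro compact_sums \<open>compact K\<close> compact_cball)
  have "K' \<subseteq> U"
  proof
    fix u assume "u \<in> K'"
    then obtain x y where u: "u = x + y" "x \<in> K" "norm y \<le> d0/2"
      unfolding K'_def by auto
    have "u \<in> ball x d0" using u d0 by (simp add: dist_norm)
    then show "u \<in> U" using d0 u by blast
  qed
  have "uniformly_continuous_on K' h'"
    using compact_uniformly_continuous[OF continuous_on_subset[OF cont \<open>K' \<subseteq> U\<close>] \<open>compact K'\<close>] .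
  then obtain d1 where d1: "0 < d1"
    "\<And>u v. u \<in> K' \<Longrightarrow> v \<in> K' \<Longrightarrow> dist v u < d1 \<Longrightarrow> dist (h' v) (h' u) < e"
    unfolding uniformly_continuous_on_def using \<open>0 < e\<close> by metis
  define d where "d = min (d0/2) d1"
  have dpos: "0 < d" using d0 d1 by (simp add: d_def)
  show ?thesis
  proof
    show "0 < d" by (fact dpos)
    fix x y z :: 'a assume x: "x \<in> K" and y: "norm y < d" and z: "norm z < d"
    have inK: "u \<in> K'" if "u \<in> ball x d" for u
    proof -
      have "u = x + (u - x)" "norm (u - x) \<le> d0/2"
        using that by (auto simp: d_def dist_norm norm_minus_commute)
      then show ?thesis unfolding K'_def using x by (metis (mono_tags, lifting) CollectI mem_cball_0)
    qed
    have xK: "x \<in> K'" using inK dpos by simp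
    \<comment> \<open>Mean value inequality for \<open>h\<close> minus its linearisation at the
      centre \<open>x\<close>: uniform continuity of \<open>h'\<close> on the closed neighbourhood
      \<open>K'\<close> makes the derivative of the difference at most \<open>e\<close>, with a
      radius independent of \<open>x\<close>. Two free increments, rather than one, are what the
      contraction in \<open>retraction\<close> needs.\<close>
    have "norm ((h (x + y) - h' x (x + y)) - (h (x + z) - h' x (x + z))) \<le> e * norm ((x + y) - (x + z))"
    proof (rule differentiable_bound[where f' = "\<lambda>u. blinfun_apply (h' u - h' x)"])
      show "convex (ball x d)" by simp
      fix u assume u: "u \<in> ball x d"
      have "u \<in> U" using inK u \<open>K' \<subseteq> U\<close> by blast
      have "((\<lambda>u. h u - h' x u) has_derivative (\<lambda>v. h' u v - h' x v)) (at u)"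
        by (intro has_derivative_diff deriv[OF \<open>u \<in> U\<close>] bounded_linear_imp_has_derivative
            blinfun.bounded_linear_right)
      moreover have "blinfun_apply (h' u - h' x) = (\<lambda>v. h' u v - h' x v)"
        by (auto simp: blinfun.diff_left)
      ultimately show "((\<lambda>u. h u - h' x u) has_derivative blinfun_apply (h' u - h' x)) (at u within ball x d)"
        by (simp add: has_derivative_at_withinI)
      have "dist (h' u) (h' x) < e"
        using d1(2)[OF xK inK[OF u]] u by (simp add: d_def dist_commute)
      then show "onorm (blinfun_apply (h' u - h' x)) \<le> e"
        by (simp add: dist_norm norm_blinfun.rep_eq)
    qed (use y z in \<open>auto simp: dist_norm\<close>)
    then show "x + y \<in> U \<and> norm (h (x + y) - h (x + z) - h' x (y - z)) \<le> e * norm (y - z)"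
      using inK[of "x + y"] y \<open>K' \<subseteq> U\<close>
      by (auto simp: dist_norm blinfun.bilinear_simps algebra_simps)
  qed
qed

lemma compact_uniform_lipschitz:
  fixes h :: "'a::euclidean_space \<Rightarrow> 'b::real_normed_vector"
    and h' :: "'a \<Rightarrow> 'a \<Rightarrow>\<^sub>L 'b"
  assumes "open U"
    and deriv: "\<And>x. x \<in> U \<Longrightarrow> (h has_derivative blinfun_apply (h' x)) (at x)"
    and cont: "continuous_on U h'"
    and "compact K" "K \<subseteq> U"
  obtains d L where "0 < d" "0 \<le> L"
    "\<And>x y. x \<in> K \<Longrightarrow> norm y < d \<Longrightarrow> norm (h (x + y) - h x) \<le> L * norm y"
proof -
  obtain d where d: "0 < d" "\<And>x y z. x \<in> K \<Longrightarrow> norm y < d \<Longrightarrow> norm z < d \<Longrightarrow>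
       x + y \<in> U \<and> norm (h (x + y) - h (x + z) - h' x (y - z)) \<le> 1 * norm (y - z)"
    using compact_uniform_strict_derivative[OF assms zero_less_one] by blast
  have "compact (h' ` K)"
    using compact_continuous_image continuous_on_subset assms by blast
  then obtain B where B: "\<And>x. x \<in> K \<Longrightarrow> norm (h' x) \<le> B" "0 < B"
    by (metis bounded_pos compact_imp_bounded image_eqI)
  show ?thesis
  proof
    show "0 < d" by (fact d)
    show "0 \<le> B + 1" using B by simp
    fix x y :: 'a assume x: "x \<in> K" and y: "norm y < d"
    have "norm (h (x + y) - h x - h' x y) \<le> norm y"
      using d(2)[OF x y, of 0] d(1) by simp
    moreover have "norm (h' x y) \<le> B * norm y"
      by (meson B(1) x norm_blinfun mult_right_mono norm_ge_zero order_trans)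
    ultimately have "norm (h (x + y) - h x) \<le> norm y + B * norm y"
      by (smt (verit) norm_triangle_sub)
    then show "norm (h (x + y) - h x) \<le> (B + 1) * norm y" by (simp add: algebra_simps)
  qed
qed

lemma compact_uniform_taylor2:
  fixes h :: "'a::euclidean_space \<Rightarrow> 'b::real_normed_vector"
    and h' :: "'a \<Rightarrow> 'a \<Rightarrow>\<^sub>L 'b" and h'' :: "'a \<Rightarrow> 'a \<Rightarrow>\<^sub>L 'a \<Rightarrow>\<^sub>L 'b"
  assumes "open U"
    and deriv: "\<And>x. x \<in> U \<Longrightarrow> (h has_derivative blinfun_apply (h' x)) (at x)"
    and deriv2: "\<And>x. x \<in> U \<Longrightarrow> (h' has_derivative blinfun_apply (h'' x)) (at x)"
    and cont: "continuous_on U h''"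
    and "compact K" "K \<subseteq> U" "0 < e"
  obtains d where "0 < d"
    "\<And>x y. x \<in> K \<Longrightarrow> norm y < d \<Longrightarrow>
       norm (h (x + y) - h x - h' x y - (1/2) *\<^sub>R h'' x y y) \<le> e * (norm y)\<^sup>2"
proof -
  obtain d where d: "0 < d" "\<And>x y z. x \<in> K \<Longrightarrow> norm y < d \<Longrightarrow> norm z < d \<Longrightarrow>
       x + y \<in> U \<and> norm (h' (x + y) - h' (x + z) - h'' x (y - z)) \<le> e * norm (y - z)"
    using compact_uniform_strict_derivative[OF \<open>open U\<close> deriv2 cont \<open>compact K\<close> \<open>K \<subseteq> U\<close> \<open>0 < e\<close>] by blast
  show ?thesis
  proof
    show "0 < d" by (fact d)
    fix x y :: 'a assume x: "x \<in> K" and y: "norm y < d"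
    \<comment> \<open>\<open>\<phi> 1 - \<phi> 0\<close> is the Taylor remainder, and the derivative
      of \<open>\<phi>\<close> is a first-order remainder of \<open>h'\<close> applied to
      \<open>y\<close>; so strict differentiability of \<open>h'\<close> is enough.\<close>
    define \<phi> where "\<phi> s = h (x + s *\<^sub>R y) - s *\<^sub>R h' x y - (s\<^sup>2/2) *\<^sub>R h'' x y y" for s :: real
    have "norm (\<phi> 1 - \<phi> 0) \<le> (e * (norm y)\<^sup>2) * norm (1 - 0 :: real)"
    proof (rule differentiable_bound[where S = "{0..1}"
          and f' = "\<lambda>s r. r *\<^sub>R (h' (x + s *\<^sub>R y) y - h' x y - s *\<^sub>R h'' x y y)"])
      fix s :: real assume s: "s \<in> {0..1}"
      have sy: "norm (s *\<^sub>R y) < d" "norm (s *\<^sub>R y) \<le> norm y"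
        using s y by (auto simp: mult_left_le_one_le intro: le_less_trans[rotated])
      have U: "x + s *\<^sub>R y \<in> U" using d(2)[OF x sy(1), of 0] d(1) by simp
      have "((\<lambda>s. h (x + s *\<^sub>R y)) has_derivative (\<lambda>r. h' (x + s *\<^sub>R y) (r *\<^sub>R y))) (at s)"
        by (rule has_derivative_compose[where g = h and f = "\<lambda>s. x + s *\<^sub>R y"])
           (auto intro!: derivative_eq_intros deriv U)
      then have "(\<phi> has_derivative (\<lambda>r. r *\<^sub>R (h' (x + s *\<^sub>R y) y - h' x y - s *\<^sub>R h'' x y y))) (at s)"
        unfolding \<phi>_def
        by (auto intro!: derivative_eq_intros simp: blinfun.bilinear_simps algebra_simps fun_eq_iff)
      then show "(\<phi> has_derivative (\<lambda>r. r *\<^sub>R (h' (x + s *\<^sub>R y) y - h' x y - s *\<^sub>R h'' x y y))) (at s within {0..1})"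
        by (rule has_derivative_at_withinI)
      have "norm (h' (x + s *\<^sub>R y) - h' x - h'' x (s *\<^sub>R y)) \<le> e * norm (s *\<^sub>R y)"
        using d(2)[OF x sy(1), of 0] d(1) by simp
      also have "\<dots> \<le> e * norm y" using sy \<open>0 < e\<close> by simp
      finally have "norm ((h' (x + s *\<^sub>R y) - h' x - h'' x (s *\<^sub>R y)) y) \<le> e * norm y * norm y"
        by (meson norm_blinfun mult_right_mono norm_ge_zero order_trans)
      then have bd: "norm (h' (x + s *\<^sub>R y) y - h' x y - s *\<^sub>R h'' x y y) \<le> e * (norm y)\<^sup>2"
        by (simp add: blinfun.bilinear_simps power2_eq_square mult.assoc)
      show "onorm (\<lambda>r. r *\<^sub>R (h' (x + s *\<^sub>R y) y - h' x y - s *\<^sub>R h'' x y y)) \<le> e * (norm y)\<^sup>2"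
        by (rule onorm_bound) (use bd \<open>0 < e\<close> in \<open>auto simp: mult.commute mult_left_mono\<close>)
    qed auto
    then show "norm (h (x + y) - h x - h' x y - (1/2) *\<^sub>R h'' x y y) \<le> e * (norm y)\<^sup>2"
      by (simp add: \<phi>_def algebra_simps)
  qed
qed

section \<open>Piecewise linear interpolation\<close>

definition clamp01 :: "real \<Rightarrow> real" where
  "clamp01 x = max 0 (min 1 x)"

text \<open>Written as a sum of clamped increments rather than by cases on the grid interval:
  continuity is immediate, and the increment over any interval becomes a nonnegative combination of
  the steps. For \<open>0 < h\<close> the function is constant outside
  \<open>[0, N h]\<close>.\<close>

definition polygon :: "real \<Rightarrow> nat \<Rightarrow> (nat \<Rightarrow> 'a::real_normed_vector) \<Rightarrow> real \<Rightarrow> 'a" where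
  "polygon h N y t = y 0 + (\<Sum>k<N. clamp01 (t / h - real k) *\<^sub>R (y (Suc k) - y k))"

lemma clamp01_mono: "x \<le> y \<Longrightarrow> clamp01 x \<le> clamp01 y"
  by (auto simp: clamp01_def)

lemma sum_clamp01: "0 \<le> x \<Longrightarrow> (\<Sum>k<N. clamp01 (x - real k)) = min x (real N)"
  by (induction N) (auto simp: clamp01_def)

lemma continuous_on_polygon: "h \<noteq> 0 \<Longrightarrow> continuous_on A (polygon h N y)"
  unfolding polygon_def clamp01_def by (intro continuous_intros) auto

lemma polygon_eq:
  assumes "0 < h" "k < N" "real k * h \<le> t" "t \<le> real (Suc k) * h"
  shows "polygon h N y t = y k + (t / h - real k) *\<^sub>R (y (Suc k) - y k)"
proof -
  have x: "real k \<le> t / h" "t / h \<le> real (Suc k)"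
    using assms by (auto simp: field_simps)
  have "(\<Sum>j<N. clamp01 (t / h - real j) *\<^sub>R (y (Suc j) - y j)) =
      (\<Sum>j<Suc k. clamp01 (t / h - real j) *\<^sub>R (y (Suc j) - y j))"
    by (rule sum.mono_neutral_right) (use assms x in \<open>auto simp: clamp01_def\<close>)
  also have "\<dots> = (\<Sum>j<k. y (Suc j) - y j) + (t / h - real k) *\<^sub>R (y (Suc k) - y k)"
  proof -
    have "(\<Sum>j<k. clamp01 (t / h - real j) *\<^sub>R (y (Suc j) - y j)) = (\<Sum>j<k. y (Suc j) - y j)"
      by (rule sum.cong) (use x in \<open>auto simp: clamp01_def min_def max_def\<close>)
    then show ?thesis using x by (simp add: clamp01_def)
  qed
  also have "(\<Sum>j<k. y (Suc j) - y j) = y k - y 0"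
    by (simp add: sum_lessThan_telescope)
  finally show ?thesis by (simp add: polygon_def)
qed

lemma grid_index:
  fixes h t :: real
  assumes "0 < h" "0 \<le> t" "t \<le> real N * h" "0 < N"
  obtains k where "k < N" "real k * h \<le> t" "t \<le> real (Suc k) * h"
proof (cases "t = real N * h")
  case True
  show ?thesis by (rule that[of "N - 1"]) (use assms True in \<open>auto simp: of_nat_diff algebra_simps\<close>)
next
  case False
  define k where "k = nat \<lfloor>t / h\<rfloor>"
  have k: "real k = \<lfloor>t / h\<rfloor>" using assms by (simp add: k_def)
  have "real k \<le> t / h" "t / h < real k + 1" using k by linarith+
  moreover have "t / h < real N" using False assms by (simp add: field_simps)
  moreover from calculation have "k < N" by linarith
  ultimately show ?thesis using assms by (intro that[of k]) (auto simp: field_simps)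
qed

lemma polygon_grid:
  assumes "0 < h" "k \<le> N" "0 < N"
  shows "polygon h N y (real k * h) = y k"
proof (cases "k = N")
  case True
  have "polygon h N y (real k * h) = y (N - 1) + (real k - real (N - 1)) *\<^sub>R (y (Suc (N - 1)) - y (N - 1))"
    using polygon_eq[of h "N - 1" N "real k * h" y] assms True
    by (auto simp: algebra_simps of_nat_diff)
  then show ?thesis using assms True by (simp add: of_nat_diff)
next
  case False
  then show ?thesis using polygon_eq[of h k N "real k * h" y] assms by (simp add: algebra_simps)
qed

lemma polygon_near:
  assumes "0 < h" "0 \<le> t" "t \<le> real N * h" "0 < N"
    and step: "\<And>k. k < N \<Longrightarrow> norm (y (Suc k) - y k) \<le> \<eta>"
  obtains k where "k < N" "\<bar>t - real k * h\<bar> \<le> h" "norm (polygon h N y t - y k) \<le> \<eta>"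
proof -
  obtain k where k: "k < N" "real k * h \<le> t" "t \<le> real (Suc k) * h"
    using grid_index assms by blast
  have r: "0 \<le> t / h - real k" "t / h - real k \<le> 1"
    using k assms by (auto simp: field_simps)
  have "norm (polygon h N y t - y k) = (t / h - real k) * norm (y (Suc k) - y k)"
    unfolding polygon_eq[OF assms(1) k] using r by simp
  also have "\<dots> \<le> norm (y (Suc k) - y k)" using r by (simp add: mult_left_le_one_le)
  also have "\<dots> \<le> \<eta>" using step k by blast
  finally show ?thesis using k by (intro that[of k]) (auto simp: algebra_simps)
qed

lemma polygon_diff_le:
  assumes "0 < h" "0 \<le> t" "t \<le> real N * h" "0 < N"
    and d: "\<And>k. k \<le> N \<Longrightarrow> norm (y k - y' k) \<le> \<eta>"
  shows "norm (polygon h N y t - polygon h N y' t) \<le> \<eta>"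
proof -
  obtain k where k: "k < N" "real k * h \<le> t" "t \<le> real (Suc k) * h"
    using grid_index assms by blast
  define r where "r = t / h - real k"
  have r: "0 \<le> r" "r \<le> 1" using k assms by (auto simp: field_simps r_def)
  have "polygon h N y t - polygon h N y' t = (1 - r) *\<^sub>R (y k - y' k) + r *\<^sub>R (y (Suc k) - y' (Suc k))"
    unfolding polygon_eq[OF assms(1) k] r_def[symmetric] by (simp add: algebra_simps)
  also have "norm \<dots> \<le> (1 - r) * \<eta> + r * \<eta>"
    by (rule order_trans[OF norm_triangle_ineq], rule add_mono)
       (use r d[of k] d[of "Suc k"] k in \<open>auto intro!: mult_left_mono\<close>)
  finally show ?thesis by (simp add: algebra_simps)
qed

text \<open>The weights of the steps in the increment from \<open>a\<close> to \<open>b\<close> are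
  nonnegative, vanish for grid cells that do not meet the open interval, and add up to
  \<open>(b - a) / h\<close>. So a bound on the steps near a point passes to the polygon and then to
  its limit.\<close>

lemma polygon_increment:
  assumes "0 < h" "0 \<le> a" "a \<le> b" "b \<le> real N * h"
    and step: "\<And>k. k < N \<Longrightarrow> real k * h < b \<Longrightarrow> a < real (Suc k) * h \<Longrightarrow>
      norm (y (Suc k) - y k - h *\<^sub>R x) \<le> c * h"
  shows "norm (polygon h N y b - polygon h N y a - (b - a) *\<^sub>R x) \<le> c * (b - a)"
proof -
  let ?w = "\<lambda>k. clamp01 (b / h - real k) - clamp01 (a / h - real k)"
  have x: "a / h \<le> b / h" "b / h \<le> real N" "0 \<le> a / h" "0 \<le> b / h" "a / h \<le> real N"
    using assms(1-4) by (auto simp: field_simps)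
  have w: "(\<Sum>k<N. ?w k) = b / h - a / h"
    using x by (simp add: sum_subtractf sum_clamp01)
  have "(b - a) *\<^sub>R x = (\<Sum>k<N. ?w k) *\<^sub>R (h *\<^sub>R x)"
    unfolding w scaleR_scaleR using assms(1) by (simp add: left_diff_distrib)
  then have 1: "(b - a) *\<^sub>R x = (\<Sum>k<N. ?w k *\<^sub>R (h *\<^sub>R x))"
    by (simp only: scaleR_sum_left)
  have 2: "polygon h N y b - polygon h N y a = (\<Sum>k<N. ?w k *\<^sub>R (y (Suc k) - y k))"
    by (simp add: polygon_def sum_subtractf scaleR_diff_left)
  have "polygon h N y b - polygon h N y a - (b - a) *\<^sub>R x =
     (\<Sum>k<N. ?w k *\<^sub>R (y (Suc k) - y k - h *\<^sub>R x))"
    unfolding 1 2 sum_subtractf[symmetric] scaleR_diff_right ..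
  also have "norm \<dots> \<le> (\<Sum>k<N. ?w k * (c * h))"
  proof (rule sum_norm_le)
    fix k assume k: "k \<in> {..<N}"
    have w0: "0 \<le> ?w k" using clamp01_mono x by simp
    show "norm (?w k *\<^sub>R (y (Suc k) - y k - h *\<^sub>R x)) \<le> ?w k * (c * h)"
    proof (cases "?w k = 0")
      case False
      have "real k < b / h"
      proof (rule ccontr)
        assume "\<not> ?thesis" then show False using False x by (auto simp: clamp01_def)
      qed
      moreover have "a / h < real (Suc k)"
      proof (rule ccontr)
        assume "\<not> ?thesis" then show False using False x by (auto simp: clamp01_def)
      qed
      ultimately have "norm (y (Suc k) - y k - h *\<^sub>R x) \<le> c * h"
        using step[of k] k assms(1) by (simp add: field_simps)
      then show ?thesis using w0 by (simp add: mult_left_mono)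
    qed simp
  qed
  also have "\<dots> = c * (b - a)"
    unfolding sum_distrib_right[symmetric] w using assms(1) by (simp add: field_simps)
  finally show ?thesis .
qed

lemma polygon_lipschitz:
  assumes "0 < h" "0 \<le> s" "0 \<le> t" "s \<le> real N * h" "t \<le> real N * h"
    and step: "\<And>k. k < N \<Longrightarrow> norm (y (Suc k) - y k) \<le> C * h"
  shows "norm (polygon h N y t - polygon h N y s) \<le> C * \<bar>t - s\<bar>"
  using assms(2-5)
proof (induction s t rule: linorder_wlog)
  case (le s t)
  then show ?case
    using polygon_increment[where h = h and a = s and b = t and N = N and y = y and x = 0 and c = C]
      assms(1) step by simp
next
  case (sym s t)
  then show ?case by (simp add: norm_minus_commute abs_minus_commute)
qed

section \<open>Limits of difference schemes\<close>

text \<open>A version of Peano's theorem. The Lipschitz bound gives a uniform limit by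
  Arzela-Ascoli; its derivative is found by comparing short increments with
  \<open>X (t, Y t)\<close>, without an integral equation. The residual may be taken at any nearby
  \<open>p\<close> in \<open>D\<close>, because the scheme it is applied to is implicit and
  \<open>X\<close> is controlled on \<open>D\<close> only.\<close>

lemma difference_scheme_limit:
  fixes X :: "real \<times> 'b::euclidean_space \<Rightarrow> 'b" and y :: "nat \<Rightarrow> nat \<Rightarrow> 'b"
  assumes "0 < T" and "compact D" and "continuous_on D X"
    and N: "\<And>n. 0 < N n" "filterlim N at_top sequentially"
    and h: "\<And>n. h n = T / real (N n)"
    and inD: "\<And>n k. k \<le> N n \<Longrightarrow> (real k * h n, y n k) \<in> D"
    and step: "\<And>n k. k < N n \<Longrightarrow> norm (y n (Suc k) - y n k) \<le> C * h n"
    and res: "\<And>e. 0 < e \<Longrightarrow> \<forall>\<^sub>F n in sequentially. \<forall>k<N n. \<exists>p\<in>D.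
        dist p (real k * h n, y n k) \<le> e \<and> norm (y n (Suc k) - y n k - h n *\<^sub>R X p) \<le> e * h n"
  obtains Y r where "strict_mono (r :: nat \<Rightarrow> nat)"
    "\<forall>t\<in>{0..T}. (t, Y t) \<in> D"
    "\<forall>t\<in>{0..T}. (Y has_vector_derivative X (t, Y t)) (at t within {0..T})"
    "\<forall>e>0. \<exists>n0. \<forall>n\<ge>n0. \<forall>t\<in>{0..T}. norm (polygon (h (r n)) (N (r n)) (y (r n)) t - Y t) < e"
proof -
  have hpos: "0 < h n" for n using h N \<open>0 < T\<close> by simp
  have Nh: "real (N n) * h n = T" for n using h N(1)[of n] by simp
  have h0: "h \<longlonglongrightarrow> 0"
    unfolding h by (intro tendsto_divide_0[OF tendsto_const] filterlim_at_top_imp_at_infinity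
        filterlim_compose[OF filterlim_real_sequentially N(2)])
  obtain R where R: "\<And>p. p \<in> D \<Longrightarrow> norm p \<le> R" "0 < R"
    by (metis bounded_pos compact_imp_bounded \<open>compact D\<close>)
  have "0 \<le> C * h 0" using step[of 0 0] N(1)[of 0] norm_ge_zero order_trans by blast
  then have C0: "0 \<le> C" using hpos[of 0] by (simp add: zero_le_mult_iff)
  let ?P = "\<lambda>n. polygon (h n) (N n) (y n)"
  have lip: "norm (?P n t - ?P n s) \<le> C * \<bar>t - s\<bar>" if "s \<in> {0..T}" "t \<in> {0..T}" for n s t
    using polygon_lipschitz[where h = "h n" and s = s and t = t and N = "N n" and y = "y n" and C = C] hpos that step Nh by simp
  have yR: "norm (y n k) \<le> R" if "k \<le> N n" for n k
    using R(1)[OF inD[OF that]] norm_snd_le[of "y n k" "real k * h n"] by simp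
  have bound: "norm (?P n t) \<le> R + C * T" if t: "t \<in> {0..T}" for n t
  proof -
    have "?P n 0 = y n 0" using polygon_grid[OF hpos[of n], of 0 "N n" "y n"] N by simp
    moreover have "norm (?P n t - ?P n 0) \<le> C * T"
      using lip[of 0 t n] t C0 \<open>0 < T\<close> by (smt (verit) atLeastAtMost_iff mult_left_mono)
    ultimately show ?thesis using yR[of 0 n] norm_triangle_sub[of "?P n t" "?P n 0"] by simp
  qed
  obtain Y r where Y: "continuous_on {0..T} Y" and r: "strict_mono (r :: nat \<Rightarrow> nat)"
    and unif: "\<And>e. 0 < e \<Longrightarrow> \<exists>n0. \<forall>n t. n \<ge> n0 \<and> t \<in> {0..T} \<longrightarrow> norm (?P (r n) t - Y t) < e"
  proof (rule Arzela_Ascoli[of "{0..T}" ?P "R + C * T"])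
    fix t e :: real assume "t \<in> {0..T}" "0 < e"
    show "\<exists>d>0. \<forall>n s. s \<in> {0..T} \<and> norm (t - s) < d \<longrightarrow> norm (?P n t - ?P n s) < e"
    proof (intro exI[of _ "e / (C + 1)"] conjI allI impI)
      fix n s assume s: "s \<in> {0..T} \<and> norm (t - s) < e / (C + 1)"
      have "norm (?P n t - ?P n s) \<le> C * \<bar>t - s\<bar>" using lip s \<open>t \<in> {0..T}\<close> by blast
      also have "\<dots> \<le> (C + 1) * \<bar>t - s\<bar>" by (intro mult_right_mono) auto
      also have "\<dots> < e" using s C0 by (simp add: field_simps)
      finally show "norm (?P n t - ?P n s) < e" .
    qed (use \<open>0 < e\<close> C0 in simp)
  qed (use bound in auto)
  have rlim: "filterlim r sequentially sequentially"
    using r filterlim_subseq by blast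
  have lim: "(\<lambda>n. ?P (r n) t) \<longlonglongrightarrow> Y t" if "t \<in> {0..T}" for t
  proof (rule LIMSEQ_I)
    fix e :: real assume "0 < e"
    then show "\<exists>n0. \<forall>n\<ge>n0. norm (?P (r n) t - Y t) < e" using unif[of e] that by blast
  qed
  have Ylip: "norm (Y t - Y s) \<le> C * \<bar>t - s\<bar>" if "s \<in> {0..T}" "t \<in> {0..T}" for s t
    by (rule LIMSEQ_le_const2[OF tendsto_norm[OF tendsto_diff[OF lim[OF that(2)] lim[OF that(1)]]]])
       (use lip[OF that] in auto)
  have hr: "(\<lambda>n. h (r n)) \<longlonglongrightarrow> 0"
    by (rule filterlim_compose[OF h0 rlim])
  show ?thesis
  proof (rule that[OF r]; intro ballI allI impI)
    fix t assume t: "t \<in> {0..T}"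
    show "(t, Y t) \<in> D"
    proof -
      have "\<exists>k<N n. \<bar>t - real k * h n\<bar> \<le> h n \<and> norm (?P n t - y n k) \<le> C * h n" for n
      proof -
        have "t \<le> real (N n) * h n" unfolding Nh using t by simp
        then obtain k where "k < N n" "\<bar>t - real k * h n\<bar> \<le> h n" "norm (?P n t - y n k) \<le> C * h n"
          using polygon_near[where h = "h n" and N = "N n" and y = "y n" and t = t and \<eta> = "C * h n"]
            hpos N(1) step t by (metis atLeastAtMost_iff)
        then show ?thesis by blast
      qed
      then obtain k where k: "\<And>n. k n < N n" "\<And>n. \<bar>t - real (k n) * h n\<bar> \<le> h n"
        "\<And>n. norm (?P n t - y n (k n)) \<le> C * h n" by metis
      have 1: "(\<lambda>n. real (k (r n)) * h (r n) - t) \<longlonglongrightarrow> 0"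
        by (rule Lim_null_comparison[OF _ hr]) (use k(2) in \<open>auto simp: abs_minus_commute\<close>)
      have 2: "(\<lambda>n. y (r n) (k (r n)) - ?P (r n) t) \<longlonglongrightarrow> 0"
        by (rule Lim_null_comparison[OF _ tendsto_mult_right_zero[OF hr, of C]])
           (use k(3) in \<open>auto simp: norm_minus_commute\<close>)
      have "(\<lambda>n. (real (k (r n)) * h (r n), y (r n) (k (r n)))) \<longlonglongrightarrow> (t, Y t)"
        using tendsto_add[OF 2 lim[OF t]] LIM_zero_cancel[OF 1] by (intro tendsto_Pair) auto
      then show ?thesis
        by (rule closed_sequentially[OF compact_imp_closed[OF \<open>compact D\<close>], rotated])
           (use inD k(1) less_imp_le in blast)
    qed
    show "(Y has_vector_derivative X (t, Y t)) (at t within {0..T})"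
      unfolding has_vector_derivative_def has_derivative_within_alt
    proof (intro conjI allI impI)
      fix e :: real assume e: "0 < e"
      obtain \<delta> where \<delta>: "0 < \<delta>" "\<And>p. p \<in> D \<Longrightarrow> dist p (t, Y t) < \<delta> \<Longrightarrow> norm (X p - X (t, Y t)) < e"
        using \<open>continuous_on D X\<close> \<open>(t, Y t) \<in> D\<close> e
        unfolding continuous_on_iff by (metis dist_norm)
      \<comment> \<open>With this \<open>d\<close>, a grid point relevant to times within
        \<open>d\<close> of \<open>t\<close> has distance below
        \<open>\<delta> / 2 + \<delta> / 8\<close> from \<open>(t, Y t)\<close>; moving on to
        \<open>p\<close> costs less than another \<open>\<delta> / 8\<close>, so \<open>p\<close>
        stays within \<open>\<delta>\<close>.\<close>
      define d where "d = \<delta> / (4 * (1 + C))"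
      have d: "0 < d" "(1 + C) * d = \<delta> / 4" using \<delta>(1) C0 by (auto simp: d_def field_simps)
      have key0: "norm (Y b - Y a - (b - a) *\<^sub>R X (t, Y t)) \<le> (e + e') * (b - a)"
        if ab: "a \<le> b" "0 \<le> a" "b \<le> T" "\<bar>a - t\<bar> < d" "\<bar>b - t\<bar> < d" and e': "0 < e'" for a b e'
      proof -
        define e'' where "e'' = min e' (\<delta> / 9)"
        have e'': "0 < e''" "e'' \<le> e'" "e'' < \<delta> / 8" using e' \<delta>(1) by (auto simp: e''_def)
        have "\<forall>\<^sub>F n in sequentially. h (r n) < d"
          by (rule order_tendstoD(2)[OF hr d(1)])
        moreover have "\<forall>\<^sub>F n in sequentially. \<forall>k<N (r n). \<exists>p\<in>D. dist p (real k * h (r n), y (r n) k) \<le> e'' \<and>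
            norm (y (r n) (Suc k) - y (r n) k - h (r n) *\<^sub>R X p) \<le> e'' * h (r n)"
          using eventually_compose_filterlim[OF res[OF e''(1)] rlim] .
        moreover have "\<forall>\<^sub>F n in sequentially. \<forall>s\<in>{0..T}. norm (?P (r n) s - Y s) < \<delta> / 8"
          using unif[of "\<delta> / 8"] \<delta>(1) unfolding eventually_sequentially by fastforce
        ultimately have ev: "\<forall>\<^sub>F n in sequentially.
            norm (?P (r n) b - ?P (r n) a - (b - a) *\<^sub>R X (t, Y t)) \<le> (e + e') * (b - a)"
        proof eventually_elim
          case (elim n)
          show ?case
          proof (rule polygon_increment)
            fix k assume k: "k < N (r n)" "real k * h (r n) < b" "a < real (Suc k) * h (r n)"
            have kT: "real k * h (r n) \<in> {0..T}"
              using k ab hpos[of "r n"] by (auto simp: less_imp_le)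
            have kt: "\<bar>real k * h (r n) - t\<bar> < 2 * d"
              using k ab elim(1) by (auto simp: algebra_simps abs_less_iff)
            have yk: "?P (r n) (real k * h (r n)) = y (r n) k"
              using polygon_grid[OF hpos[of "r n"], of k "N (r n)" "y (r n)"] k N by simp
            have "norm (y (r n) k - Y t) < \<delta> / 8 + C * (2 * d)"
            proof -
              have "norm (y (r n) k - Y (real k * h (r n))) < \<delta> / 8"
                using elim(3) kT yk by metis
              moreover have "norm (Y (real k * h (r n)) - Y t) \<le> C * (2 * d)"
                using Ylip[OF t kT] kt C0 by (smt (verit) mult_left_mono)
              ultimately show ?thesis
                using norm_triangle_ineq[of "y (r n) k - Y (real k * h (r n))" "Y (real k * h (r n)) - Y t"]
                by simp
            qed
            then have "dist (real k * h (r n), y (r n) k) (t, Y t) < 2 * d + (\<delta> / 8 + C * (2 * d))"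
              using kt norm_Pair_le[of "real k * h (r n) - t" "y (r n) k - Y t"]
              by (simp add: dist_norm)
            also have "\<dots> = 2 * ((1 + C) * d) + \<delta> / 8" by (simp add: algebra_simps)
            finally have near: "dist (real k * h (r n), y (r n) k) (t, Y t) < \<delta> / 2 + \<delta> / 8"
              using d(2) by simp
            obtain p where p: "p \<in> D" "dist p (real k * h (r n), y (r n) k) \<le> e''"
              "norm (y (r n) (Suc k) - y (r n) k - h (r n) *\<^sub>R X p) \<le> e'' * h (r n)"
              using elim(2) k(1) by blast
            have "dist p (t, Y t) < \<delta>"
              using near p(2) e''(3) \<delta>(1) dist_triangle[of p "(t, Y t)" "(real k * h (r n), y (r n) k)"]
              by linarith
            then have "norm (X p - X (t, Y t)) \<le> e" using \<delta>(2) p(1) less_imp_le by blast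
            then have "norm (h (r n) *\<^sub>R (X p - X (t, Y t))) \<le> e * h (r n)"
              using hpos[of "r n"] by (simp add: mult.commute)
            then have "norm (y (r n) (Suc k) - y (r n) k - h (r n) *\<^sub>R X p + h (r n) *\<^sub>R (X p - X (t, Y t)))
                \<le> e'' * h (r n) + e * h (r n)"
              using p(3) by (rule norm_triangle_le[OF add_mono, rotated])
            also have "\<dots> \<le> e' * h (r n) + e * h (r n)" using e''(2) hpos[of "r n"] by simp
            finally show "norm (y (r n) (Suc k) - y (r n) k - h (r n) *\<^sub>R X (t, Y t)) \<le> (e + e') * h (r n)"
              by (simp add: algebra_simps)
          qed (use ab hpos Nh in auto)
        qed
        have "a \<in> {0..T}" "b \<in> {0..T}" using ab by auto
        then have lhs: "(\<lambda>n. norm (?P (r n) b - ?P (r n) a - (b - a) *\<^sub>R X (t, Y t)))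
            \<longlonglongrightarrow> norm (Y b - Y a - (b - a) *\<^sub>R X (t, Y t))"
          by (intro tendsto_intros lim)
        show ?thesis using tendsto_upperbound[OF lhs ev] by simp
      qed
      \<comment> \<open>The consistency error \<open>e'\<close> can be made arbitrarily small by
        taking \<open>n\<close> large, so it drops out while \<open>e\<close> stays.\<close>
      have key: "norm (Y b - Y a - (b - a) *\<^sub>R X (t, Y t)) \<le> e * (b - a)"
        if ab: "a \<le> b" "0 \<le> a" "b \<le> T" "\<bar>a - t\<bar> < d" "\<bar>b - t\<bar> < d" for a b
      proof (rule field_le_epsilon)
        fix e' :: real assume e': "0 < e'"
        show "norm (Y b - Y a - (b - a) *\<^sub>R X (t, Y t)) \<le> e * (b - a) + e'"
        proof (cases "a = b")
          case False
          then have "0 < e' / (b - a)" using ab(1) e' by simp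
          from key0[OF ab this] show ?thesis using ab(1) False by (simp add: distrib_right)
        qed (use e' in simp)
      qed
      show "\<exists>d>0. \<forall>s\<in>{0..T}. norm (s - t) < d \<longrightarrow>
          norm (Y s - Y t - (s - t) *\<^sub>R X (t, Y t)) \<le> e * norm (s - t)"
      proof (intro exI[of _ d] conjI ballI impI d(1))
        fix s assume s: "s \<in> {0..T}" "norm (s - t) < d"
        show "norm (Y s - Y t - (s - t) *\<^sub>R X (t, Y t)) \<le> e * norm (s - t)"
        proof (cases "t \<le> s")
          case True
          then show ?thesis using key[of t s] s t d by simp
        next
          case False
          have "norm (Y s - Y t - (s - t) *\<^sub>R X (t, Y t)) = norm (Y t - Y s - (t - s) *\<^sub>R X (t, Y t))"
            by (subst norm_minus_cancel[symmetric]) (simp add: algebra_simps)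
          then show ?thesis using key[of s t] s t d False by simp
        qed
      qed
    qed (rule bounded_linear_scaleR_left)
  next
    fix e :: real assume "0 < e"
    then show "\<exists>n0. \<forall>n\<ge>n0. \<forall>t\<in>{0..T}. norm (?P (r n) t - Y t) < e"
      using unif[of e] by fast
  qed
qed

text \<open>The jumps grow quadratically in the velocities but carry a factor \<open>h\<close>:
  summed, the quadratic terms are bounded by the energy, so the total variation is at most
  \<open>C * (N * h + 2 * E)\<close>. Some velocity is no larger than the root mean square, which
  anchors the estimate.\<close>

lemma discrete_velocity_bound:
  fixes v :: "nat \<Rightarrow> 'a::real_normed_vector"
  assumes "0 < h" "0 < N" "0 \<le> C"
    and energy: "(\<Sum>k<N. h * (norm (v k))\<^sup>2) \<le> E"
    and step: "\<And>k. Suc k < N \<Longrightarrow>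
      norm (v (Suc k) - v k) \<le> C * h * (1 + (norm (v (Suc k)))\<^sup>2 + (norm (v k))\<^sup>2)"
    and j: "j < N"
  shows "norm (v j) \<le> sqrt (E / (real N * h)) + C * (real N * h + 2 * E)"
proof -
  have ran: "norm (v b - v a) \<le> C * (real N * h + 2 * E)" if "a \<le> b" "b < N" for a b
  proof -
    have "norm (v b - v a) = norm (\<Sum>k=a..<b. v (Suc k) - v k)"
      using that by (simp add: sum_Suc_diff')
    also have "\<dots> \<le> (\<Sum>k=a..<b. C * h * (1 + (norm (v (Suc k)))\<^sup>2 + (norm (v k))\<^sup>2))"
      by (rule sum_norm_le) (use step that in auto)
    also have "\<dots> \<le> (\<Sum>k<N-1. C * h * (1 + (norm (v (Suc k)))\<^sup>2 + (norm (v k))\<^sup>2))"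
      by (rule sum_mono2) (use that assms in auto)
    also have "\<dots> = C * (real (N - 1) * h + (\<Sum>k<N-1. h * (norm (v (Suc k)))\<^sup>2) + (\<Sum>k<N-1. h * (norm (v k))\<^sup>2))"
      by (simp add: sum_distrib_left sum.distrib algebra_simps)
    also have "\<dots> \<le> C * (real N * h + E + E)"
    proof (intro mult_left_mono add_mono)
      have *: "(\<Sum>k\<in>S. h * (norm (v k))\<^sup>2) \<le> E" if "S \<subseteq> {..<N}" for S
        by (rule order_trans[OF sum_mono2 energy]) (use that assms in auto)
      show "(\<Sum>k<N-1. h * (norm (v k))\<^sup>2) \<le> E" by (rule *) auto
      have "(\<Sum>k<N-1. h * (norm (v (Suc k)))\<^sup>2) = (\<Sum>k\<in>Suc ` {..<N-1}. h * (norm (v k))\<^sup>2)"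
        by (simp add: sum.reindex)
      also have "\<dots> \<le> E" by (rule *) auto
      finally show "(\<Sum>k<N-1. h * (norm (v (Suc k)))\<^sup>2) \<le> E" .
    qed (use assms in auto)
    finally show ?thesis by (simp add: algebra_simps)
  qed
  have "\<exists>i<N. (norm (v i))\<^sup>2 \<le> E / (real N * h)"
  proof (rule ccontr)
    assume "\<not> ?thesis"
    then have "\<And>i. i < N \<Longrightarrow> E / (real N * h) < (norm (v i))\<^sup>2" by force
    then have "(\<Sum>i<N. h * (E / (real N * h))) < (\<Sum>i<N. h * (norm (v i))\<^sup>2)"
      by (intro sum_strict_mono mult_strict_left_mono) (use assms in auto)
    then show False using energy assms by simp
  qed
  then obtain i where i: "i < N" "norm (v i) \<le> sqrt (E / (real N * h))"
    using real_le_rsqrt by blast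
  have "norm (v j - v i) \<le> C * (real N * h + 2 * E)"
    using ran[of i j] ran[of j i] i j by (cases "i \<le> j") (auto simp: norm_minus_commute)
  then show ?thesis using i norm_triangle_sub[of "v j" "v i"] by linarith
qed

section \<open>Constraints of constant rank\<close>

text \<open>
  The \<open>l\<close> constraint functions are the components of one map \<open>F\<close> into the configuration space;
  \<open>E\<close> projects onto the components of \<open>F\<close> that are left over.
\<close>

locale constraints =
  fixes F :: "real \<times> 'a::euclidean_space \<Rightarrow> 'a"
    and F' :: "real \<times> 'a \<Rightarrow> (real \<times> 'a) \<Rightarrow>\<^sub>L 'a"
    and F'' :: "real \<times> 'a \<Rightarrow> (real \<times> 'a) \<Rightarrow>\<^sub>L (real \<times> 'a) \<Rightarrow>\<^sub>L 'a"
    and E :: "'a \<Rightarrow> 'a"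
  assumes F_deriv: "\<And>x. (F has_derivative blinfun_apply (F' x)) (at x)"
    and F'_deriv: "\<And>x. (F' has_derivative blinfun_apply (F'' x)) (at x)"
    and F''_cont: "continuous_on UNIV F''"
    and E_linear: "bounded_linear E"
    and E_selfadjoint: "\<And>u v. E u \<bullet> v = u \<bullet> E v"
    and E_F: "\<And>x. E (F x) = 0"
    and rank: "\<And>x \<mu>. F x = 0 \<Longrightarrow> (\<And>w. F' x (0, w) \<bullet> \<mu> = 0) \<Longrightarrow> E \<mu> = 0 \<Longrightarrow> \<mu> = 0"
begin

definition B :: "real \<times> 'a \<Rightarrow> 'a \<Rightarrow> 'a" where
  "B x w = F' x (0, w)"

text \<open>The adjoint of \<open>B x\<close>, in coordinates, so that its continuity in
  \<open>x\<close> follows from that of \<open>B\<close>.\<close>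

definition Bt :: "real \<times> 'a \<Rightarrow> 'a \<Rightarrow> 'a" where
  "Bt x \<mu> = (\<Sum>b\<in>Basis. (B x b \<bullet> \<mu>) *\<^sub>R b)"

lemma F_cont: "continuous_on S F"
  by (rule has_derivative_continuous_on) (rule has_derivative_at_withinI, rule F_deriv)

lemma F'_cont: "continuous_on S F'"
  by (rule has_derivative_continuous_on) (rule has_derivative_at_withinI, rule F'_deriv)

lemma bounded_linear_B: "bounded_linear (B x)"
  unfolding B_def
  by (intro bounded_linear_compose[OF blinfun.bounded_linear_right] bounded_linear_Pair
      bounded_linear_zero bounded_linear_ident)

lemma linear_B: "linear (B x)"
  using bounded_linear_B by (rule bounded_linear.linear)

lemma inner_Bt: "Bt x \<mu> \<bullet> w = B x w \<bullet> \<mu>"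
proof -
  have "B x w \<bullet> \<mu> = B x (\<Sum>b\<in>Basis. (w \<bullet> b) *\<^sub>R b) \<bullet> \<mu>" by (simp add: euclidean_representation)
  also have "\<dots> = (\<Sum>b\<in>Basis. (w \<bullet> b) * (B x b \<bullet> \<mu>))"
    by (simp add: linear_sum[OF linear_B] linear_scale[OF linear_B] inner_sum_left)
  also have "\<dots> = Bt x \<mu> \<bullet> w"
    by (simp add: Bt_def inner_sum_left inner_commute[of w] mult.commute)
  finally show ?thesis ..
qed

lemma linear_Bt: "linear (Bt x)"
  by (rule linearI) (auto simp: Bt_def inner_add_right scaleR_left_distrib sum.distrib scaleR_sum_right)

lemma linear_E: "linear E"
  using E_linear by (rule bounded_linear.linear)

lemma B_cont: "continuous_on S f \<Longrightarrow> continuous_on S w \<Longrightarrow> continuous_on S (\<lambda>y. B (f y) (w y))"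
  unfolding B_def
  by (intro continuous_intros continuous_on_compose2[OF F'_cont[of UNIV]]) auto

lemma Bt_cont: "continuous_on S f \<Longrightarrow> continuous_on S w \<Longrightarrow> continuous_on S (\<lambda>y. Bt (f y) (w y))"
  unfolding Bt_def by (intro continuous_intros B_cont)

lemma E_cont: "continuous_on S w \<Longrightarrow> continuous_on S (\<lambda>y. E (w y))"
  by (rule bounded_linear.continuous_on[OF E_linear])

lemma E_F': "E (F' x \<xi>) = 0"
proof -
  have 1: "((\<lambda>x. E (F x)) has_derivative (\<lambda>\<xi>. E (F' x \<xi>))) (at x)"
    by (rule bounded_linear.has_derivative[OF E_linear F_deriv])
  have 2: "((\<lambda>x. E (F x)) has_derivative (\<lambda>\<xi>. 0)) (at x)"
    by (simp add: E_F)
  show ?thesis using has_derivative_unique[OF 1 2] by metis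
qed

text \<open>\<open>u\<close> lies in the kernel and \<open>E \<mu>\<close> in the range of the
  self-adjoint \<open>E\<close>, and these are orthogonal. Hence one equation in the full space can
  encode two: an equation between vectors annihilated by \<open>E\<close>, and the normalisation
  \<open>E \<mu> = 0\<close> of the multiplier.\<close>

lemma E_eq_0_iff: "E u = 0 \<Longrightarrow> u + E \<mu> = 0 \<Longrightarrow> u = 0 \<and> E \<mu> = 0"
proof -
  assume u: "E u = 0" "u + E \<mu> = 0"
  have "E \<mu> \<bullet> E \<mu> = - (u \<bullet> E \<mu>)" using u(2) by (metis add_eq_0_iff inner_minus_left)
  also have "\<dots> = 0" using u(1) E_selfadjoint[of u \<mu>] by simp
  finally show ?thesis using u(2) by simp
qed

lemma B_bound:
  assumes "compact K"
  obtains \<beta> where "0 < \<beta>" "\<And>x w. x \<in> K \<Longrightarrow> norm (B x w) \<le> \<beta> * norm w"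
    "\<And>x w. x \<in> K \<Longrightarrow> norm (Bt x w) \<le> \<beta> * norm w"
proof -
  have "compact (F' ` K)" using compact_continuous_image[OF F'_cont assms] .
  then obtain \<beta> where \<beta>: "\<And>x. x \<in> K \<Longrightarrow> norm (F' x) \<le> \<beta>" "0 < \<beta>"
    by (metis bounded_pos compact_imp_bounded image_eqI)
  have 1: "norm (B x w) \<le> \<beta> * norm w" if "x \<in> K" for x w
  proof -
    have "norm (B x w) \<le> norm (F' x) * norm ((0::real), w)"
      unfolding B_def by (rule norm_blinfun)
    also have "\<dots> \<le> \<beta> * norm w" using \<beta>(1)[OF that] by (simp add: norm_Pair mult_right_mono)
    finally show ?thesis .
  qed
  have 2: "norm (Bt x w) \<le> \<beta> * norm w" if "x \<in> K" for x w
  proof -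
    have "(norm (Bt x w))\<^sup>2 = B x (Bt x w) \<bullet> w"
      by (metis inner_Bt power2_norm_eq_inner)
    also have "\<dots> \<le> norm (B x (Bt x w)) * norm w" by (rule norm_cauchy_schwarz)
    also have "\<dots> \<le> \<beta> * norm (Bt x w) * norm w"
      using 1[OF that, of "Bt x w"] by (rule mult_right_mono) simp
    finally have "norm (Bt x w) * norm (Bt x w) \<le> norm (Bt x w) * (\<beta> * norm w)"
      by (simp add: power2_eq_square ac_simps)
    then show ?thesis using \<beta>(2)
      by (cases "norm (Bt x w) = 0") auto
  qed
  show ?thesis using that \<beta>(2) 1 2 by blast
qed

text \<open>On the constraint, \<open>rank\<close> makes \<open>B Bt + E\<close> injective.
  Minimising over \<open>K\<close> times the unit sphere makes this uniform, and adding
  \<open>norm (F x)\<close> to the minimised quantity extends the bound to points near the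
  constraint, where \<open>rank\<close> says nothing.\<close>

lemma gram_lower_bound:
  assumes "compact K"
  obtains m where "0 < m"
    "\<And>x \<mu>. x \<in> K \<Longrightarrow> norm (F x) \<le> m \<Longrightarrow> m * norm \<mu> \<le> norm (B x (Bt x \<mu>) + E \<mu>)"
proof (cases "K = {}")
  case True then show ?thesis using that[of 1] by simp
next
  case False
  let ?q = "\<lambda>(x, \<mu>). norm (F x) + norm (B x (Bt x \<mu>) + E \<mu>)"
  have "\<exists>p\<in>K \<times> sphere 0 1. \<forall>p'\<in>K \<times> sphere 0 1. ?q p \<le> ?q p'"
  proof (rule continuous_attains_inf)
    show "compact (K \<times> sphere (0::'a) 1)" using assms by (intro compact_Times) auto
    show "K \<times> sphere (0::'a) 1 \<noteq> {}" using False by simp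
    show "continuous_on (K \<times> sphere 0 1) ?q"
      unfolding case_prod_unfold
      by (intro continuous_intros B_cont Bt_cont E_cont continuous_on_compose2[OF F_cont[of UNIV]]) auto
  qed
  then obtain x0 \<mu>0 where p: "x0 \<in> K" "norm \<mu>0 = 1"
    "\<And>x \<mu>. x \<in> K \<Longrightarrow> norm \<mu> = 1 \<Longrightarrow> ?q (x0, \<mu>0) \<le> ?q (x, \<mu>)" by auto
  have pos: "0 < ?q (x0, \<mu>0)"
  proof (rule ccontr)
    assume "\<not> ?thesis"
    then have 0: "F x0 = 0" "B x0 (Bt x0 \<mu>0) + E \<mu>0 = 0"
      by (auto simp: not_less add_nonneg_eq_0_iff antisym)
         (metis add_nonneg_nonneg add_nonneg_eq_0_iff norm_eq_zero norm_ge_zero order_antisym)+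
    have "E (B x0 (Bt x0 \<mu>0)) = 0" by (simp add: B_def E_F')
    from E_eq_0_iff[OF this 0(2)] have 1: "B x0 (Bt x0 \<mu>0) = 0" "E \<mu>0 = 0" by auto
    have "Bt x0 \<mu>0 \<bullet> Bt x0 \<mu>0 = 0" using 1 by (simp add: inner_Bt)
    then have "F' x0 (0, w) \<bullet> \<mu>0 = 0" for w
      using inner_Bt[of x0 \<mu>0 w] by (simp add: B_def)
    then have "\<mu>0 = 0" using rank[OF 0(1)] 1 by blast
    then show False using p by simp
  qed
  \<comment> \<open>Half of the minimum: where \<open>norm (F x)\<close> accounts for at most half,
    the other summand must supply the rest.\<close>
  define m where "m = ?q (x0, \<mu>0) / 2"
  show ?thesis
  proof (rule that[of m])
    show "0 < m" using pos by (simp add: m_def)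
    fix x \<mu> assume x: "x \<in> K" "norm (F x) \<le> m"
    show "m * norm \<mu> \<le> norm (B x (Bt x \<mu>) + E \<mu>)"
    proof (cases "\<mu> = 0")
      case False
      have lin: "linear (\<lambda>\<mu>. B x (Bt x \<mu>) + E \<mu>)"
        by (intro linear_compose_add linear_E linear_compose[OF linear_Bt linear_B, unfolded o_def])
      have "2 * m \<le> norm (F x) + norm (B x (Bt x (\<mu> /\<^sub>R norm \<mu>)) + E (\<mu> /\<^sub>R norm \<mu>))"
        using p(3)[OF x(1), of "\<mu> /\<^sub>R norm \<mu>"] False by (simp add: m_def)
      then have "m \<le> norm (B x (Bt x (\<mu> /\<^sub>R norm \<mu>)) + E (\<mu> /\<^sub>R norm \<mu>))" using x(2) by linarith
      also have "\<dots> = norm (B x (Bt x \<mu>) + E \<mu>) / norm \<mu>"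
        using linear_scale[OF lin, of "inverse (norm \<mu>)" \<mu>] by (simp add: divide_inverse_commute)
      finally show ?thesis using False by (simp add: field_simps)
    qed simp
  qed
qed

text \<open>
  The retraction moves \<open>y\<close> along the normal directions \<open>Bt (t, y) \<mu>\<close>; the multiplier \<open>\<mu>\<close> is the fixed
  point of a chord Newton iteration that contracts uniformly on compact sets.
\<close>

lemma retraction:
  assumes "compact K"
  obtains \<rho> \<epsilon> C where "0 < \<epsilon>" "0 \<le> C" "continuous_on {x \<in> K. norm (F x) \<le> \<epsilon>} \<rho>"
    "\<And>x. x \<in> K \<Longrightarrow> norm (F x) \<le> \<epsilon> \<Longrightarrow> F (fst x, \<rho> x) = 0"
    "\<And>x. x \<in> K \<Longrightarrow> norm (F x) \<le> \<epsilon> \<Longrightarrow> norm (\<rho> x - snd x) \<le> C * norm (F x)"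
proof -
  obtain m where m: "0 < m"
    "\<And>x \<mu>. x \<in> K \<Longrightarrow> norm (F x) \<le> m \<Longrightarrow> m * norm \<mu> \<le> norm (B x (Bt x \<mu>) + E \<mu>)"
    using gram_lower_bound[OF assms] by blast
  obtain \<beta> where \<beta>: "0 < \<beta>" "\<And>x w. x \<in> K \<Longrightarrow> norm (Bt x w) \<le> \<beta> * norm w"
    using B_bound[OF assms] by metis
  \<comment> \<open>Accuracy of the linearisation: after composition with \<open>Bt\<close>, whose
    norm is at most \<open>\<beta>\<close>, the error is \<open>m / 2\<close> per unit of
    \<open>\<mu>\<close>. This is half of what the Gram operator guarantees, so the iteration
    contracts by \<open>1/2\<close>.\<close>
  have "0 < m / (2 * \<beta>)" using m \<beta> by simp
  then obtain d where d: "0 < d" "\<And>x y z. x \<in> K \<Longrightarrow> norm y < d \<Longrightarrow> norm z < d \<Longrightarrow>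
       norm (F (x + y) - F (x + z) - F' x (y - z)) \<le> m / (2 * \<beta>) * norm (y - z)"
    using compact_uniform_strict_derivative[OF open_UNIV F_deriv F'_cont assms subset_UNIV] by metis
  define r where "r = d / (2 * \<beta>)"
  have r: "0 < r" "\<beta> * r < d" using d \<beta> by (auto simp: r_def)
  \<comment> \<open>The summand \<open>E \<mu>\<close> makes the equation for \<open>\<mu>\<close>
    square; \<open>E_eq_0_iff\<close> removes it again at a zero of \<open>\<Psi>\<close>.\<close>
  define \<Psi> where "\<Psi> x \<mu> = F (x + (0, Bt x \<mu>)) + E \<mu>" for x \<mu>
  define G where "G x \<mu> = B x (Bt x \<mu>) + E \<mu>" for x \<mu>
  have linG: "linear (G x)" for x
    unfolding G_def
    by (intro linear_compose_add linear_E linear_compose[OF linear_Bt linear_B, unfolded o_def])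
  have \<Psi>: "norm (\<Psi> x \<mu> - \<Psi> x \<mu>' - G x (\<mu> - \<mu>')) \<le> m / 2 * norm (\<mu> - \<mu>')"
    if "x \<in> K" "norm \<mu> \<le> r" "norm \<mu>' \<le> r" for x \<mu> \<mu>'
  proof -
    have small: "norm ((0::real), Bt x \<mu>) < d" if "norm \<mu> \<le> r" for \<mu>
    proof -
      have "\<beta> * norm \<mu> \<le> \<beta> * r" using that \<beta>(1) by simp
      then show ?thesis using \<beta>(2)[OF \<open>x \<in> K\<close>, of \<mu>] r(2) by (simp add: norm_Pair)
    qed
    have "\<Psi> x \<mu> - \<Psi> x \<mu>' - G x (\<mu> - \<mu>') =
       F (x + (0, Bt x \<mu>)) - F (x + (0, Bt x \<mu>')) - F' x ((0, Bt x \<mu>) - (0, Bt x \<mu>'))"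
      by (simp add: \<Psi>_def G_def B_def linear_diff[OF linear_Bt] linear_diff[OF linear_E])
    also have "norm \<dots> \<le> m / (2 * \<beta>) * norm ((0::real, Bt x \<mu>) - (0, Bt x \<mu>'))"
      by (rule d(2)[OF that(1) small[OF that(2)] small[OF that(3)]])
    also have "\<dots> \<le> m / (2 * \<beta>) * (\<beta> * norm (\<mu> - \<mu>'))"
      using \<beta>(2)[OF that(1), of "\<mu> - \<mu>'"] m(1) \<beta>(1)
      by (intro mult_left_mono) (auto simp: norm_Pair linear_diff[OF linear_Bt])
    also have "\<dots> = m / 2 * norm (\<mu> - \<mu>')" using \<beta>(1) by simp
    finally show ?thesis .
  qed
  \<comment> \<open>The first entry makes the Gram estimate available at \<open>x\<close>; the
    second puts the first iterate in the ball of radius \<open>r / 2\<close>, so that the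
    contraction maps the ball of radius \<open>r\<close> into itself.\<close>
  define \<epsilon> where "\<epsilon> = min m (m * r / 2)"
  have \<epsilon>: "0 < \<epsilon>" "\<epsilon> \<le> m" "\<epsilon> \<le> m * r / 2" using m r by (auto simp: \<epsilon>_def)
  have ex: "\<exists>\<mu>. norm \<mu> \<le> r \<and> \<Psi> x \<mu> = 0 \<and> norm \<mu> \<le> 2 / m * norm (F x)"
    if x: "x \<in> K" "norm (F x) \<le> \<epsilon>" for x
  proof -
    have low: "m * norm \<mu> \<le> norm (G x \<mu>)" for \<mu>
      using m(2)[OF x(1)] x(2) \<epsilon>(2) by (simp add: G_def)
    have "inj (G x)"
      using low m(1) by (intro iffD2[OF linear_injective_0[OF linG]]) (metis mult_pos_pos norm_zero not_le zero_less_norm_iff)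
    then obtain H where H: "linear H" "\<And>u. H (G x u) = u" "\<And>u. G x (H u) = u"
      using linear_injective_isomorphism[OF linG] by blast
    have Hn: "norm (H u) \<le> norm u / m" for u
      using low[of "H u"] H(3)[of u] m(1) by (simp add: field_simps)
    define \<phi> where "\<phi> \<mu> = \<mu> - H (\<Psi> x \<mu>)" for \<mu>
    have con: "norm (\<phi> \<mu> - \<phi> \<mu>') \<le> 1 / 2 * norm (\<mu> - \<mu>')" if "norm \<mu> \<le> r" "norm \<mu>' \<le> r" for \<mu> \<mu>'
    proof -
      have "\<phi> \<mu> - \<phi> \<mu>' = - H (\<Psi> x \<mu> - \<Psi> x \<mu>' - G x (\<mu> - \<mu>'))"
        by (simp add: \<phi>_def linear_diff[OF H(1)] H(2) linear_diff[OF linG])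
      then have "norm (\<phi> \<mu> - \<phi> \<mu>') \<le> norm (\<Psi> x \<mu> - \<Psi> x \<mu>' - G x (\<mu> - \<mu>')) / m"
        using Hn by simp
      also have "\<dots> \<le> (m / 2 * norm (\<mu> - \<mu>')) / m"
        using \<Psi>[OF x(1) that] m(1) by (intro divide_right_mono) auto
      finally show ?thesis using m(1) by simp
    qed
    have \<phi>0: "norm (\<phi> 0) \<le> norm (F x) / m"
      using Hn[of "F x"] by (simp add: \<phi>_def \<Psi>_def linear_0[OF linear_Bt] linear_0[OF linear_E] zero_prod_def[symmetric])
    have \<phi>1: "norm (\<phi> \<mu>) \<le> 1 / 2 * norm \<mu> + norm (F x) / m" if "norm \<mu> \<le> r" for \<mu>
      using con[OF that, of 0] \<phi>0 r(1) norm_triangle_sub[of "\<phi> \<mu>" "\<phi> 0"] by simp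
    have "norm (F x) / m \<le> r / 2" using x(2) \<epsilon>(3) m(1) by (simp add: field_simps)
    then have "norm (\<phi> \<mu>) \<le> r" if "norm \<mu> \<le> r" for \<mu>
      using \<phi>1[OF that] that by linarith
    then have "\<phi> ` cball 0 r \<subseteq> cball 0 r" by auto
    then have "\<exists>!\<mu>. \<mu> \<in> cball 0 r \<and> \<phi> \<mu> = \<mu>"
      using con r(1) by (intro Banach_fix[where c = "1/2"]) (auto simp: dist_norm complete_eq_closed)
    then obtain \<mu> where \<mu>: "norm \<mu> \<le> r" "\<phi> \<mu> = \<mu>" by auto
    then have "\<Psi> x \<mu> = 0"
      by (metis H(3) \<phi>_def add.right_neutral add_diff_cancel_left' diff_eq_eq linear_0[OF linG] diff_add_cancel)
    moreover have "norm \<mu> \<le> 2 / m * norm (F x)" using \<phi>1[OF \<mu>(1)] \<mu>(2) by simp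
    ultimately show ?thesis using \<mu>(1) by blast
  qed
  \<comment> \<open>An arbitrary choice suffices: continuity follows below from an estimate that
    compares two zeros of \<open>\<Psi>\<close> in the ball, valid whichever zeros are
    chosen.\<close>
  define \<Lambda> where "\<Lambda> x = (SOME \<mu>. norm \<mu> \<le> r \<and> \<Psi> x \<mu> = 0 \<and> norm \<mu> \<le> 2 / m * norm (F x))" for x
  define A where "A = {x \<in> K. norm (F x) \<le> \<epsilon>}"
  have \<Lambda>: "norm (\<Lambda> x) \<le> r" "\<Psi> x (\<Lambda> x) = 0" "norm (\<Lambda> x) \<le> 2 / m * norm (F x)" if "x \<in> A" for x
    using someI_ex[OF ex, of x] that unfolding A_def \<Lambda>_def by blast+
  have \<Psi>_cont: "continuous_on A (\<lambda>x. \<Psi> x \<mu>)" for \<mu>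
    unfolding \<Psi>_def
    by (intro continuous_intros Bt_cont continuous_on_compose2[OF F_cont[of UNIV]]) auto
  have "continuous_on A \<Lambda>"
    unfolding continuous_on_def
  proof
    fix x0 assume x0: "x0 \<in> A"
    have "((\<lambda>x. \<Psi> x (\<Lambda> x0)) \<longlongrightarrow> 0) (at x0 within A)"
      using \<Psi>_cont[of "\<Lambda> x0"] x0 \<Lambda>(2)[OF x0] unfolding continuous_on_def by metis
    then have lim: "((\<lambda>x. 2 / m * norm (\<Psi> x (\<Lambda> x0))) \<longlongrightarrow> 0) (at x0 within A)"
      by (intro tendsto_mult_right_zero tendsto_norm_zero)
    have "norm (\<Lambda> x - \<Lambda> x0) \<le> 2 / m * norm (\<Psi> x (\<Lambda> x0))" if x: "x \<in> A" for x
    proof -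
      have "m * norm (\<Lambda> x - \<Lambda> x0) \<le> norm (G x (\<Lambda> x - \<Lambda> x0))"
        using m(2)[of x] x \<epsilon>(2) by (auto simp: A_def G_def)
      moreover have "norm (\<Psi> x (\<Lambda> x) - \<Psi> x (\<Lambda> x0) - G x (\<Lambda> x - \<Lambda> x0)) \<le> m / 2 * norm (\<Lambda> x - \<Lambda> x0)"
        using \<Psi>[of x] x \<Lambda>(1)[OF x] \<Lambda>(1)[OF x0] by (auto simp: A_def)
      moreover have "norm (G x (\<Lambda> x - \<Lambda> x0)) \<le> norm (\<Psi> x (\<Lambda> x0)) +
          norm (\<Psi> x (\<Lambda> x) - \<Psi> x (\<Lambda> x0) - G x (\<Lambda> x - \<Lambda> x0))"
        using norm_triangle_ineq4[of "- \<Psi> x (\<Lambda> x0)" "\<Psi> x (\<Lambda> x) - \<Psi> x (\<Lambda> x0) - G x (\<Lambda> x - \<Lambda> x0)"]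
        by (simp add: \<Lambda>(2)[OF x])
      ultimately have "m / 2 * norm (\<Lambda> x - \<Lambda> x0) \<le> norm (\<Psi> x (\<Lambda> x0))" by simp
      then show ?thesis using m(1) by (simp add: field_simps)
    qed
    then have "\<forall>\<^sub>F x in at x0 within A. norm (\<Lambda> x - \<Lambda> x0) \<le> 2 / m * norm (\<Psi> x (\<Lambda> x0))"
      by (auto simp: eventually_at_filter)
    then have "((\<lambda>x. \<Lambda> x - \<Lambda> x0) \<longlongrightarrow> 0) (at x0 within A)"
      using lim by (rule Lim_null_comparison)
    then show "(\<Lambda> \<longlongrightarrow> \<Lambda> x0) (at x0 within A)" by (rule LIM_zero_cancel)
  qed
  then have cont: "continuous_on A (\<lambda>x. snd x + Bt x (\<Lambda> x))"
    by (intro continuous_intros Bt_cont)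
  show ?thesis
  proof (rule that[of \<epsilon> "\<beta> * (2 / m)" "\<lambda>x. snd x + Bt x (\<Lambda> x)"])
    show "continuous_on {x \<in> K. norm (F x) \<le> \<epsilon>} (\<lambda>x. snd x + Bt x (\<Lambda> x))"
      using cont by (simp add: A_def)
    show "0 \<le> \<beta> * (2 / m)" using \<beta> m by simp
  next
    fix x assume x: "x \<in> K" "norm (F x) \<le> \<epsilon>"
    then have "x \<in> A" by (simp add: A_def)
    have eq: "x + (0, Bt x (\<Lambda> x)) = (fst x, snd x + Bt x (\<Lambda> x))" by (simp add: prod_eq_iff)
    have "E (F (x + (0, Bt x (\<Lambda> x)))) = 0" by (rule E_F)
    from E_eq_0_iff[OF this \<Lambda>(2)[OF \<open>x \<in> A\<close>, unfolded \<Psi>_def]]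
    show "F (fst x, snd x + Bt x (\<Lambda> x)) = 0" by (simp add: eq)
    have "norm (Bt x (\<Lambda> x)) \<le> \<beta> * norm (\<Lambda> x)" by (rule \<beta>(2)[OF x(1)])
    also have "\<dots> \<le> \<beta> * (2 / m * norm (F x))"
      using \<Lambda>(3)[OF \<open>x \<in> A\<close>] \<beta>(1) by (intro mult_left_mono) auto
    finally show "norm (snd x + Bt x (\<Lambda> x) - snd x) \<le> \<beta> * (2 / m) * norm (F x)" by simp
  qed (rule \<epsilon>(1))
qed

end

section \<open>Lagrange multipliers on the constraint set at a fixed time\<close>

context constraints
begin

text \<open>A direction tangent to the constraint is realised by retracting the straight line: the
  resulting curve stays in the constraint, and it differs from the line by a multiple of
  \<open>F\<close> on the line, which is of smaller order than the parameter. Hence \<open>q\<close>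
  annihilates the kernel of \<open>B\<close>, and so it lies in the range of
  \<open>Bt\<close>.\<close>

lemma lagrange_multiplier:
  assumes deriv: "(\<phi> has_derivative (\<lambda>\<xi>. q \<bullet> \<xi>)) (at y)"
    and y: "F (t, y) = 0"
    and "0 < r" and min: "\<And>y'. norm (y' - y) < r \<Longrightarrow> F (t, y') = 0 \<Longrightarrow> \<phi> y \<le> (\<phi> y' :: real)"
  obtains \<mu> where "E \<mu> = 0" "q = Bt (t, y) \<mu>"
proof -
  let ?x = "(t, y)"
  have orth: "q \<bullet> \<xi> = 0" if \<xi>: "B ?x \<xi> = 0" for \<xi>
  proof -
    have "compact ({t} \<times> cball y 1)" by (intro compact_Times) auto
    then obtain \<rho> \<epsilon> C where \<rho>: "0 < \<epsilon>" "0 \<le> C"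
      "\<And>x. x \<in> {t} \<times> cball y 1 \<Longrightarrow> norm (F x) \<le> \<epsilon> \<Longrightarrow> F (fst x, \<rho> x) = 0"
      "\<And>x. x \<in> {t} \<times> cball y 1 \<Longrightarrow> norm (F x) \<le> \<epsilon> \<Longrightarrow> norm (\<rho> x - snd x) \<le> C * norm (F x)"
      by (rule retraction) blast
    define c where "c s = \<rho> (t, y + s *\<^sub>R \<xi>)" for s :: real
    have Fd: "((\<lambda>s. F (t, y + s *\<^sub>R \<xi>)) has_derivative (\<lambda>s. F' ?x (0, s *\<^sub>R \<xi>))) (at 0)"
    proof (rule has_derivative_compose[where f = "\<lambda>s. (t, y + s *\<^sub>R \<xi>)" and g = F])
      show "((\<lambda>s. (t, y + s *\<^sub>R \<xi>)) has_derivative (\<lambda>s. (0, s *\<^sub>R \<xi>))) (at 0)"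
        by (auto intro!: derivative_eq_intros)
      show "(F has_derivative F' ?x) (at (t, y + 0 *\<^sub>R \<xi>))" using F_deriv by simp
    qed
    have "F' ?x (0, s *\<^sub>R \<xi>) = 0" for s
      using \<xi> linear_scale[OF linear_B, of ?x s \<xi>] by (simp add: B_def)
    then have F0: "((\<lambda>s. norm (F (t, y + s *\<^sub>R \<xi>)) / norm s) \<longlongrightarrow> 0) (at 0)"
      using Fd y unfolding has_derivative_iff_norm by simp
    have near: "\<forall>\<^sub>F s in at 0. (t, y + s *\<^sub>R \<xi>) \<in> {t} \<times> cball y 1 \<and> norm (F (t, y + s *\<^sub>R \<xi>)) \<le> \<epsilon>"
    proof -
      have "((\<lambda>s. norm (s *\<^sub>R \<xi>)) \<longlongrightarrow> norm (0 *\<^sub>R \<xi>)) (at 0)" by (intro tendsto_intros)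
      then have "\<forall>\<^sub>F s in at 0. norm (s *\<^sub>R \<xi>) < 1" by (rule order_tendstoD) simp
      moreover have "((\<lambda>s. F (t, y + s *\<^sub>R \<xi>)) \<longlongrightarrow> F (t, y + 0 *\<^sub>R \<xi>)) (at 0)"
        using has_derivative_continuous[OF Fd] by (simp add: continuous_within)
      then have "((\<lambda>s. norm (F (t, y + s *\<^sub>R \<xi>))) \<longlongrightarrow> 0) (at 0)"
        using y by (simp add: tendsto_norm_zero)
      then have "\<forall>\<^sub>F s in at 0. norm (F (t, y + s *\<^sub>R \<xi>)) < \<epsilon>" using \<rho>(1) by (rule order_tendstoD)
      ultimately show ?thesis by eventually_elim (auto simp: dist_norm)
    qed
    have c0: "c 0 = y" using \<rho>(4)[of ?x] y \<rho>(1) by (simp add: c_def)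
    have cd: "(c has_derivative (\<lambda>s. s *\<^sub>R \<xi>)) (at 0)"
      unfolding has_derivative_iff_norm
    proof
      have "\<forall>\<^sub>F s in at 0. norm (norm (c s - c 0 - (s - 0) *\<^sub>R \<xi>) / norm (s - 0))
          \<le> C * (norm (F (t, y + s *\<^sub>R \<xi>)) / norm s)"
        using near
      proof eventually_elim
        case (elim s)
        then have "norm (c s - (y + s *\<^sub>R \<xi>)) \<le> C * norm (F (t, y + s *\<^sub>R \<xi>))"
          using \<rho>(4)[of "(t, y + s *\<^sub>R \<xi>)"] by (simp add: c_def)
        then have "norm (c s - (y + s *\<^sub>R \<xi>)) / \<bar>s\<bar> \<le> C * norm (F (t, y + s *\<^sub>R \<xi>)) / \<bar>s\<bar>"
          by (rule divide_right_mono) simp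
        then show ?case by (simp add: c0 diff_diff_eq)
      qed
      then show "((\<lambda>s. norm (c s - c 0 - (s - 0) *\<^sub>R \<xi>) / norm (s - 0)) \<longlongrightarrow> 0) (at 0)"
        using tendsto_mult_right_zero[OF F0] by (rule Lim_null_comparison)
    qed (rule bounded_linear_scaleR_left)
    have "((\<lambda>s. \<phi> (c s)) has_derivative (\<lambda>s. q \<bullet> (s *\<^sub>R \<xi>))) (at 0)"
      by (rule has_derivative_compose[where f = c and g = \<phi>, OF cd]) (simp add: c0 deriv)
    moreover have "\<forall>\<^sub>F s in at 0. \<phi> (c 0) \<le> \<phi> (c s)"
    proof -
      have "(c \<longlongrightarrow> y) (at 0)"
        using has_derivative_continuous[OF cd] c0 by (simp add: continuous_within)
      then have "\<forall>\<^sub>F s in at 0. dist (c s) y < r" using \<open>0 < r\<close> by (rule tendstoD)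
      then show ?thesis using near
      proof eventually_elim
        case (elim s)
        then have "F (t, c s) = 0" using \<rho>(3)[of "(t, y + s *\<^sub>R \<xi>)"] by (simp add: c_def)
        then show ?case using min[of "c s"] elim(1) by (simp add: c0 dist_norm)
      qed
    qed
    ultimately have "(\<lambda>s. q \<bullet> (s *\<^sub>R \<xi>)) = (\<lambda>s. 0)" by (rule has_derivative_local_min)
    then have "q \<bullet> (1 *\<^sub>R \<xi>) = 0" by metis
    then show ?thesis by simp
  qed
  obtain m where "0 < m"
    "\<And>x \<mu>. x \<in> {?x} \<Longrightarrow> norm (F x) \<le> m \<Longrightarrow> m * norm \<mu> \<le> norm (B x (Bt x \<mu>) + E \<mu>)"
    by (rule gram_lower_bound[OF compact_sing]) blast
  then have m: "0 < m" "\<And>\<mu>. m * norm \<mu> \<le> norm (B ?x (Bt ?x \<mu>) + E \<mu>)"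
    using y by simp_all
  have lin: "linear (\<lambda>\<mu>. B ?x (Bt ?x \<mu>) + E \<mu>)"
    by (intro linear_compose_add linear_E linear_compose[OF linear_Bt linear_B, unfolded o_def])
  have "\<mu> = 0" if "B ?x (Bt ?x \<mu>) + E \<mu> = 0" for \<mu>
    using m(2)[of \<mu>] m(1) unfolding that by (simp add: mult_le_0_iff)
  then have "inj (\<lambda>\<mu>. B ?x (Bt ?x \<mu>) + E \<mu>)"
    unfolding linear_injective_0[OF lin] by (intro allI impI)
  then have "surj (\<lambda>\<mu>. B ?x (Bt ?x \<mu>) + E \<mu>)"
    by (rule linear_inj_imp_surj[OF lin])
  \<comment> \<open>The candidate multiplier. Once the equation is split,
    \<open>Bt \<mu> - q\<close> lies in the kernel of \<open>B\<close>; it is therefore orthogonal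
    to \<open>q\<close> and to \<open>Bt \<mu>\<close>, hence to itself.\<close>
  then obtain \<mu> where \<mu>: "B ?x q = B ?x (Bt ?x \<mu>) + E \<mu>"
    by (rule surjE)
  have "E (B ?x (Bt ?x \<mu> - q)) = 0" unfolding B_def by (rule E_F')
  moreover have "B ?x (Bt ?x \<mu> - q) + E \<mu> = 0"
    unfolding linear_diff[OF linear_B] \<mu> by simp
  ultimately have "B ?x (Bt ?x \<mu> - q) = 0 \<and> E \<mu> = 0" by (rule E_eq_0_iff)
  then have 1: "B ?x (Bt ?x \<mu> - q) = 0" "E \<mu> = 0" by blast+
  have "(Bt ?x \<mu> - q) \<bullet> (Bt ?x \<mu> - q) = 0"
    using orth[OF 1(1)] inner_Bt[of ?x \<mu> "Bt ?x \<mu> - q"] 1(1) by (simp add: inner_diff_left)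
  then show ?thesis using that 1 by simp
qed

end

section \<open>The equations of motion\<close>

locale mechanical_system = constraints F F' F'' E
  for F :: "real \<times> 'a::euclidean_space \<Rightarrow> 'a" and F' F'' E +
  fixes \<sigma> :: "'a set"
    and g :: "real \<times> 'a \<Rightarrow> 'a \<Rightarrow>\<^sub>L 'a" and g' :: "real \<times> 'a \<Rightarrow> (real \<times> 'a) \<Rightarrow>\<^sub>L 'a \<Rightarrow>\<^sub>L 'a"
    and a :: "real \<times> 'a \<Rightarrow> 'a" and a' :: "real \<times> 'a \<Rightarrow> (real \<times> 'a) \<Rightarrow>\<^sub>L 'a"
    and V :: "real \<times> 'a \<Rightarrow> real" and V' :: "real \<times> 'a \<Rightarrow> (real \<times> 'a) \<Rightarrow>\<^sub>L real"
    and K :: real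
  assumes \<sigma>_closed: "closed \<sigma>"
    and g_deriv: "\<And>x. snd x \<notin> \<sigma> \<Longrightarrow> (g has_derivative blinfun_apply (g' x)) (at x)"
    and g'_cont: "continuous_on (UNIV \<times> - \<sigma>) g'"
    and a_deriv: "\<And>x. snd x \<notin> \<sigma> \<Longrightarrow> (a has_derivative blinfun_apply (a' x)) (at x)"
    and a'_cont: "continuous_on (UNIV \<times> - \<sigma>) a'"
    and V_deriv: "\<And>x. snd x \<notin> \<sigma> \<Longrightarrow> (V has_derivative blinfun_apply (V' x)) (at x)"
    and V'_cont: "continuous_on (UNIV \<times> - \<sigma>) V'"
    and g_sym: "\<And>x v w. snd x \<notin> \<sigma> \<Longrightarrow> g x v \<bullet> w = v \<bullet> g x w"
    and K_pos: "0 < K"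
    and g_lower: "\<And>x v. snd x \<notin> \<sigma> \<Longrightarrow> K * (norm v)\<^sup>2 \<le> 1/2 * (g x v \<bullet> v)"
begin

abbreviation \<Omega> :: "(real \<times> 'a) set" where
  "\<Omega> \<equiv> UNIV \<times> - \<sigma>"

definition L :: "real \<times> 'a \<Rightarrow> 'a \<Rightarrow> real" where
  "L x v = 1/2 * (g x v \<bullet> v) + a x \<bullet> v - V x"

definition Lz :: "real \<times> 'a \<Rightarrow> 'a \<Rightarrow> 'a" where
  "Lz x v = (\<Sum>b\<in>Basis. (1/2 * (g' x (0, b) v \<bullet> v) + a' x (0, b) \<bullet> v - V' x (0, b)) *\<^sub>R b)"

text \<open>The block operator of the constrained equations, acting on an acceleration and a
  multiplier. The summand \<open>E\<close> fills the rows that carry no constraint, so that a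
  square, invertible system results on the constraint set.\<close>

definition saddle :: "real \<times> 'a \<Rightarrow> 'a \<times> 'a \<Rightarrow> 'a \<times> 'a" where
  "saddle x p = (g x (fst p) - Bt x (snd p), B x (fst p) + E (snd p))"

text \<open>First component: what remains of \<open>d/dt (g v + a) = Lz + Bt \<mu>\<close> when
  acceleration and multiplier stand on the left. Second component: minus the terms without
  acceleration in the second time derivative of \<open>F (t, z t) = 0\<close>.\<close>

definition force :: "real \<times> 'a \<Rightarrow> 'a \<Rightarrow> 'a \<times> 'a" where
  "force x v = (Lz x v - g' x (1, v) v - a' x (1, v), - F'' x (1, v) (1, v))"

text \<open>The pair of the acceleration and the multiplier, meaningful where \<open>F x = 0\<close>.\<close>

definition response :: "real \<times> 'a \<Rightarrow> 'a \<Rightarrow> 'a \<times> 'a" where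
  "response x v = (THE p. saddle x p = force x v)"

definition accel :: "real \<times> 'a \<Rightarrow> 'a \<Rightarrow> 'a" where
  "accel x v = fst (response x v)"

definition multiplier :: "real \<times> 'a \<Rightarrow> 'a \<Rightarrow> 'a" where
  "multiplier x v = snd (response x v)"

lemma open_\<Omega>: "open \<Omega>"
  using \<sigma>_closed by (intro open_Times) auto

lemma g_cont: "continuous_on \<Omega> g"
  by (rule has_derivative_continuous_on[where f' = "\<lambda>x. blinfun_apply (g' x)"])
     (rule has_derivative_at_withinI, rule g_deriv, auto)

lemma a_cont: "continuous_on \<Omega> a"
  by (rule has_derivative_continuous_on[where f' = "\<lambda>x. blinfun_apply (a' x)"])
     (rule has_derivative_at_withinI, rule a_deriv, auto)

lemma V_cont: "continuous_on \<Omega> V"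
  by (rule has_derivative_continuous_on[where f' = "\<lambda>x. blinfun_apply (V' x)"])
     (rule has_derivative_at_withinI, rule V_deriv, auto)

lemma linear_saddle: "linear (saddle x)"
proof (rule linearI)
  show "saddle x (p + q) = saddle x p + saddle x q" for p q
    by (simp add: saddle_def blinfun.add_right linear_add[OF linear_B] linear_add[OF linear_Bt]
        linear_add[OF linear_E])
  show "saddle x (c *\<^sub>R p) = c *\<^sub>R saddle x p" for c p
    by (simp add: saddle_def blinfun.scaleR_right linear_scale[OF linear_B] linear_scale[OF linear_Bt]
        linear_scale[OF linear_E] scaleR_diff_right scaleR_add_right)
qed

lemma saddle_cont:
  "continuous_on S f \<Longrightarrow> continuous_on S p \<Longrightarrow> f ` S \<subseteq> \<Omega> \<Longrightarrow> continuous_on S (\<lambda>y. saddle (f y) (p y))"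
  unfolding saddle_def
  by (intro continuous_intros B_cont Bt_cont E_cont continuous_on_compose2[OF g_cont]) auto

text \<open>Pairing the first row with \<open>w\<close> gives
  \<open>g w \<bullet> w = B w \<bullet> \<mu> = 0\<close>, so ellipticity forces
  \<open>w = 0\<close>; then \<open>Bt \<mu> = 0\<close>, and \<open>rank\<close> gives
  \<open>\<mu> = 0\<close>.\<close>

lemma saddle_eq_0:
  assumes x: "snd x \<notin> \<sigma>" "F x = 0" and p: "saddle x p = 0"
  shows "p = 0"
proof -
  obtain w \<mu> where pw: "p = (w, \<mu>)" by fastforce
  have 1: "g x w = Bt x \<mu>" and 2: "B x w + E \<mu> = 0"
    using p by (auto simp: saddle_def pw zero_prod_def)
  have "E (B x w) = 0" by (simp add: B_def E_F')
  from E_eq_0_iff[OF this 2] have 3: "B x w = 0" "E \<mu> = 0" by auto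
  have "g x w \<bullet> w = 0" using 3 by (simp add: 1 inner_Bt)
  then have "K * (norm w)\<^sup>2 \<le> 0" using g_lower[OF x(1), of w] by simp
  then have w: "w = 0" using K_pos by (simp add: mult_le_0_iff)
  have "F' x (0, u) \<bullet> \<mu> = 0" for u
    using inner_Bt[of x \<mu> u] 1 w by (simp add: B_def blinfun.zero_right)
  then have "\<mu> = 0" using rank[OF x(2)] 3(2) by blast
  then show ?thesis using w by (simp add: pw zero_prod_def)
qed

text \<open>Injectivity made uniform by minimising over \<open>A\<close> times the unit sphere. The
  discrete estimates below all invert \<open>saddle\<close> through this bound.\<close>

lemma saddle_lower_bound:
  assumes "compact A" "A \<subseteq> \<Omega>" "\<And>x. x \<in> A \<Longrightarrow> F x = 0"
  obtains \<kappa> where "0 < \<kappa>" "\<And>x p. x \<in> A \<Longrightarrow> \<kappa> * norm p \<le> norm (saddle x p)"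
proof (cases "A = {}")
  case True then show ?thesis using that[of 1] by simp
next
  case False
  have "\<exists>q\<in>A \<times> sphere 0 1. \<forall>q'\<in>A \<times> sphere 0 1. norm (saddle (fst q) (snd q)) \<le> norm (saddle (fst q') (snd q'))"
  proof (rule continuous_attains_inf)
    show "compact (A \<times> sphere (0::'a \<times> 'a) 1)" using assms by (intro compact_Times) auto
    show "A \<times> sphere (0::'a \<times> 'a) 1 \<noteq> {}" using False by simp
    show "continuous_on (A \<times> sphere (0::'a \<times> 'a) 1) (\<lambda>q. norm (saddle (fst q) (snd q)))"
      using assms(2) by (intro continuous_intros saddle_cont) auto
  qed
  then obtain x0 p0 where p: "x0 \<in> A" "norm p0 = 1"
    "\<And>x p. x \<in> A \<Longrightarrow> norm p = 1 \<Longrightarrow> norm (saddle x0 p0) \<le> norm (saddle x p)" by auto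
  have pos: "0 < norm (saddle x0 p0)"
    using saddle_eq_0[of x0 p0] assms p(1,2) by fastforce
  show ?thesis
  proof (rule that[OF pos])
    fix x q assume x: "x \<in> A"
    show "norm (saddle x0 p0) * norm q \<le> norm (saddle x q)"
    proof (cases "q = 0")
      case False
      then have "norm (saddle x0 p0) \<le> norm (saddle x (q /\<^sub>R norm q))" using p(3)[OF x] by simp
      also have "\<dots> = norm (saddle x q) / norm q"
        using linear_scale[OF linear_saddle, of x "inverse (norm q)" q] by (simp add: divide_inverse_commute)
      finally show ?thesis using False by (simp add: field_simps)
    qed simp
  qed
qed

lemma response_unique:
  assumes "snd x \<notin> \<sigma>" "F x = 0"
  shows "saddle x p = force x v \<longleftrightarrow> p = response x v"
proof -
  have inj: "inj (saddle x)"
    unfolding linear_injective_0[OF linear_saddle] by (intro allI impI) (rule saddle_eq_0[OF assms])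
  then have "surj (saddle x)" by (rule linear_inj_imp_surj[OF linear_saddle])
  then obtain q where q: "force x v = saddle x q" by (rule surjE)
  have "response x v = q"
    unfolding response_def q inj_eq[OF inj] by (rule the_eq_trivial)
  then show ?thesis by (simp add: q inj_eq[OF inj])
qed

lemma E_F'': "E (F'' x \<xi> \<zeta>) = 0"
proof -
  have "((\<lambda>x. F' x \<zeta>) has_derivative (\<lambda>\<xi>. F'' x \<xi> \<zeta>)) (at x)"
    by (rule bounded_linear.has_derivative[OF blinfun.bounded_linear_left F'_deriv])
  then have 1: "((\<lambda>x. E (F' x \<zeta>)) has_derivative (\<lambda>\<xi>. E (F'' x \<xi> \<zeta>))) (at x)"
    by (rule bounded_linear.has_derivative[OF E_linear])
  have 2: "((\<lambda>x. E (F' x \<zeta>)) has_derivative (\<lambda>\<xi>. 0)) (at x)"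
    by (simp add: E_F')
  show ?thesis using has_derivative_unique[OF 1 2] by metis
qed

lemma equations_of_motion:
  assumes "snd x \<notin> \<sigma>" "F x = 0"
  shows "g x (accel x v) + g' x (1, v) v + a' x (1, v) - Lz x v = Bt x (multiplier x v)"
    and "B x (accel x v) = - F'' x (1, v) (1, v)" and "E (multiplier x v) = 0"
proof -
  have eq: "saddle x (response x v) = force x v" using response_unique[OF assms, of "response x v" v] by simp
  then have 1: "g x (accel x v) - Bt x (multiplier x v) = Lz x v - g' x (1, v) v - a' x (1, v)"
    and 2: "B x (accel x v) + E (multiplier x v) = - F'' x (1, v) (1, v)"
    unfolding saddle_def force_def accel_def multiplier_def prod.inject by blast+
  show "g x (accel x v) + g' x (1, v) v + a' x (1, v) - Lz x v = Bt x (multiplier x v)"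
    using 1 by (simp add: algebra_simps)
  \<comment> \<open>Both terms in the bracket are annihilated by \<open>E\<close>, because
    \<open>E\<close> composed with \<open>F\<close> vanishes identically; so the second row
    splits.\<close>
  have "(B x (accel x v) + F'' x (1, v) (1, v)) + E (multiplier x v) = 0"
  proof -
    have "(B x (accel x v) + F'' x (1, v) (1, v)) + E (multiplier x v) =
        (B x (accel x v) + E (multiplier x v)) + F'' x (1, v) (1, v)" by (simp only: ac_simps)
    then show ?thesis unfolding 2 by (simp only: add.left_inverse)
  qed
  moreover have "E (B x (accel x v) + F'' x (1, v) (1, v)) = 0"
    by (simp add: linear_add[OF linear_E] E_F'' B_def E_F')
  ultimately have "B x (accel x v) + F'' x (1, v) (1, v) = 0" "E (multiplier x v) = 0"
    by (auto dest: E_eq_0_iff)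
  then show "B x (accel x v) = - F'' x (1, v) (1, v)" "E (multiplier x v) = 0"
    by (simp_all only: eq_neg_iff_add_eq_0)
qed

lemma Lz_cont:
  "continuous_on S f \<Longrightarrow> continuous_on S v \<Longrightarrow> f ` S \<subseteq> \<Omega> \<Longrightarrow> continuous_on S (\<lambda>y. Lz (f y) (v y))"
  unfolding Lz_def
  by (intro continuous_intros continuous_on_compose2[OF g'_cont] continuous_on_compose2[OF a'_cont]
      continuous_on_compose2[OF V'_cont]) auto

lemma force_cont:
  "continuous_on S f \<Longrightarrow> continuous_on S v \<Longrightarrow> f ` S \<subseteq> \<Omega> \<Longrightarrow> continuous_on S (\<lambda>y. force (f y) (v y))"
  unfolding force_def
  by (intro continuous_intros Lz_cont continuous_on_compose2[OF g'_cont]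
      continuous_on_compose2[OF a'_cont] continuous_on_compose2[OF F''_cont]) auto

text \<open>The change of the solution is the change of the data seen through the inverse of
  \<open>saddle\<close>. That inverse is bounded near a point by \<open>saddle_lower_bound\<close>,
  but only on the constraint set, whence the domain.\<close>

lemma response_cont: "continuous_on {p. snd (fst p) \<notin> \<sigma> \<and> F (fst p) = 0} (\<lambda>p. response (fst p) (snd p))"
    (is "continuous_on ?D _")
  unfolding continuous_on_def
proof
  fix p0 assume p0: "p0 \<in> ?D"
  obtain x0 v0 where xv: "p0 = (x0, v0)" by fastforce
  have "x0 \<in> \<Omega>" using p0 xv by (cases x0) auto
  then obtain \<delta> where \<delta>: "0 < \<delta>" "cball x0 \<delta> \<subseteq> \<Omega>"
    using open_\<Omega> open_contains_cball by blast
  define A where "A = cball x0 \<delta> \<inter> {x. F x = 0}"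
  have "closed {x. F x = 0}"
    by (intro closed_Collect_eq F_cont continuous_on_const)
  then have "compact A" unfolding A_def by (intro compact_Int_closed) auto
  moreover have "A \<subseteq> \<Omega>" "\<And>x. x \<in> A \<Longrightarrow> F x = 0" using \<delta>(2) by (auto simp: A_def)
  ultimately obtain \<kappa> where \<kappa>: "0 < \<kappa>" "\<And>x p. x \<in> A \<Longrightarrow> \<kappa> * norm p \<le> norm (saddle x p)"
    using saddle_lower_bound[of A] by blast
  let ?r = "response x0 v0"
  have cont: "continuous_on ?D (\<lambda>p. force (fst p) (snd p) - saddle (fst p) ?r)"
    by (intro continuous_intros force_cont saddle_cont) auto
  have "force x0 v0 - saddle x0 ?r = 0" using response_unique[of x0 ?r v0] p0 xv by auto
  then have "((\<lambda>p. force (fst p) (snd p) - saddle (fst p) ?r) \<longlongrightarrow> 0) (at p0 within ?D)"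
    using cont p0 unfolding continuous_on_def xv by (metis (mono_tags, lifting) fst_conv snd_conv)
  then have lim: "((\<lambda>p. 1 / \<kappa> * norm (force (fst p) (snd p) - saddle (fst p) ?r)) \<longlongrightarrow> 0) (at p0 within ?D)"
    by (intro tendsto_mult_right_zero tendsto_norm_zero)
  have "\<forall>\<^sub>F p in at p0 within ?D. dist p p0 < \<delta>"
    using \<delta>(1) by (auto simp: eventually_at)
  moreover have "\<forall>\<^sub>F p in at p0 within ?D. p \<in> ?D" by (auto simp: eventually_at_filter)
  ultimately have "\<forall>\<^sub>F p in at p0 within ?D. norm (response (fst p) (snd p) - ?r)
      \<le> 1 / \<kappa> * norm (force (fst p) (snd p) - saddle (fst p) ?r)"
  proof eventually_elim
    case (elim p)
    have "dist (fst p) x0 \<le> dist p p0" by (metis dist_fst_le fst_conv xv)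
    then have "fst p \<in> A" using elim by (auto simp: A_def dist_commute)
    then have "\<kappa> * norm (response (fst p) (snd p) - ?r) \<le> norm (saddle (fst p) (response (fst p) (snd p) - ?r))"
      by (rule \<kappa>)
    also have "\<dots> = norm (force (fst p) (snd p) - saddle (fst p) ?r)"
      using response_unique[of "fst p" "response (fst p) (snd p)" "snd p"] elim
      by (simp add: linear_diff[OF linear_saddle])
    finally show ?case using \<kappa>(1) by (simp add: field_simps)
  qed
  then have "((\<lambda>p. response (fst p) (snd p) - ?r) \<longlongrightarrow> 0) (at p0 within ?D)"
    using lim by (rule Lim_null_comparison)
  then show "((\<lambda>p. response (fst p) (snd p)) \<longlongrightarrow> response (fst p0) (snd p0)) (at p0 within ?D)"
    unfolding xv by (simp add: LIM_zero_cancel)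
qed

lemma accel_cont: "continuous_on {p. snd (fst p) \<notin> \<sigma> \<and> F (fst p) = 0} (\<lambda>p. accel (fst p) (snd p))"
  unfolding accel_def by (intro continuous_on_fst response_cont)

lemma multiplier_cont:
  "continuous_on {p. snd (fst p) \<notin> \<sigma> \<and> F (fst p) = 0} (\<lambda>p. multiplier (fst p) (snd p))"
  unfolding multiplier_def by (intro continuous_on_snd response_cont)

end

lemma sum_Basis_inner_linear:
  fixes f :: "'a::euclidean_space \<Rightarrow> real"
  assumes "linear f"
  shows "(\<Sum>b\<in>Basis. f b *\<^sub>R b) \<bullet> w = f w"
proof -
  have "f w = f (\<Sum>b\<in>Basis. (w \<bullet> b) *\<^sub>R b)" by (simp add: euclidean_representation)
  also have "\<dots> = (\<Sum>b\<in>Basis. (w \<bullet> b) * f b)"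
    by (simp add: linear_sum[OF assms] linear_scale[OF assms])
  also have "\<dots> = (\<Sum>b\<in>Basis. f b *\<^sub>R b) \<bullet> w"
    by (simp add: inner_sum_left inner_commute[of w] mult.commute)
  finally show ?thesis ..
qed

lemma compact_blinfun_bound:
  assumes "compact A" "continuous_on A f"
  obtains b where "0 < b" "\<And>x w. x \<in> A \<Longrightarrow> norm (blinfun_apply (f x) w) \<le> b * norm w"
proof -
  obtain b where b: "0 < b" "\<And>x. x \<in> A \<Longrightarrow> norm (f x) \<le> b"
    using compact_imp_bounded[OF compact_continuous_image[OF assms(2,1)]]
    by (auto simp: bounded_pos)
  show ?thesis
  proof (rule that[OF b(1)])
    fix x w assume "x \<in> A"
    have "norm (blinfun_apply (f x) w) \<le> norm (f x) * norm w" by (rule norm_blinfun)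
    also have "\<dots> \<le> b * norm w" using b(2)[OF \<open>x \<in> A\<close>] by (simp add: mult_right_mono)
    finally show "norm (blinfun_apply (f x) w) \<le> b * norm w" .
  qed
qed

section \<open>Discrete Euler-Lagrange equations: jump bounds and consistency\<close>

context mechanical_system
begin

lemma inner_Lz: "Lz x v \<bullet> w = 1/2 * (g' x (0, w) v \<bullet> v) + a' x (0, w) \<bullet> v - V' x (0, w)"
proof -
  have p: "(0::real, u + w) = (0, u) + (0, w)" "(0::real, c *\<^sub>R u) = c *\<^sub>R (0, u)" for u w :: 'a and c
    by simp_all
  have "linear (\<lambda>w. 1/2 * (g' x (0, w) v \<bullet> v) + a' x (0, w) \<bullet> v - V' x (0, w))"
    by (rule linearI; simp only: p blinfun.add_right blinfun.scaleR_right blinfun.add_left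
        blinfun.scaleR_left inner_add_left inner_scaleR_left; simp add: algebra_simps)
  then show ?thesis unfolding Lz_def by (rule sum_Basis_inner_linear)
qed

text \<open>One chain rule for three uses: variation of a grid point, of the velocity alone, and of
  the position alone. Symmetry of \<open>g\<close> merges the two terms in which the velocity
  varies.\<close>

lemma has_derivative_L:
  assumes X: "(X has_derivative X') (at s)" and W: "(W has_derivative W') (at s)"
    and s: "snd (X s) \<notin> \<sigma>"
  shows "((\<lambda>s. L (X s) (W s)) has_derivative
    (\<lambda>u. 1/2 * (g' (X s) (X' u) (W s) \<bullet> W s) + a' (X s) (X' u) \<bullet> W s - V' (X s) (X' u)
       + (g (X s) (W s) + a (X s)) \<bullet> W' u)) (at s)"
proof -
  have gX: "((\<lambda>s. g (X s)) has_derivative (\<lambda>u. g' (X s) (X' u))) (at s)"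
    by (rule has_derivative_compose[OF X g_deriv[OF s]])
  have aX: "((\<lambda>s. a (X s)) has_derivative (\<lambda>u. a' (X s) (X' u))) (at s)"
    by (rule has_derivative_compose[OF X a_deriv[OF s]])
  have VX: "((\<lambda>s. V (X s)) has_derivative (\<lambda>u. V' (X s) (X' u))) (at s)"
    by (rule has_derivative_compose[OF X V_deriv[OF s]])
  have gW: "((\<lambda>s. g (X s) (W s)) has_derivative (\<lambda>u. g (X s) (W' u) + g' (X s) (X' u) (W s))) (at s)"
    by (rule blinfun.FDERIV[OF gX W])
  have "((\<lambda>s. 1/2 * (g (X s) (W s) \<bullet> W s) + a (X s) \<bullet> W s - V (X s)) has_derivative
    (\<lambda>u. 1/2 * (g (X s) (W s) \<bullet> W' u + (g (X s) (W' u) + g' (X s) (X' u) (W s)) \<bullet> W s)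
      + (a (X s) \<bullet> W' u + a' (X s) (X' u) \<bullet> W s) - V' (X s) (X' u))) (at s)"
    by (intro has_derivative_diff has_derivative_add has_derivative_mult_right has_derivative_inner gW aX VX W)
  moreover have "1/2 * (g (X s) (W s) \<bullet> W' u + (g (X s) (W' u) + g' (X s) (X' u) (W s)) \<bullet> W s)
      + (a (X s) \<bullet> W' u + a' (X s) (X' u) \<bullet> W s) - V' (X s) (X' u)
    = 1/2 * (g' (X s) (X' u) (W s) \<bullet> W s) + a' (X s) (X' u) \<bullet> W s - V' (X s) (X' u)
       + (g (X s) (W s) + a (X s)) \<bullet> W' u" for u
    using g_sym[OF s, of "W s" "W' u"] by (simp add: inner_add_left inner_add_right inner_commute)
  ultimately show ?thesis unfolding L_def by (simp only:)
qed

text \<open>An interior grid point \<open>y\<close> enters two summands of the discrete action: as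
  base point and left end of the step to \<open>yp\<close>, and as right end of the step from
  \<open>ym\<close>. The multiplier rule for their sum gives the equation.\<close>

lemma discrete_euler_lagrange:
  assumes h: "0 < h" and y: "y \<notin> \<sigma>" "snd xm \<notin> \<sigma>" "F (t, y) = 0" and "0 < r"
    and min: "\<And>y'. norm (y' - y) < r \<Longrightarrow> F (t, y') = 0 \<Longrightarrow>
      h * L (t, y) ((yp - y) /\<^sub>R h) + h * L xm ((y - ym) /\<^sub>R h)
        \<le> h * L (t, y') ((yp - y') /\<^sub>R h) + h * L xm ((y' - ym) /\<^sub>R h)"
  obtains \<mu> where "E \<mu> = 0"
    "h *\<^sub>R Lz (t, y) ((yp - y) /\<^sub>R h) - (g (t, y) ((yp - y) /\<^sub>R h) + a (t, y))
      + (g xm ((y - ym) /\<^sub>R h) + a xm) = Bt (t, y) \<mu>"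
proof (rule lagrange_multiplier[where r = r])
  let ?v = "(yp - y) /\<^sub>R h" and ?vm = "(y - ym) /\<^sub>R h"
  have d1: "((\<lambda>y'. L (t, y') ((yp - y') /\<^sub>R h)) has_derivative
     (\<lambda>u. Lz (t, y) ?v \<bullet> u + (g (t, y) ?v + a (t, y)) \<bullet> (- u /\<^sub>R h))) (at y)"
    unfolding inner_Lz
    by (rule has_derivative_L[where X = "\<lambda>y. (t, y)"]) (auto intro!: derivative_eq_intros simp: y)
  have "((\<lambda>y'. L xm ((y' - ym) /\<^sub>R h)) has_derivative
     (\<lambda>u. 1/2 * (g' xm 0 ?vm \<bullet> ?vm) + a' xm 0 \<bullet> ?vm - V' xm 0
       + (g xm ?vm + a xm) \<bullet> (u /\<^sub>R h))) (at y)"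
    by (rule has_derivative_L[where X = "\<lambda>y. xm"]) (auto intro!: derivative_eq_intros simp: y)
  then have d2: "((\<lambda>y'. L xm ((y' - ym) /\<^sub>R h)) has_derivative (\<lambda>u. (g xm ?vm + a xm) \<bullet> (u /\<^sub>R h))) (at y)"
    by (simp add: blinfun.zero_right)
  have "((\<lambda>y'. h * L (t, y') ((yp - y') /\<^sub>R h) + h * L xm ((y' - ym) /\<^sub>R h)) has_derivative
    (\<lambda>u. h * (Lz (t, y) ?v \<bullet> u + (g (t, y) ?v + a (t, y)) \<bullet> (- u /\<^sub>R h))
     + h * ((g xm ?vm + a xm) \<bullet> (u /\<^sub>R h)))) (at y)"
    by (intro has_derivative_add has_derivative_mult_right d1 d2)
  moreover have "h * (q \<bullet> u + p \<bullet> (- u /\<^sub>R h)) + h * (p' \<bullet> (u /\<^sub>R h)) = (h *\<^sub>R q - p + p') \<bullet> u"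
    for p p' q u :: 'a
    using h by (simp add: inner_add_left inner_diff_left field_simps)
  ultimately show "((\<lambda>y'. h * L (t, y') ((yp - y') /\<^sub>R h) + h * L xm ((y' - ym) /\<^sub>R h)) has_derivative
    (\<lambda>u. (h *\<^sub>R Lz (t, y) ?v - (g (t, y) ?v + a (t, y)) + (g xm ?vm + a xm)) \<bullet> u)) (at y)"
    by (simp only:)
qed (use assms that in auto)

text \<open>The difference of momenta is rearranged so that the leading coefficients are all taken
  at \<open>x\<close>. The unknowns are then the velocity jump and the multiplier together, and
  inverting \<open>saddle\<close> estimates both at once.\<close>

lemma discrete_saddle:
  assumes eq: "h *\<^sub>R Lz x v - (g x v + a x) + (g xm vm + a xm) = Bt x \<mu>" and "E \<mu> = 0"
  shows "saddle x (v - vm, - \<mu>) =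
    (h *\<^sub>R Lz x v - (g x - g xm) vm - (a x - a xm), B x (v - vm))"
proof -
  have "g x (v - vm) + Bt x \<mu> = h *\<^sub>R Lz x v - (g x - g xm) vm - (a x - a xm)"
    unfolding eq[symmetric] by (simp add: blinfun.diff_left blinfun.diff_right)
  moreover have "Bt x (- \<mu>) = - Bt x \<mu>" "E (- \<mu>) = 0"
    using linear_neg[OF linear_Bt] linear_neg[OF linear_E] assms(2) by auto
  ultimately show ?thesis by (simp add: saddle_def)
qed

text \<open>Three consecutive grid points, encoded by the middle one and the two velocities: the
  neighbours of \<open>x\<close> are \<open>x + h (1, v)\<close> and
  \<open>x - h (1, vm)\<close>.\<close>

definition discrete_motion :: "real \<Rightarrow> real \<times> 'a \<Rightarrow> 'a \<Rightarrow> 'a \<Rightarrow> bool" where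
  "discrete_motion h x v vm \<longleftrightarrow> 0 < h \<and> F (x + h *\<^sub>R (1, v)) = 0 \<and> F (x - h *\<^sub>R (1, vm)) = 0 \<and>
    (\<exists>\<mu>. E \<mu> = 0 \<and> h *\<^sub>R Lz x v - (g x v + a x)
      + (g (x - h *\<^sub>R (1, vm)) vm + a (x - h *\<^sub>R (1, vm))) = Bt x \<mu>)"

lemma Lz_bound:
  assumes "compact A" "A \<subseteq> \<Omega>"
  obtains c where "0 < c" "\<And>x v. x \<in> A \<Longrightarrow> norm (Lz x v) \<le> c * (1 + (norm v)\<^sup>2)"
proof -
  obtain b1 where b1: "0 < b1" "\<And>x w. x \<in> A \<Longrightarrow> norm (g' x w) \<le> b1 * norm w"
    using compact_blinfun_bound[OF assms(1) continuous_on_subset[OF g'_cont assms(2)]] by blast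
  obtain b2 where b2: "0 < b2" "\<And>x w. x \<in> A \<Longrightarrow> norm (a' x w) \<le> b2 * norm w"
    using compact_blinfun_bound[OF assms(1) continuous_on_subset[OF a'_cont assms(2)]] by blast
  obtain b3 where b3: "0 < b3" "\<And>x w. x \<in> A \<Longrightarrow> norm (V' x w) \<le> b3 * norm w"
    using compact_blinfun_bound[OF assms(1) continuous_on_subset[OF V'_cont assms(2)]] by blast
  define c where "c = real (card (Basis::'a set)) * (b1 + b2 + b3)"
  show ?thesis
  proof (rule that[of c])
    show "0 < c" using b1 b2 b3 by (simp add: c_def)
    fix x v assume x: "x \<in> A"
    have "norm (Lz x v) \<le> (\<Sum>b\<in>(Basis::'a set). (b1 + b2 + b3) * (1 + (norm v)\<^sup>2))"
      unfolding Lz_def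
    proof (rule sum_norm_le)
      fix b :: 'a assume b: "b \<in> Basis"
      have nb: "norm (0::real, b) = 1" using b by (simp add: norm_Pair)
      have "norm (g' x (0, b) v) \<le> norm (g' x (0, b)) * norm v" by (rule norm_blinfun)
      also have "\<dots> \<le> b1 * norm v"
        using b1(2)[OF x, of "(0, b)"] unfolding nb by (intro mult_right_mono) auto
      finally have "norm (g' x (0, b) v) * norm v \<le> b1 * norm v * norm v"
        by (rule mult_right_mono) simp
      then have "\<bar>g' x (0, b) v \<bullet> v\<bar> \<le> b1 * norm v * norm v"
        by (rule order_trans[OF Cauchy_Schwarz_ineq2])
      then have 1: "\<bar>1/2 * (g' x (0, b) v \<bullet> v)\<bar> \<le> b1 * (norm v)\<^sup>2"
        using b1(1) by (simp add: power2_eq_square)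
      have "\<bar>a' x (0, b) \<bullet> v\<bar> \<le> norm (a' x (0, b)) * norm v" by (rule Cauchy_Schwarz_ineq2)
      also have "\<dots> \<le> b2 * norm v"
        using b2(2)[OF x, of "(0, b)"] unfolding nb by (intro mult_right_mono) auto
      also have "\<dots> \<le> b2 * (1 + (norm v)\<^sup>2)"
      proof -
        have "2 * norm v \<le> 1 + (norm v)\<^sup>2" using sum_squares_bound[of 1 "norm v"] by simp
        then have "norm v \<le> 1 + (norm v)\<^sup>2" using norm_ge_zero[of v] by linarith
        then show ?thesis using b2(1) by simp
      qed
      finally have 2: "\<bar>a' x (0, b) \<bullet> v\<bar> \<le> b2 * (1 + (norm v)\<^sup>2)" .
      have 3: "\<bar>V' x (0, b)\<bar> \<le> b3" using b3(2)[OF x, of "(0, b)"] unfolding nb by simp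
      have "norm ((1/2 * (g' x (0, b) v \<bullet> v) + a' x (0, b) \<bullet> v - V' x (0, b)) *\<^sub>R b)
        = \<bar>1/2 * (g' x (0, b) v \<bullet> v) + a' x (0, b) \<bullet> v - V' x (0, b)\<bar>"
        using b by simp
      also have "\<dots> \<le> b1 * (norm v)\<^sup>2 + b2 * (1 + (norm v)\<^sup>2) + b3" using 1 2 3 by linarith
      also have "\<dots> \<le> (b1 + b2 + b3) * (1 + (norm v)\<^sup>2)"
        using b1(1) b3(1) by (simp add: algebra_simps)
      finally show "norm ((1/2 * (g' x (0, b) v \<bullet> v) + a' x (0, b) \<bullet> v - V' x (0, b)) *\<^sub>R b)
        \<le> (b1 + b2 + b3) * (1 + (norm v)\<^sup>2)" .
    qed
    then show "norm (Lz x v) \<le> c * (1 + (norm v)\<^sup>2)" by (simp add: c_def)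
  qed
qed

text \<open>The first row of \<open>discrete_saddle\<close> is bounded through the growth of
  \<open>Lz\<close> and the Lipschitz constants of \<open>g\<close> and \<open>a\<close>. For the
  second, \<open>F\<close> vanishes at \<open>x\<close> and at both neighbours, so Taylor expansion
  bounds \<open>B x (v - vm)\<close>. At this stage only \<open>h\<close> times the velocity is
  known to be small, so the quadratic growth has to stay explicit.\<close>

lemma discrete_step_bound:
  assumes A: "compact A" "A \<subseteq> \<Omega>" "\<And>x. x \<in> A \<Longrightarrow> F x = 0"
  obtains d C where "0 < d" "0 \<le> C"
    "\<forall>h x v vm. discrete_motion h x v vm \<longrightarrow> x \<in> A \<longrightarrow> h * norm (1::real, v) < d \<longrightarrow>
      h * norm (1::real, vm) < d \<longrightarrow> norm (v - vm) \<le> C * h * (1 + (norm v)\<^sup>2 + (norm vm)\<^sup>2)"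
proof -
  obtain \<kappa> where \<kappa>: "0 < \<kappa>" "\<And>x p. x \<in> A \<Longrightarrow> \<kappa> * norm p \<le> norm (saddle x p)"
    using saddle_lower_bound[OF A] by blast
  obtain c1 where c1: "0 < c1" "\<And>x v. x \<in> A \<Longrightarrow> norm (Lz x v) \<le> c1 * (1 + (norm v)\<^sup>2)"
    using Lz_bound[OF A(1,2)] by blast
  obtain d1 c2 where c2: "0 < d1" "0 \<le> c2"
    "\<And>x y. x \<in> A \<Longrightarrow> norm y < d1 \<Longrightarrow> norm (g (x + y) - g x) \<le> c2 * norm y"
    using compact_uniform_lipschitz[OF open_\<Omega> _ g'_cont A(1,2), of g] g_deriv by (metis ComplD mem_Times_iff)
  obtain d2 c3 where c3: "0 < d2" "0 \<le> c3"
    "\<And>x y. x \<in> A \<Longrightarrow> norm y < d2 \<Longrightarrow> norm (a (x + y) - a x) \<le> c3 * norm y"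
    using compact_uniform_lipschitz[OF open_\<Omega> _ a'_cont A(1,2), of a] a_deriv by (metis ComplD mem_Times_iff)
  obtain d3 where d3: "0 < d3" "\<And>x y. x \<in> A \<Longrightarrow> norm y < d3 \<Longrightarrow>
       norm (F (x + y) - F x - F' x y - (1/2) *\<^sub>R F'' x y y) \<le> 1 * (norm y)\<^sup>2"
    using compact_uniform_taylor2[OF open_UNIV F_deriv F'_deriv F''_cont A(1) subset_UNIV zero_less_one]
    by blast
  obtain b where b: "0 < b" "\<And>x w. x \<in> A \<Longrightarrow> norm (F'' x w) \<le> b * norm w"
    using compact_blinfun_bound[OF A(1) continuous_on_subset[OF F''_cont subset_UNIV]] by blast
  define d where "d = min d1 (min d2 d3)"
  define c4 where "c4 = 1 + b"
  have F2: "norm (F' x y) \<le> c4 * (norm y)\<^sup>2" if "x \<in> A" "norm y < d" "F (x + y) = 0" for x y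
  proof -
    have "norm (F' x y + (1/2) *\<^sub>R F'' x y y) \<le> (norm y)\<^sup>2"
      using d3(2)[of x y] that A(3)[OF that(1)] norm_minus_cancel[of "F' x y + (1/2) *\<^sub>R F'' x y y"]
      by (simp add: d_def del: norm_minus_cancel)
    moreover have "norm ((1/2) *\<^sub>R F'' x y y) \<le> b * (norm y)\<^sup>2"
    proof -
      have "norm (F'' x y y) \<le> norm (F'' x y) * norm y" by (rule norm_blinfun)
      also have "\<dots> \<le> b * norm y * norm y" by (rule mult_right_mono[OF b(2)[OF that(1)]]) simp
      finally have "norm (F'' x y y) \<le> b * (norm y)\<^sup>2" by (simp add: power2_eq_square mult.assoc)
      then show ?thesis using norm_ge_zero[of "F'' x y y"] unfolding norm_scaleR by linarith
    qed
    ultimately show ?thesis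
      using norm_triangle_sub[of "F' x y" "- ((1/2) *\<^sub>R F'' x y y)"] by (simp add: c4_def algebra_simps)
  qed
  define C where "C = (c1 + 2 * c2 + 2 * c3 + 2 * c4) / \<kappa>"
  show ?thesis
  proof (rule that[of d C], goal_cases)
    case 1 show "0 < d" using c2 c3 d3 by (simp add: d_def)
  next
    case 2 show "0 \<le> C" using c1 c2 c3 b \<kappa> by (simp add: C_def c4_def)
  next
    case 3 show ?case
  proof (intro allI impI)
    fix h x v vm
    assume dm: "discrete_motion h x v vm" and x: "x \<in> A"
      and hv: "h * norm (1::real, v) < d" "h * norm (1::real, vm) < d"
    obtain \<mu> where h: "0 < h" and F0: "F (x + h *\<^sub>R (1, v)) = 0" "F (x - h *\<^sub>R (1, vm)) = 0" and "E \<mu> = 0"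
      and eq: "h *\<^sub>R Lz x v - (g x v + a x) + (g (x - h *\<^sub>R (1, vm)) vm + a (x - h *\<^sub>R (1, vm))) = Bt x \<mu>"
      using dm unfolding discrete_motion_def by blast
    define Q where "Q = 1 + (norm v)\<^sup>2 + (norm vm)\<^sup>2"
    have n1: "(norm (1::real, w))\<^sup>2 = 1 + (norm w)\<^sup>2" for w :: 'a by (simp add: norm_Pair)
    have n2: "norm (1::real, w) \<le> 1 + (norm w)\<^sup>2" for w :: 'a
    proof -
      have "norm (1::real) \<le> norm (1::real, w)" by (rule norm_fst_le)
      then have "norm (1::real, w) * 1 \<le> norm (1::real, w) * norm (1::real, w)" by (intro mult_left_mono) auto
      then show ?thesis using n1[of w] by (simp add: power2_eq_square)
    qed
    have n3: "norm w * norm (1::real, w) \<le> 1 + (norm w)\<^sup>2" for w :: 'a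
    proof -
      have "norm w * norm (1::real, w) \<le> norm (1::real, w) * norm (1::real, w)"
        by (intro mult_right_mono norm_snd_le) simp
      then show ?thesis using n1[of w] by (simp add: power2_eq_square)
    qed
    define y where "y = - (h *\<^sub>R (1::real, vm))"
    define z where "z = h *\<^sub>R (1::real, v)"
    define xm where "xm = x - h *\<^sub>R (1::real, vm)"
    have xm: "x + y = xm" by (simp add: xm_def y_def)
    have Fy: "F (x + y) = 0" "F (x + z) = 0"
      unfolding xm z_def unfolding xm_def by (rule F0)+
    note eq = eq[folded xm_def]
    have ny: "norm y = h * norm (1::real, vm)" "norm z = h * norm (1::real, v)"
      unfolding y_def z_def norm_minus_cancel norm_scaleR using h by simp_all
    have yd: "norm y < d" and zd: "norm z < d"
      unfolding ny using hv by blast+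
    have e1: "norm (h *\<^sub>R Lz x v) \<le> c1 * h * Q"
    proof -
      have "norm (h *\<^sub>R Lz x v) \<le> h * (c1 * (1 + (norm v)\<^sup>2))"
        using c1(2)[OF x, of v] h by simp
      also have "\<dots> \<le> h * (c1 * Q)" using h c1(1) by (simp add: Q_def)
      finally show ?thesis by (simp add: ac_simps)
    qed
    have e2: "norm ((g x - g (xm)) vm) \<le> 2 * c2 * h * Q"
    proof -
      have "norm (g (x + y) - g x) \<le> c2 * (h * norm (1::real, vm))"
        unfolding ny(1)[symmetric] by (rule c2(3)[OF x order_less_le_trans[OF yd]]) (simp add: d_def)
      then have "norm ((g x - g (xm)) vm) \<le> c2 * (h * norm (1::real, vm)) * norm vm"
        by (intro order_trans[OF norm_blinfun] mult_right_mono) (auto simp: norm_minus_commute xm)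
      also have "\<dots> = c2 * h * (norm vm * norm (1::real, vm))" by simp
      also have "\<dots> \<le> c2 * h * Q"
        using n3[of vm] c2(2) h by (intro mult_left_mono) (auto simp: Q_def intro: order_trans)
      also have "\<dots> \<le> 2 * c2 * h * Q" using c2(2) h by (simp add: Q_def)
      finally show ?thesis .
    qed
    have e3: "norm (a x - a (xm)) \<le> 2 * c3 * h * Q"
    proof -
      have "norm (a (x + y) - a x) \<le> c3 * (h * norm (1::real, vm))"
        unfolding ny(1)[symmetric] by (rule c3(3)[OF x order_less_le_trans[OF yd]]) (simp add: d_def)
      also have "\<dots> = c3 * h * norm (1::real, vm)" by simp
      also have "\<dots> \<le> c3 * h * Q"
        using n2[of vm] c3(2) h by (intro mult_left_mono) (auto simp: Q_def intro: order_trans)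
      also have "\<dots> \<le> 2 * c3 * h * Q" using c3(2) h by (simp add: Q_def)
      finally show ?thesis by (simp add: norm_minus_commute xm)
    qed
    have e4: "norm (B x (v - vm)) \<le> 2 * c4 * h * Q"
    proof -
      have "norm (F' x z) \<le> c4 * (h * norm (1::real, v))\<^sup>2"
        unfolding ny(2)[symmetric] by (rule F2[OF x zd Fy(2)])
      moreover have "norm (F' x y) \<le> c4 * (h * norm (1::real, vm))\<^sup>2"
        unfolding ny(1)[symmetric] by (rule F2[OF x yd Fy(1)])
      \<comment> \<open>The increments towards the two neighbours add up to
        \<open>h (0, v - vm)\<close>: their time components cancel.\<close>
      moreover have "h *\<^sub>R B x (v - vm) = F' x z + F' x y"
        unfolding B_def blinfun.add_right[symmetric] blinfun.scaleR_right[symmetric]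
        by (simp add: y_def z_def scaleR_diff_right)
      ultimately have "h * norm (B x (v - vm)) \<le> c4 * (h * norm (1::real, v))\<^sup>2 + c4 * (h * norm (1::real, vm))\<^sup>2"
        using h norm_triangle_ineq[of "F' x z" "F' x y"] norm_scaleR[of h "B x (v - vm)"] by simp
      also have "\<dots> = h * (c4 * h * ((1 + (norm v)\<^sup>2) + (1 + (norm vm)\<^sup>2)))"
        unfolding power_mult_distrib n1 by (simp add: algebra_simps power2_eq_square)
      finally have "norm (B x (v - vm)) \<le> c4 * h * ((1 + (norm v)\<^sup>2) + (1 + (norm vm)\<^sup>2))"
        using h by simp
      also have "\<dots> \<le> c4 * h * (2 * Q)"
        using h b(1) by (intro mult_left_mono) (auto simp: Q_def c4_def)
      finally show ?thesis by (simp add: ac_simps)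
    qed
    have "\<kappa> * norm (v - vm, - \<mu>) \<le>
        norm (h *\<^sub>R Lz x v - (g x - g (xm)) vm - (a x - a (xm)), B x (v - vm))"
      using \<kappa>(2)[OF x, of "(v - vm, - \<mu>)"] discrete_saddle[OF eq \<open>E \<mu> = 0\<close>] by simp
    also have "\<dots> \<le> norm (h *\<^sub>R Lz x v - (g x - g (xm)) vm - (a x - a (xm)))
       + norm (B x (v - vm))" by (rule norm_Pair_le)
    also have "\<dots> \<le> (c1 * h * Q + 2 * c2 * h * Q + 2 * c3 * h * Q) + 2 * c4 * h * Q"
      by (intro add_mono norm_triangle_le_diff e1 e2 e3 e4)
    finally have "\<kappa> * norm (v - vm, - \<mu>) \<le> (c1 + 2 * c2 + 2 * c3 + 2 * c4) * h * Q"
      by (simp add: algebra_simps)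
    moreover have "norm (v - vm) \<le> norm (v - vm, - \<mu>)" by (rule norm_fst_le)
    then have "\<kappa> * norm (v - vm) \<le> \<kappa> * norm (v - vm, - \<mu>)" using \<kappa>(1) by simp
    ultimately have "\<kappa> * norm (v - vm) \<le> (c1 + 2 * c2 + 2 * c3 + 2 * c4) * h * Q" by linarith
    then have "norm (v - vm) \<le> (c1 + 2 * c2 + 2 * c3 + 2 * c4) * h * Q / \<kappa>"
      using \<kappa>(1) by (simp only: pos_le_divide_eq mult.commute)
    then show "norm (v - vm) \<le> C * h * (1 + (norm v)\<^sup>2 + (norm vm)\<^sup>2)"
      by (simp only: C_def Q_def[symmetric] times_divide_eq_left)
  qed
  qed
qed

end

lemma blinfun_quadratic_diff:
  assumes b: "\<And>w. norm (blinfun_apply f w) \<le> b * norm w" and "0 \<le> b"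
  shows "norm (blinfun_apply (blinfun_apply f \<xi>) v - blinfun_apply (blinfun_apply f \<zeta>) w)
    \<le> b * norm (\<xi> - \<zeta>) * norm v + b * norm \<zeta> * norm (v - w)"
proof -
  have "blinfun_apply (blinfun_apply f \<xi>) v - blinfun_apply (blinfun_apply f \<zeta>) w =
     blinfun_apply (blinfun_apply f (\<xi> - \<zeta>)) v + blinfun_apply (blinfun_apply f \<zeta>) (v - w)"
    by (simp add: blinfun.diff_left blinfun.diff_right)
  also have "norm \<dots> \<le> norm (blinfun_apply f (\<xi> - \<zeta>)) * norm v + norm (blinfun_apply f \<zeta>) * norm (v - w)"
    by (intro norm_triangle_le add_mono norm_blinfun)
  also have "\<dots> \<le> b * norm (\<xi> - \<zeta>) * norm v + b * norm \<zeta> * norm (v - w)"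
    by (intro add_mono mult_right_mono b) auto
  finally show ?thesis .
qed

context mechanical_system
begin

text \<open>With velocities and jumps bounded, \<open>saddle\<close> maps
  \<open>(v - vm, - \<mu>)\<close> and \<open>h\<close> times \<open>response\<close> to vectors
  whose difference is of smaller order than \<open>h\<close>; inverting \<open>saddle\<close>
  uniformly transfers this to the jump itself.\<close>

lemma discrete_step_consistent:
  assumes A: "compact A" "A \<subseteq> \<Omega>" "\<And>x. x \<in> A \<Longrightarrow> F x = 0"
    and "0 \<le> R" "0 \<le> C" "0 < \<epsilon>"
  obtains h0 where "0 < h0"
    "\<forall>h x v vm. discrete_motion h x v vm \<longrightarrow> h < h0 \<longrightarrow> x \<in> A \<longrightarrow> norm v \<le> R \<longrightarrow> norm vm \<le> R \<longrightarrow>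
      norm (v - vm) \<le> C * h \<longrightarrow> norm (v - vm - h *\<^sub>R accel x v) \<le> \<epsilon> * h"
proof -
  obtain \<kappa> where \<kappa>: "0 < \<kappa>" "\<And>x p. x \<in> A \<Longrightarrow> \<kappa> * norm p \<le> norm (saddle x p)"
    using saddle_lower_bound[OF A] by blast
  obtain b1 where b1: "0 < b1" "\<And>x w. x \<in> A \<Longrightarrow> norm (g' x w) \<le> b1 * norm w"
    using compact_blinfun_bound[OF A(1) continuous_on_subset[OF g'_cont A(2)]] by blast
  obtain b2 where b2: "0 < b2" "\<And>x w. x \<in> A \<Longrightarrow> norm (a' x w) \<le> b2 * norm w"
    using compact_blinfun_bound[OF A(1) continuous_on_subset[OF a'_cont A(2)]] by blast
  obtain b3 where b3: "0 < b3" "\<And>x w. x \<in> A \<Longrightarrow> norm (F'' x w) \<le> b3 * norm w"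
    using compact_blinfun_bound[OF A(1) continuous_on_subset[OF F''_cont subset_UNIV]] by blast
  define W where "W = 1 + R"
  have W: "0 < W" "R \<le> W" using \<open>0 \<le> R\<close> by (simp_all add: W_def)
  \<comment> \<open>\<open>c1\<close> collects the coefficients of the Taylor accuracy
    \<open>e\<close>, and \<open>c2\<close> those of the extra factor \<open>h\<close> that arises
    when \<open>vm\<close> is replaced by \<open>v\<close>. The choice of \<open>e\<close> and the
    last entry of \<open>h0\<close> give each of them half of
    \<open>\<kappa> * \<epsilon>\<close>.\<close>
  define c1 where "c1 = W * W + W + 2 * W * W"
  define c2 where "c2 = b1 * C * W + b1 * W * C + b2 * C + b3 * C * W + b3 * W * C"
  have c: "0 < c1" "0 \<le> c2"
    using W b1 b2 b3 \<open>0 \<le> C\<close> by (simp_all add: c1_def c2_def add_pos_pos)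
  define e where "e = \<kappa> * \<epsilon> / (2 * c1)"
  have e: "0 < e" "c1 * e = \<kappa> * \<epsilon> / 2"
    using \<kappa> \<open>0 < \<epsilon>\<close> c by (simp_all add: e_def)
  obtain d1 where d1: "0 < d1" "\<And>x y z. x \<in> A \<Longrightarrow> norm y < d1 \<Longrightarrow> norm z < d1 \<Longrightarrow>
       x + y \<in> \<Omega> \<and> norm (g (x + y) - g (x + z) - g' x (y - z)) \<le> e * norm (y - z)"
    using compact_uniform_strict_derivative[OF open_\<Omega> _ g'_cont A(1,2) e(1), of g] g_deriv
    by (metis ComplD mem_Times_iff)
  obtain d2 where d2: "0 < d2" "\<And>x y z. x \<in> A \<Longrightarrow> norm y < d2 \<Longrightarrow> norm z < d2 \<Longrightarrow>
       x + y \<in> \<Omega> \<and> norm (a (x + y) - a (x + z) - a' x (y - z)) \<le> e * norm (y - z)"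
    using compact_uniform_strict_derivative[OF open_\<Omega> _ a'_cont A(1,2) e(1), of a] a_deriv
    by (metis ComplD mem_Times_iff)
  obtain d3 where d3: "0 < d3" "\<And>x y. x \<in> A \<Longrightarrow> norm y < d3 \<Longrightarrow>
       norm (F (x + y) - F x - F' x y - (1/2) *\<^sub>R F'' x y y) \<le> e * (norm y)\<^sup>2"
    using compact_uniform_taylor2[OF open_UNIV F_deriv F'_deriv F''_cont A(1) subset_UNIV e(1)]
    by blast
  define h0 where "h0 = min (min (d1 / W) (d2 / W)) (min (d3 / W) (\<kappa> * \<epsilon> / (2 * (c2 + 1))))"
  show ?thesis
  proof (rule that[of h0], goal_cases)
    case 1 show "0 < h0" using d1 d2 d3 W \<kappa> \<open>0 < \<epsilon>\<close> c by (simp add: h0_def)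
  next
    case 2 show ?case
  proof (intro allI impI)
    fix h x v vm
    assume dm: "discrete_motion h x v vm" and h0: "h < h0" and x: "x \<in> A"
      and v: "norm v \<le> R" "norm vm \<le> R" and vv: "norm (v - vm) \<le> C * h"
    obtain \<mu> where "0 < h" and F0: "F (x + h *\<^sub>R (1, v)) = 0" "F (x - h *\<^sub>R (1, vm)) = 0" and "E \<mu> = 0"
      and eq: "h *\<^sub>R Lz x v - (g x v + a x) + (g (x - h *\<^sub>R (1, vm)) vm + a (x - h *\<^sub>R (1, vm))) = Bt x \<mu>"
      using dm unfolding discrete_motion_def by blast
    note h = \<open>0 < h\<close> h0
    have xO: "snd x \<notin> \<sigma>" "F x = 0" using x A(2) A(3)[OF x] by (cases x, auto)+
    have hW: "h * W < d1" "h * W < d2" "h * W < d3"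
      using h(2) W(1) by (simp_all add: h0_def pos_less_divide_eq)
    have hc: "c2 * h \<le> \<kappa> * \<epsilon> / 2"
    proof -
      have "h * (2 * (c2 + 1)) < \<kappa> * \<epsilon>"
        using h(2) c(2) by (simp add: h0_def pos_less_divide_eq)
      then show ?thesis using h(1) by (simp add: algebra_simps)
    qed
    define \<xi> where "\<xi> = (1::real, v)"
    define \<zeta> where "\<zeta> = (1::real, vm)"
    define y where "y = - (h *\<^sub>R \<zeta>)"
    define z where "z = h *\<^sub>R \<xi>"
    define xm where "xm = x - h *\<^sub>R \<zeta>"
    have xm: "x + y = xm" by (simp add: xm_def y_def)
    have Fy: "F (x + y) = 0" "F (x + z) = 0"
      unfolding xm z_def unfolding xm_def \<xi>_def \<zeta>_def by (rule F0)+
    note eq = eq[folded \<zeta>_def, folded xm_def]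
    have n\<xi>: "norm \<xi> \<le> W" "norm \<zeta> \<le> W"
      using norm_Pair_le[of "1::real" v] norm_Pair_le[of "1::real" vm] v by (simp_all add: W_def \<xi>_def \<zeta>_def)
    have \<xi>\<zeta>: "norm (\<xi> - \<zeta>) \<le> C * h" using vv by (simp add: \<xi>_def \<zeta>_def norm_Pair)
    have ny: "norm y \<le> h * W" "norm z \<le> h * W"
      unfolding y_def z_def norm_minus_cancel norm_scaleR using h(1) n\<xi> by simp_all
    have vW: "norm v \<le> W" "norm vm \<le> W" using v W by linarith+
    define \<rho>1 where "\<rho>1 = h *\<^sub>R Lz x v - (g x - g xm) vm - (a x - a xm)"
    define \<rho>2 where "\<rho>2 = B x (v - vm)"
    have sad: "saddle x (v - vm, - \<mu>) = (\<rho>1, \<rho>2)"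
      unfolding \<rho>1_def \<rho>2_def by (rule discrete_saddle[OF eq \<open>E \<mu> = 0\<close>])
    have G: "norm (g xm - g x - g' x y) \<le> e * (h * W)"
    proof -
      have "norm (g (x + y) - g (x + 0) - g' x (y - 0)) \<le> e * norm (y - 0)"
        using d1(2)[OF x, of y 0] ny hW d1(1) by auto
      also have "\<dots> \<le> e * (h * W)" using ny e(1) by simp
      finally show ?thesis by (simp add: xm)
    qed
    have Ga: "norm (a xm - a x - a' x y) \<le> e * (h * W)"
    proof -
      have "norm (a (x + y) - a (x + 0) - a' x (y - 0)) \<le> e * norm (y - 0)"
        using d2(2)[OF x, of y 0] ny hW d2(1) by auto
      also have "\<dots> \<le> e * (h * W)" using ny e(1) by simp
      finally show ?thesis by (simp add: xm)
    qed
    have 1: "norm (\<rho>1 - h *\<^sub>R fst (force x v)) \<le> (e * (W * W + W) + (b1 * C * W + b1 * W * C + b2 * C) * h) * h"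
    proof -
      have "\<rho>1 - h *\<^sub>R fst (force x v) =
        (g xm - g x - g' x y) vm + (a xm - a x - a' x y) + (h *\<^sub>R (g' x \<xi> v - g' x \<zeta> vm) + h *\<^sub>R a' x (\<xi> - \<zeta>))"
        by (simp add: \<rho>1_def force_def \<xi>_def[symmetric] y_def blinfun.add_left blinfun.diff_left blinfun.diff_right
            blinfun.minus_left blinfun.minus_right blinfun.scaleR_right blinfun.scaleR_left scaleR_diff_right)
      also have "norm \<dots> \<le> e * (h * W) * W + e * (h * W) + (h * (b1 * (C * h) * W + b1 * W * (C * h)) + h * (b2 * (C * h)))"
      proof (intro norm_triangle_le add_mono)
        have "norm ((g xm - g x - g' x y) vm) \<le> norm (g xm - g x - g' x y) * norm vm" by (rule norm_blinfun)
        also have "\<dots> \<le> e * (h * W) * W"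
          using G vW W h e by (intro mult_mono) auto
        finally show "norm ((g xm - g x - g' x y) vm) \<le> e * (h * W) * W" .
        show "norm (a xm - a x - a' x y) \<le> e * (h * W)" by (rule Ga)
        have "norm (g' x \<xi> v - g' x \<zeta> vm) \<le> b1 * norm (\<xi> - \<zeta>) * norm v + b1 * norm \<zeta> * norm (v - vm)"
          using b1 x by (intro blinfun_quadratic_diff) auto
        also have "\<dots> \<le> b1 * (C * h) * W + b1 * W * (C * h)"
          using b1(1) \<xi>\<zeta> vW n\<xi> vv W h \<open>0 \<le> C\<close> by (intro add_mono mult_mono) auto
        finally show "norm (h *\<^sub>R (g' x \<xi> v - g' x \<zeta> vm)) \<le> h * (b1 * (C * h) * W + b1 * W * (C * h))"
          using h(1) by simp
        have "norm (a' x (\<xi> - \<zeta>)) \<le> b2 * (C * h)"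
          using b2(2)[OF x, of "\<xi> - \<zeta>"] \<xi>\<zeta> b2(1) by (meson mult_left_mono order_trans less_imp_le)
        then show "norm (h *\<^sub>R a' x (\<xi> - \<zeta>)) \<le> h * (b2 * (C * h))" using h(1) by simp
      qed
      also have "\<dots> = (e * (W * W + W) + (b1 * C * W + b1 * W * C + b2 * C) * h) * h"
        by (simp add: algebra_simps)
      finally show ?thesis .
    qed
    have 2: "norm (\<rho>2 - h *\<^sub>R snd (force x v)) \<le> (e * (2 * W * W) + (b3 * C * W + b3 * W * C) * h) * h"
    proof -
      \<comment> \<open>\<open>P\<close> and \<open>Q\<close> are the Taylor polynomials of
        \<open>F\<close> at \<open>x\<close> towards the two neighbours. As \<open>F\<close>
        vanishes at all three points, they are minus the remainders; in their sum the two quadratic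
        halves combine, up to the replacement of \<open>\<zeta>\<close> by \<open>\<xi>\<close>, to
        \<open>h\<^sup>2\<close> times the term that defines the second component of
        \<open>force\<close>.\<close>
      define P where "P = F' x z + (1/2) *\<^sub>R F'' x z z"
      define Q where "Q = F' x y + (1/2) *\<^sub>R F'' x y y"
      have P: "norm P \<le> e * (h * W)\<^sup>2"
      proof -
        have "norm (- P) \<le> e * (norm z)\<^sup>2"
          using d3(2)[OF x, of z] ny(2) hW(3) Fy xO(2) by (simp add: P_def)
        also have "\<dots> \<le> e * (h * W)\<^sup>2" using ny(2) e(1) by (simp add: power_mono)
        finally show ?thesis by simp
      qed
      have Q: "norm Q \<le> e * (h * W)\<^sup>2"
      proof -
        have "norm (- Q) \<le> e * (norm y)\<^sup>2"
          using d3(2)[OF x, of y] ny(1) hW(3) Fy xO(2) by (simp add: Q_def)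
        also have "\<dots> \<le> e * (h * W)\<^sup>2" using ny(1) e(1) by (simp add: power_mono)
        finally show ?thesis by simp
      qed
      have D: "norm (F'' x \<xi> \<xi> - F'' x \<zeta> \<zeta>) \<le> b3 * (C * h) * W + b3 * W * (C * h)"
      proof -
        have "norm (F'' x \<xi> \<xi> - F'' x \<zeta> \<zeta>) \<le> b3 * norm (\<xi> - \<zeta>) * norm \<xi> + b3 * norm \<zeta> * norm (\<xi> - \<zeta>)"
          using b3 x by (intro blinfun_quadratic_diff) auto
        also have "\<dots> \<le> b3 * (C * h) * W + b3 * W * (C * h)"
          using b3(1) \<xi>\<zeta> n\<xi> W h \<open>0 \<le> C\<close> by (intro add_mono mult_mono) auto
        finally show ?thesis .
      qed
      have eqh: "h *\<^sub>R (\<rho>2 - h *\<^sub>R snd (force x v)) = P + Q + (h\<^sup>2 / 2) *\<^sub>R (F'' x \<xi> \<xi> - F'' x \<zeta> \<zeta>)"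
      proof -
        have "(0, v - vm) = \<xi> - \<zeta>" by (simp add: \<xi>_def \<zeta>_def)
        then have "\<rho>2 = F' x \<xi> - F' x \<zeta>" by (simp add: \<rho>2_def B_def blinfun.diff_right)
        moreover have "snd (force x v) = - F'' x \<xi> \<xi>" by (simp add: force_def \<xi>_def)
        moreover have "P = h *\<^sub>R F' x \<xi> + (h\<^sup>2 / 2) *\<^sub>R F'' x \<xi> \<xi>"
          by (simp add: P_def z_def blinfun.scaleR_right blinfun.scaleR_left power2_eq_square)
        moreover have "Q = - (h *\<^sub>R F' x \<zeta>) + (h\<^sup>2 / 2) *\<^sub>R F'' x \<zeta> \<zeta>"
          by (simp add: Q_def y_def blinfun.scaleR_right blinfun.scaleR_left blinfun.minus_left
              blinfun.minus_right power2_eq_square)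
        moreover have "h *\<^sub>R (h *\<^sub>R u) = (h\<^sup>2 / 2) *\<^sub>R u + (h\<^sup>2 / 2) *\<^sub>R u" for u :: 'a
          by (simp add: power2_eq_square scaleR_left_distrib[symmetric])
        ultimately show ?thesis by (simp add: scaleR_diff_right scaleR_add_right)
      qed
      have "h * norm (\<rho>2 - h *\<^sub>R snd (force x v)) = norm (P + Q + (h\<^sup>2 / 2) *\<^sub>R (F'' x \<xi> \<xi> - F'' x \<zeta> \<zeta>))"
        unfolding eqh[symmetric] using h(1) by simp
      also have "\<dots> \<le> e * (h * W)\<^sup>2 + e * (h * W)\<^sup>2 + h\<^sup>2 * (b3 * (C * h) * W + b3 * W * (C * h))"
      proof (intro norm_triangle_le add_mono P Q)
        have "norm ((h\<^sup>2 / 2) *\<^sub>R (F'' x \<xi> \<xi> - F'' x \<zeta> \<zeta>)) = h\<^sup>2 / 2 * norm (F'' x \<xi> \<xi> - F'' x \<zeta> \<zeta>)" by simp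
        also have "\<dots> \<le> h\<^sup>2 * norm (F'' x \<xi> \<xi> - F'' x \<zeta> \<zeta>)" by (intro mult_right_mono) auto
        also have "\<dots> \<le> h\<^sup>2 * (b3 * (C * h) * W + b3 * W * (C * h))" using D by (intro mult_left_mono) auto
        finally show "norm ((h\<^sup>2 / 2) *\<^sub>R (F'' x \<xi> \<xi> - F'' x \<zeta> \<zeta>)) \<le> h\<^sup>2 * (b3 * (C * h) * W + b3 * W * (C * h))" .
      qed
      also have "\<dots> = h * ((e * (2 * W * W) + (b3 * C * W + b3 * W * C) * h) * h)"
        by (simp add: algebra_simps power2_eq_square)
      finally show ?thesis using h(1) by simp
    qed
    have "saddle x ((v - vm, - \<mu>) - h *\<^sub>R response x v) =
        (\<rho>1 - h *\<^sub>R fst (force x v), \<rho>2 - h *\<^sub>R snd (force x v))"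
      unfolding linear_diff[OF linear_saddle] linear_scale[OF linear_saddle] sad
      using response_unique[OF xO, of "response x v" v] by (simp add: prod_eq_iff)
    then have "\<kappa> * norm ((v - vm, - \<mu>) - h *\<^sub>R response x v) \<le>
        norm (\<rho>1 - h *\<^sub>R fst (force x v)) + norm (\<rho>2 - h *\<^sub>R snd (force x v))"
      using \<kappa>(2)[OF x, of "(v - vm, - \<mu>) - h *\<^sub>R response x v"] norm_Pair_le
      by (metis (no_types, lifting) order_trans)
    also have "\<dots> \<le> (e * (W * W + W) + (b1 * C * W + b1 * W * C + b2 * C) * h) * h
        + (e * (2 * W * W) + (b3 * C * W + b3 * W * C) * h) * h"
      by (intro add_mono 1 2)
    also have "\<dots> = (c1 * e + c2 * h) * h" by (simp add: c1_def c2_def algebra_simps)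
    also have "\<dots> \<le> (\<kappa> * \<epsilon>) * h" using e(2) hc h(1) by (intro mult_right_mono) auto
    finally have "\<kappa> * norm ((v - vm, - \<mu>) - h *\<^sub>R response x v) \<le> \<kappa> * (\<epsilon> * h)"
      by (simp only: mult.assoc)
    then have "norm ((v - vm, - \<mu>) - h *\<^sub>R response x v) \<le> \<epsilon> * h" using \<kappa>(1) by simp
    moreover have "norm (v - vm - h *\<^sub>R accel x v) \<le> norm ((v - vm, - \<mu>) - h *\<^sub>R response x v)"
      using norm_fst_le[of "v - vm - h *\<^sub>R accel x v" "snd ((v - vm, - \<mu>) - h *\<^sub>R response x v)"]
      by (simp add: accel_def prod_eq_iff fst_diff)
         (metis (no_types, lifting) fst_conv fst_diff fst_scaleR norm_fst_le prod.collapse)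
    ultimately show "norm (v - vm - h *\<^sub>R accel x v) \<le> \<epsilon> * h" by linarith
  qed
  qed
qed

end

section \<open>Discrete curves\<close>

locale boundary_problem = mechanical_system F F' F'' E \<sigma> g g' a a' V V' K
  for F :: "real \<times> 'a::euclidean_space \<Rightarrow> 'a" and F' F'' E \<sigma> g g' a a' V V' K +
  fixes T :: real and e :: 'a and C M A C1 P :: real and z0 :: "real \<Rightarrow> 'a" and \<Lambda> :: real
  assumes T_pos: "0 < T"
    and constants: "0 \<le> C" "0 \<le> M" "0 \<le> A" "0 < P"
    and a_bound: "\<And>x. snd x \<notin> \<sigma> \<Longrightarrow> norm (a x) \<le> C + M * norm (snd x)"
    and V_bound: "\<And>x. snd x \<notin> \<sigma> \<Longrightarrow> V x \<le> A * (norm (snd x))\<^sup>2 + C1"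
    and V_sing: "\<And>x s. snd x \<notin> \<sigma> \<Longrightarrow> s \<in> \<sigma> \<Longrightarrow>
      V x \<le> A * (norm (snd x))\<^sup>2 + C1 - P / (norm (snd x - s))\<^sup>2"
    and coercive: "0 < K - M * T - A * T\<^sup>2"
    and z0_ends: "z0 0 = 0" "z0 T = e"
    and z0_in: "\<And>t. t \<in> {0..T} \<Longrightarrow> z0 t \<notin> \<sigma>" "\<And>t. t \<in> {0..T} \<Longrightarrow> F (t, z0 t) = 0"
    and z0_lipschitz: "\<And>s t. s \<in> {0..T} \<Longrightarrow> t \<in> {0..T} \<Longrightarrow> norm (z0 s - z0 t) \<le> \<Lambda> * \<bar>s - t\<bar>"
begin

definition h :: "nat \<Rightarrow> real" where
  "h N = T / real N"

definition vel :: "nat \<Rightarrow> (nat \<Rightarrow> 'a) \<Rightarrow> nat \<Rightarrow> 'a" where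
  "vel N z k = (z (Suc k) - z k) /\<^sub>R h N"

definition action :: "nat \<Rightarrow> (nat \<Rightarrow> 'a) \<Rightarrow> real" where
  "action N z = (\<Sum>k<N. h N * L (real k * h N, z k) (vel N z k))"

definition energy :: "nat \<Rightarrow> (nat \<Rightarrow> 'a) \<Rightarrow> real" where
  "energy N z = (\<Sum>k<N. h N * (norm (vel N z k))\<^sup>2)"

text \<open>Values beyond \<open>N\<close> are fixed to \<open>e\<close> so that a family of such
  sequences is bounded at every index, as the diagonal argument in \<open>minimizer_exists\<close>
  requires.\<close>

definition admissible :: "nat \<Rightarrow> (nat \<Rightarrow> 'a) \<Rightarrow> bool" where
  "admissible N z \<longleftrightarrow> z 0 = 0 \<and> (\<forall>k\<ge>N. z k = e) \<and> (\<forall>k\<le>N. z k \<notin> \<sigma> \<and> F (real k * h N, z k) = 0)"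

lemma h_pos: "0 < N \<Longrightarrow> 0 < h N"
  using T_pos by (simp add: h_def)

lemma h_N: "0 < N \<Longrightarrow> real N * h N = T"
  by (simp add: h_def)

lemma grid_in: "0 < N \<Longrightarrow> k \<le> N \<Longrightarrow> real k * h N \<in> {0..T}"
  using h_N[of N] h_pos[of N] mult_right_mono[of "real k" "real N" "h N"] by simp

lemma step_vel: "0 < N \<Longrightarrow> z (Suc k) = z k + h N *\<^sub>R vel N z k"
  using h_pos[of N] by (simp add: vel_def)

lemma norm_step: "0 < N \<Longrightarrow> norm (z (Suc k) - z k) = h N * norm (vel N z k)"
  using h_pos[of N] by (simp add: vel_def)

lemma energy_nonneg: "0 < N \<Longrightarrow> 0 \<le> energy N z"
  using h_pos[of N] by (auto simp: energy_def intro!: sum_nonneg)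

lemma displacement_bound:
  assumes N: "0 < N" "k \<le> N" and z: "z 0 = 0"
  shows "(norm (z k))\<^sup>2 \<le> T * energy N z"
proof -
  have "norm (z k) = norm (\<Sum>i<k. z (Suc i) - z i)" using z by (simp add: sum_lessThan_telescope)
  also have "\<dots> \<le> (\<Sum>i<k. 1 * (h N * norm (vel N z i)))"
    by (rule sum_norm_le) (simp add: norm_step[OF N(1)])
  finally have "(norm (z k))\<^sup>2 \<le> (\<Sum>i<k. 1 * (h N * norm (vel N z i)))\<^sup>2"
    by (rule power_mono) simp
  also have "\<dots> \<le> (\<Sum>i<k. 1\<^sup>2) * (\<Sum>i<k. (h N * norm (vel N z i))\<^sup>2)"
    by (rule Cauchy_Schwarz_ineq_sum)
  also have "\<dots> = (real k * h N) * (\<Sum>i<k. h N * (norm (vel N z i))\<^sup>2)"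
    by (simp add: power_mult_distrib power2_eq_square sum_distrib_left ac_simps)
  also have "\<dots> \<le> T * energy N z"
  proof (rule mult_mono)
    show "real k * h N \<le> T" using grid_in[OF N] by simp
    show "(\<Sum>i<k. h N * (norm (vel N z i))\<^sup>2) \<le> energy N z"
      unfolding energy_def using N h_pos[OF N(1)] by (intro sum_mono2) auto
    show "0 \<le> (\<Sum>i<k. h N * (norm (vel N z i))\<^sup>2)"
      using h_pos[OF N(1)] by (intro sum_nonneg) auto
  qed (use T_pos in auto)
  finally show ?thesis .
qed

section \<open>Coercivity, strong force and a priori bounds\<close>

definition \<gamma> :: real where "\<gamma> = K - M * T - A * T\<^sup>2"

definition offset :: real where "offset = C\<^sup>2 / (2 * \<gamma>) * T + C1 * T"

lemma \<gamma>_pos: "0 < \<gamma>"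
  using coercive by (simp add: \<gamma>_def)

text \<open>Young's inequality twice: the term with \<open>C\<close> is absorbed by
  \<open>\<gamma> / 2\<close>, and the one with \<open>M\<close> is split with weight
  \<open>T\<close>, so that both halves contribute \<open>M * T / 2\<close> once
  \<open>displacement_bound\<close> is inserted. Exactly \<open>\<gamma> / 2\<close> is left. The
  family \<open>q\<close> keeps track of the singular part of the potential.\<close>

lemma action_lower_bound:
  assumes N: "0 < N" and z: "admissible N z"
    and q: "\<And>k. k < N \<Longrightarrow> V (real k * h N, z k) \<le> A * (norm (z k))\<^sup>2 + C1 - q k"
  shows "\<gamma> / 2 * energy N z + (\<Sum>k<N. h N * q k) \<le> action N z + offset"
proof -
  let ?h = "h N" and ?v = "\<lambda>k. norm (vel N z k)" and ?z = "\<lambda>k. norm (z k)"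
  have pt: "(K - \<gamma> / 2 - M * T / 2) * (?v k)\<^sup>2 + q k \<le> L (real k * ?h, z k) (vel N z k)
      + C\<^sup>2 / (2 * \<gamma>) + C1 + (M / (2 * T) + A) * (?z k)\<^sup>2" if k: "k < N" for k
  proof -
    have s: "snd (real k * ?h, z k) \<notin> \<sigma>" using z k by (simp add: admissible_def)
    have 1: "K * (?v k)\<^sup>2 \<le> 1/2 * (g (real k * ?h, z k) (vel N z k) \<bullet> vel N z k)" by (rule g_lower[OF s])
    have "\<bar>a (real k * ?h, z k) \<bullet> vel N z k\<bar> \<le> norm (a (real k * ?h, z k)) * ?v k" by (rule Cauchy_Schwarz_ineq2)
    also have "\<dots> \<le> (C + M * ?z k) * ?v k" using a_bound[OF s] by (intro mult_right_mono) auto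
    finally have 2: "- (a (real k * ?h, z k) \<bullet> vel N z k) \<le> C * ?v k + M * (?z k * ?v k)"
      by (simp add: algebra_simps)
    have 3: "C * ?v k \<le> C\<^sup>2 / (2 * \<gamma>) + \<gamma> / 2 * (?v k)\<^sup>2"
    proof -
      have "0 \<le> (C - \<gamma> * ?v k)\<^sup>2" by simp
      then have "2 * \<gamma> * (C * ?v k) \<le> C\<^sup>2 + \<gamma>\<^sup>2 * (?v k)\<^sup>2"
        by (simp add: power2_diff power_mult_distrib algebra_simps)
      then show ?thesis using \<gamma>_pos by (simp add: field_simps power2_eq_square)
    qed
    have "0 \<le> (?z k - T * ?v k)\<^sup>2" by simp
    then have "2 * T * (?z k * ?v k) \<le> (?z k)\<^sup>2 + T\<^sup>2 * (?v k)\<^sup>2"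
      by (simp add: power2_diff power_mult_distrib algebra_simps)
    then have "?z k * ?v k \<le> (?z k)\<^sup>2 / (2 * T) + T / 2 * (?v k)\<^sup>2"
      using T_pos by (simp add: field_simps power2_eq_square)
    then have 4: "M * (?z k * ?v k) \<le> M * ((?z k)\<^sup>2 / (2 * T) + T / 2 * (?v k)\<^sup>2)"
      using constants(2) by (rule mult_left_mono)
    have "L (real k * ?h, z k) (vel N z k) \<ge> K * (?v k)\<^sup>2 - (C\<^sup>2 / (2 * \<gamma>) + \<gamma> / 2 * (?v k)\<^sup>2)
        - M * ((?z k)\<^sup>2 / (2 * T) + T / 2 * (?v k)\<^sup>2) - (A * (?z k)\<^sup>2 + C1 - q k)"
      using 1 2 3 4 q[OF k] unfolding L_def by linarith
    then show ?thesis by (simp add: algebra_simps)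
  qed
  have zk: "(?z k)\<^sup>2 \<le> T * energy N z" if "k < N" for k
    using displacement_bound[of N k z] that z by (simp add: admissible_def)
  have "(\<Sum>k<N. ?h * ((K - \<gamma> / 2 - M * T / 2) * (?v k)\<^sup>2 + q k)) \<le>
      (\<Sum>k<N. ?h * (L (real k * ?h, z k) (vel N z k) + C\<^sup>2 / (2 * \<gamma>) + C1 + (M / (2 * T) + A) * (T * energy N z)))"
  proof (intro sum_mono mult_left_mono)
    fix k assume k: "k \<in> {..<N}"
    have "(M / (2 * T) + A) * (?z k)\<^sup>2 \<le> (M / (2 * T) + A) * (T * energy N z)"
      using zk[of k] k constants T_pos by (intro mult_left_mono) auto
    then show "(K - \<gamma> / 2 - M * T / 2) * (?v k)\<^sup>2 + q k \<le>
        L (real k * ?h, z k) (vel N z k) + C\<^sup>2 / (2 * \<gamma>) + C1 + (M / (2 * T) + A) * (T * energy N z)"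
      using pt[of k] k by simp
  qed (use h_pos[OF N] in simp)
  moreover have "(\<Sum>k<N. ?h * ((K - \<gamma> / 2 - M * T / 2) * (?v k)\<^sup>2 + q k)) =
      (K - \<gamma> / 2 - M * T / 2) * energy N z + (\<Sum>k<N. ?h * q k)"
    by (simp add: energy_def distrib_left sum.distrib sum_distrib_left sum_distrib_right ac_simps)
  moreover have "(\<Sum>k<N. ?h * (L (real k * ?h, z k) (vel N z k) + C\<^sup>2 / (2 * \<gamma>) + C1 + (M / (2 * T) + A) * (T * energy N z)))
      = action N z + T * (C\<^sup>2 / (2 * \<gamma>) + C1 + (M / (2 * T) + A) * (T * energy N z))"
  proof -
    have "(\<Sum>k<N. ?h * (f k + c1 + c2 + c3)) = (\<Sum>k<N. ?h * f k) + real N * ?h * (c1 + c2 + c3)"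
      for f :: "nat \<Rightarrow> real" and c1 c2 c3
      by (simp add: distrib_left sum.distrib algebra_simps)
    then show ?thesis by (simp add: action_def h_N[OF N])
  qed
  moreover have "T * (C\<^sup>2 / (2 * \<gamma>) + C1 + (M / (2 * T) + A) * (T * energy N z))
      = offset + (M * T / 2 + A * T\<^sup>2) * energy N z"
    using T_pos by (simp add: offset_def power2_eq_square algebra_simps)
  moreover have "(K - \<gamma> / 2 - M * T / 2) * energy N z - (M * T / 2 + A * T\<^sup>2) * energy N z = \<gamma> / 2 * energy N z"
  proof -
    have "(K - \<gamma> / 2 - M * T / 2) - (M * T / 2 + A * T\<^sup>2) = \<gamma> / 2" by (simp add: \<gamma>_def field_simps)
    then show ?thesis by (simp only: left_diff_distrib[symmetric])
  qed
  ultimately show ?thesis by linarith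
qed

text \<open>The strong force estimate. With \<open>r\<close> the distance from \<open>s\<close>, one
  step lowers \<open>ln r\<close> by at most \<open>h * v / r\<close>, hence by half of
  \<open>h * v\<^sup>2 + h / r\<^sup>2\<close>. The energy and \<open>D\<close> bound the two sums,
  so the distance keeps a fixed fraction of its initial value.\<close>

lemma distance_lower_bound:
  assumes N: "0 < N" and j: "j < N"
    and r: "\<And>k. k \<le> N \<Longrightarrow> z k \<noteq> s"
    and S: "(\<Sum>k<N. h N * (1 / (norm (z k - s))\<^sup>2)) \<le> D"
  shows "norm (z 0 - s) * exp (- (energy N z + D) / 2) \<le> norm (z j - s)"
proof -
  let ?r = "\<lambda>k. norm (z k - s)" and ?h = "h N" and ?v = "\<lambda>k. norm (vel N z k)"
  have rpos: "0 < ?r k" if "k \<le> N" for k using r[OF that] by simp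
  have one: "ln (?r k) - ln (?r (Suc k)) \<le> (?h * (?v k)\<^sup>2 + ?h * (1 / (?r (Suc k))\<^sup>2)) / 2" if k: "Suc k \<le> N" for k
  proof -
    have "ln (?r k) - ln (?r (Suc k)) = ln (?r k / ?r (Suc k))"
      using rpos[of k] rpos[OF k] k by (simp add: ln_div)
    also have "\<dots> \<le> ?r k / ?r (Suc k) - 1"
      using rpos[of k] rpos[OF k] k by (intro ln_le_minus_one) auto
    also have "\<dots> = (?r k - ?r (Suc k)) / ?r (Suc k)" using rpos[OF k] by (simp add: field_simps)
    also have "\<dots> \<le> (?h * ?v k) / ?r (Suc k)"
    proof (rule divide_right_mono)
      have "?r k \<le> ?r (Suc k) + norm (z (Suc k) - z k)"
        using norm_triangle_ineq4[of "z (Suc k) - s" "z (Suc k) - z k"] by simp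
      then show "?r k - ?r (Suc k) \<le> ?h * ?v k" using norm_step[OF N, of z k] by simp
    qed simp
    also have "\<dots> = ?h * (?v k * (1 / ?r (Suc k)))" by simp
    also have "\<dots> \<le> ?h * (((?v k)\<^sup>2 + (1 / ?r (Suc k))\<^sup>2) / 2)"
      using sum_squares_bound[of "?v k" "1 / ?r (Suc k)"] h_pos[OF N]
      by (intro mult_left_mono) (auto simp: mult.commute)
    finally show ?thesis by (simp add: power_one_over algebra_simps)
  qed
  have "ln (?r 0) - ln (?r j) = (\<Sum>k<j. ln (?r k) - ln (?r (Suc k)))"
    by (rule sum_lessThan_telescope'[of "\<lambda>k. ln (?r k)", symmetric])
  also have "\<dots> \<le> (\<Sum>k<j. (?h * (?v k)\<^sup>2 + ?h * (1 / (?r (Suc k))\<^sup>2)) / 2)"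
    by (rule sum_mono) (use one j in auto)
  also have "\<dots> = ((\<Sum>k<j. ?h * (?v k)\<^sup>2) + (\<Sum>k<j. ?h * (1 / (?r (Suc k))\<^sup>2))) / 2"
    by (simp only: sum_divide_distrib sum.distrib add_divide_distrib)
  also have "\<dots> \<le> (energy N z + D) / 2"
  proof -
    have "(\<Sum>k<j. ?h * (?v k)\<^sup>2) \<le> energy N z"
      unfolding energy_def by (rule sum_mono2) (use j h_pos[OF N] in auto)
    moreover have "(\<Sum>k<j. ?h * (1 / (?r (Suc k))\<^sup>2)) \<le> D"
    proof -
      \<comment> \<open>The reciprocal sits at the later grid point, so the indices shift by one;
        they stay below \<open>N\<close> because \<open>j < N\<close>.\<close>
      have "(\<Sum>k<j. ?h * (1 / (?r (Suc k))\<^sup>2)) = (\<Sum>k\<in>Suc ` {..<j}. ?h * (1 / (?r k)\<^sup>2))"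
        by (subst sum.reindex) auto
      also have "\<dots> \<le> (\<Sum>k<N. ?h * (1 / (?r k)\<^sup>2))"
        by (rule sum_mono2) (use j h_pos[OF N] in auto)
      also note S
      finally show ?thesis .
    qed
    ultimately show ?thesis by (intro divide_right_mono add_mono) auto
  qed
  finally have "ln (?r 0) - (energy N z + D) / 2 \<le> ln (?r j)" by linarith
  then have "ln (?r 0) + - (energy N z + D) / 2 \<le> ln (?r j)" by linarith
  then have "exp (ln (?r 0) + - (energy N z + D) / 2) \<le> exp (ln (?r j))" by (simp only: exp_le_cancel_iff)
  moreover have "0 < ?r 0" "0 < ?r j" using rpos j by simp_all
  ultimately show ?thesis by (simp only: exp_add exp_ln)
qed

lemma a_priori_bounds:
  obtains Y R \<delta> where "0 < Y" "0 < \<delta>"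
    "\<forall>N z. 0 < N \<longrightarrow> admissible N z \<longrightarrow> action N z \<le> S \<longrightarrow>
      energy N z \<le> Y \<and> (\<forall>k\<le>N. norm (z k) \<le> R \<and> (\<forall>s\<in>\<sigma>. \<delta> \<le> norm (z k - s)))"
proof -
  define Y where "Y = max 1 (2 / \<gamma> * (S + offset))"
  \<comment> \<open>What the singular term leaves for the sum of
    \<open>h / (norm (z k - s))\<^sup>2\<close> once the nonnegative energy is dropped.\<close>
  define D where "D = (S + offset) / P"
  have e1: "energy N z \<le> Y" if "0 < N" "admissible N z" "action N z \<le> S" for N z
  proof -
    have "\<gamma> / 2 * energy N z \<le> S + offset"
    proof -
      have "V (real k * h N, z k) \<le> A * (norm (z k))\<^sup>2 + C1 - 0" if "k < N" for k
        using V_bound[of "(real k * h N, z k)"] that \<open>admissible N z\<close> by (simp add: admissible_def)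
      from action_lower_bound[OF that(1,2) this] show ?thesis using that(3) by simp
    qed
    then have "energy N z \<le> 2 / \<gamma> * (S + offset)" using \<gamma>_pos by (simp add: field_simps)
    then show ?thesis by (simp add: Y_def)
  qed
  have zs: "0 \<notin> \<sigma>" "e \<notin> \<sigma>" using z0_in(1)[of 0] z0_in(1)[of T] z0_ends T_pos by auto
  then obtain d0 d1 where d: "0 < d0" "\<And>s. s \<in> \<sigma> \<Longrightarrow> d0 \<le> dist 0 s" "0 < d1" "\<And>s. s \<in> \<sigma> \<Longrightarrow> d1 \<le> dist e s"
    using separate_point_closed[OF \<sigma>_closed] by metis
  \<comment> \<open>\<open>distance_lower_bound\<close> reaches only indices below \<open>N\<close>;
    it starts from the distance \<open>d0\<close> of the origin, and the last point \<open>e\<close>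
    is covered by its own distance \<open>d1\<close>.\<close>
  define \<delta> where "\<delta> = min d1 (d0 * exp (- (Y + D) / 2))"
  show ?thesis
  proof (rule that[of Y \<delta> "sqrt (T * Y)"]; (intro allI impI conjI ballI)?)
    show "0 < Y" by (simp add: Y_def)
    show "0 < \<delta>" using d by (simp add: \<delta>_def)
    fix N z assume Nz: "0 < N" "admissible N z" "action N z \<le> S"
    show "energy N z \<le> Y" by (rule e1[OF Nz])
    fix k assume k: "k \<le> N"
    have "(norm (z k))\<^sup>2 \<le> T * energy N z"
      using displacement_bound[OF Nz(1) k] Nz(2) by (simp add: admissible_def)
    also have "\<dots> \<le> T * Y" using e1[OF Nz] T_pos by simp
    finally show "norm (z k) \<le> sqrt (T * Y)" by (rule real_le_rsqrt)
    fix s assume s: "s \<in> \<sigma>"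
    show "\<delta> \<le> norm (z k - s)"
    proof (cases "k = N")
      case True
      then show ?thesis using d(4)[OF s] Nz(2) by (simp add: admissible_def \<delta>_def dist_norm min.coboundedI1)
    next
      case False
      have "\<gamma> / 2 * energy N z + (\<Sum>k<N. h N * (P / (norm (z k - s))\<^sup>2)) \<le> S + offset"
      proof -
        have "V (real k * h N, z k) \<le> A * (norm (z k))\<^sup>2 + C1 - P / (norm (z k - s))\<^sup>2" if "k < N" for k
          using V_sing[of "(real k * h N, z k)", OF _ s] that Nz(2) by (simp add: admissible_def)
        from action_lower_bound[OF Nz(1,2) this] show ?thesis using Nz(3) by simp
      qed
      moreover have "0 \<le> \<gamma> / 2 * energy N z" using \<gamma>_pos energy_nonneg[OF Nz(1), of z] by simp
      moreover have "(\<Sum>k<N. h N * (P / (norm (z k - s))\<^sup>2)) = P * (\<Sum>k<N. h N * (1 / (norm (z k - s))\<^sup>2))"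
        by (simp add: sum_distrib_left ac_simps)
      ultimately have "P * (\<Sum>k<N. h N * (1 / (norm (z k - s))\<^sup>2)) \<le> S + offset" by linarith
      then have "(\<Sum>k<N. h N * (1 / (norm (z k - s))\<^sup>2)) \<le> D"
        using constants(4) by (simp add: D_def field_simps)
      moreover have "\<And>k. k \<le> N \<Longrightarrow> z k \<noteq> s" using Nz(2) s by (auto simp: admissible_def)
      ultimately have low: "norm (z 0 - s) * exp (- (energy N z + D) / 2) \<le> norm (z k - s)"
        using False k Nz(1) by (intro distance_lower_bound) auto
      have "d0 * exp (- (Y + D) / 2) \<le> norm (z 0 - s) * exp (- (energy N z + D) / 2)"
        using d(1) d(2)[OF s] Nz(2) e1[OF Nz]
        by (intro mult_mono) (auto simp: admissible_def dist_norm)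
      then show ?thesis using low by (simp add: \<delta>_def min.coboundedI2)
    qed
  qed
qed

definition sample :: "nat \<Rightarrow> nat \<Rightarrow> 'a" where
  "sample N k = (if k \<le> N then z0 (real k * h N) else e)"

lemma sample_admissible: "0 < N \<Longrightarrow> admissible N (sample N)"
  using z0_ends z0_in grid_in[of N] h_N[of N] by (auto simp: admissible_def sample_def)

lemma \<Lambda>_nonneg: "0 \<le> \<Lambda>"
  using z0_lipschitz[of 0 T] T_pos norm_ge_zero[of "z0 0 - z0 T"]
  by (smt (verit) atLeastAtMost_iff zero_le_mult_iff)

lemma sample_step: "0 < N \<Longrightarrow> k < N \<Longrightarrow> norm (sample N (Suc k) - sample N k) \<le> \<Lambda> * h N"
  using z0_lipschitz[OF grid_in[of N "Suc k"] grid_in[of N k]] h_pos[of N]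
  by (simp add: sample_def algebra_simps)

lemma z0_cont: "continuous_on {0..T} z0"
proof (rule continuous_onI)
  fix t \<epsilon> :: real assume t: "t \<in> {0..T}" "0 < \<epsilon>"
  show "\<exists>d>0. \<forall>s\<in>{0..T}. dist s t < d \<longrightarrow> dist (z0 s) (z0 t) \<le> \<epsilon>"
  proof (intro exI[of _ "\<epsilon> / (\<Lambda> + 1)"] conjI ballI impI)
    show "0 < \<epsilon> / (\<Lambda> + 1)" using t \<Lambda>_nonneg by simp
    fix s assume s: "s \<in> {0..T}" "dist s t < \<epsilon> / (\<Lambda> + 1)"
    have "norm (z0 s - z0 t) \<le> \<Lambda> * \<bar>s - t\<bar>" by (rule z0_lipschitz) fact+
    also have "\<dots> \<le> (\<Lambda> + 1) * \<bar>s - t\<bar>" by (intro mult_right_mono) auto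
    also have "\<dots> \<le> \<epsilon>" using s(2) \<Lambda>_nonneg by (simp add: dist_real_def field_simps)
    finally show "dist (z0 s) (z0 t) \<le> \<epsilon>" by (simp add: dist_norm)
  qed
qed

lemma L_cont:
  "continuous_on S f \<Longrightarrow> continuous_on S v \<Longrightarrow> f ` S \<subseteq> \<Omega> \<Longrightarrow> continuous_on S (\<lambda>y. L (f y) (v y))"
  unfolding L_def
  by (intro continuous_intros continuous_on_compose2[OF g_cont] continuous_on_compose2[OF a_cont]
      continuous_on_compose2[OF V_cont]) auto

text \<open>The samples have velocities of norm at most \<open>\<Lambda>\<close>, so the Lagrangian
  is evaluated on one compact set and the level \<open>S\<close> does not depend on
  \<open>N\<close>.\<close>

lemma sample_action_bounded:
  obtains S where "\<And>N. 0 < N \<Longrightarrow> action N (sample N) \<le> S"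
proof -
  have z: "continuous_on ({0..T} \<times> cball (0::'a) \<Lambda>) (\<lambda>p. z0 (fst p))"
    by (rule continuous_on_compose2[OF z0_cont continuous_on_fst[OF continuous_on_id]]) auto
  have "continuous_on ({0..T} \<times> cball (0::'a) \<Lambda>) (\<lambda>p. L (fst p, z0 (fst p)) (snd p))"
    by (rule L_cont[OF continuous_on_Pair[OF continuous_on_fst[OF continuous_on_id] z]
        continuous_on_snd[OF continuous_on_id]]) (use z0_in(1) in auto)
  then have "compact ((\<lambda>p. L (fst p, z0 (fst p)) (snd p)) ` ({0..T} \<times> cball 0 \<Lambda>))"
    by (rule compact_continuous_image) (intro compact_Times compact_Icc compact_cball)
  then have "bounded ((\<lambda>p. L (fst p, z0 (fst p)) (snd p)) ` ({0..T} \<times> cball 0 \<Lambda>))"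
    by (rule compact_imp_bounded)
  then obtain b where b0: "\<forall>y\<in>(\<lambda>p. L (fst p, z0 (fst p)) (snd p)) ` ({0..T} \<times> cball 0 \<Lambda>). norm y \<le> b"
    unfolding bounded_iff by blast
  have b: "\<bar>L (t, z0 t) v\<bar> \<le> b" if "t \<in> {0..T}" "norm v \<le> \<Lambda>" for t v
  proof -
    have "L (t, z0 t) v \<in> (\<lambda>p. L (fst p, z0 (fst p)) (snd p)) ` ({0..T} \<times> cball 0 \<Lambda>)"
      by (rule image_eqI[of _ _ "(t, v)"]) (use that in auto)
    from bspec[OF b0 this] show ?thesis by simp
  qed
  have "action N (sample N) \<le> T * b" if N: "0 < N" for N
  proof -
    have "action N (sample N) \<le> (\<Sum>k<N. h N * b)"
      unfolding action_def
    proof (intro sum_mono mult_left_mono)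
      fix k assume k: "k \<in> {..<N}"
      have "h N * norm (vel N (sample N) k) \<le> h N * \<Lambda>"
        using sample_step[OF N, of k] norm_step[OF N, of "sample N" k] k by (simp add: mult.commute)
      then have nv: "norm (vel N (sample N) k) \<le> \<Lambda>" using h_pos[OF N] by simp
      have gi: "real k * h N \<in> {0..T}" by (rule grid_in[OF N]) (use k in simp)
      have "sample N k = z0 (real k * h N)" using k by (simp add: sample_def)
      then show "L (real k * h N, sample N k) (vel N (sample N) k) \<le> b"
        using b[OF gi nv] by (simp only: abs_le_iff)
    qed (use h_pos[OF N] in simp)
    also have "\<dots> = T * b" by (simp add: mult.assoc[symmetric] h_N[OF N])
    finally show ?thesis .
  qed
  then show ?thesis by (rule that)
qed

end

section \<open>Compact core, tubular retraction and homotopies of paths\<close>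

context boundary_problem
begin

text \<open>For the \<open>R\<close> and \<open>\<delta>\<close> of the a priori bounds, this
  compact set holds the grid points of all competitors of bounded action.\<close>

definition core :: "real \<Rightarrow> real \<Rightarrow> (real \<times> 'a) set" where
  "core R \<delta> = ({0..T} \<times> cball 0 R) \<inter> ((\<Inter>s\<in>\<sigma>. {x. \<delta> \<le> norm (snd x - s)}) \<inter> {x. F x = 0})"

definition core_nbhd :: "real \<Rightarrow> real \<Rightarrow> real \<Rightarrow> (real \<times> 'a) set" where
  "core_nbhd R \<delta> r = {x. fst x \<in> {0..T} \<and> (\<exists>x'\<in>core R \<delta>. dist x x' \<le> r)}"

lemma core_iff:
  "(t, y) \<in> core R \<delta> \<longleftrightarrow> t \<in> {0..T} \<and> norm y \<le> R \<and> (\<forall>s\<in>\<sigma>. \<delta> \<le> norm (y - s)) \<and> F (t, y) = 0"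
  by (auto simp: core_def)

lemma compact_core: "compact (core R \<delta>)"
  unfolding core_def
proof (rule compact_Int_closed)
  show "compact ({0..T} \<times> cball (0::'a) R)" by (intro compact_Times compact_Icc compact_cball)
  show "closed ((\<Inter>s\<in>\<sigma>. {x. \<delta> \<le> norm (snd x - s)}) \<inter> {x. F x = 0})"
    by (intro closed_Int closed_INT ballI closed_Collect_le closed_Collect_eq F_cont continuous_on_const
        continuous_on_norm continuous_on_diff continuous_on_snd continuous_on_id)
qed

lemma core_subset: "0 < \<delta> \<Longrightarrow> core R \<delta> \<subseteq> \<Omega>"
  by (force simp: core_def)

lemma core_F: "x \<in> core R \<delta> \<Longrightarrow> F x = 0"
  by (simp add: core_def)

lemma tubular_retraction:
  assumes "0 < \<delta>"
  obtains \<epsilon> \<rho> where "0 < \<epsilon>" "continuous_on (core_nbhd R \<delta> \<epsilon>) \<rho>"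
    "\<forall>x\<in>core_nbhd R \<delta> \<epsilon>. F (fst x, \<rho> x) = 0 \<and> \<rho> x \<notin> \<sigma> \<and> (F x = 0 \<longrightarrow> \<rho> x = snd x)"
proof -
  let ?K = "{0..T} \<times> cball (0::'a) (R + 1)"
  have "compact ?K" by (intro compact_Times compact_Icc compact_cball)
  then obtain \<rho> \<epsilon>0 c where \<rho>: "0 < \<epsilon>0" "0 \<le> c" "continuous_on {x \<in> ?K. norm (F x) \<le> \<epsilon>0} \<rho>"
    "\<And>x. x \<in> ?K \<Longrightarrow> norm (F x) \<le> \<epsilon>0 \<Longrightarrow> F (fst x, \<rho> x) = 0"
    "\<And>x. x \<in> ?K \<Longrightarrow> norm (F x) \<le> \<epsilon>0 \<Longrightarrow> norm (\<rho> x - snd x) \<le> c * norm (F x)"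
    by (rule retraction) blast
  obtain d l where l: "0 < d" "0 \<le> l"
    "\<And>x y. x \<in> core R \<delta> \<Longrightarrow> norm y < d \<Longrightarrow> norm (F (x + y) - F x) \<le> l * norm y"
    using compact_uniform_lipschitz[OF open_UNIV F_deriv F'_cont compact_core subset_UNIV] by blast
  \<comment> \<open>In turn: stay in the ball of radius \<open>R + 1\<close>; stay within reach of
    the Lipschitz estimate for \<open>F\<close>; keep \<open>norm (F x)\<close> at most
    \<open>\<epsilon>0\<close>; and make the tube radius plus the displacement by
    \<open>\<rho>\<close>, together at most \<open>\<epsilon> + c * l * \<epsilon>\<close>, smaller
    than \<open>\<delta>\<close>, so that \<open>\<rho>\<close> cannot reach \<sigma>.\<close>
  define \<epsilon> where "\<epsilon> = Min {1, d / 2, \<epsilon>0 / (l + 1), \<delta> / (2 * (1 + c * l))}"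
  have cl: "0 \<le> c * l" using \<rho> l by simp
  have "0 < 1 + c * l" "0 < l + 1" using cl l by simp_all
  then have \<epsilon>: "0 < \<epsilon>" using l(1) \<rho>(1) assms by (simp add: \<epsilon>_def)
  have \<epsilon>1: "\<epsilon> \<le> 1" "\<epsilon> < d" using l by (auto simp: \<epsilon>_def min_less_iff_disj)
  have "\<epsilon> \<le> \<epsilon>0 / (l + 1)" by (simp add: \<epsilon>_def)
  then have "\<epsilon> * (l + 1) \<le> \<epsilon>0" using l(2) by (simp add: pos_le_divide_eq)
  then have \<epsilon>2: "l * \<epsilon> \<le> \<epsilon>0" using \<epsilon> by (simp add: algebra_simps)
  have "\<epsilon> \<le> \<delta> / (2 * (1 + c * l))" by (simp add: \<epsilon>_def)
  then have "\<epsilon> * (2 * (1 + c * l)) \<le> \<delta>" using cl by (simp add: pos_le_divide_eq)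
  then have \<epsilon>3: "\<epsilon> + c * (l * \<epsilon>) < \<delta>" using assms by (simp add: algebra_simps)
  have near: "x \<in> ?K \<and> norm (F x) \<le> l * \<epsilon> \<and> (\<forall>s\<in>\<sigma>. \<delta> \<le> norm (snd x - s) + \<epsilon>)"
    if x: "x \<in> core_nbhd R \<delta> \<epsilon>" for x
  proof -
    obtain x' where x': "x' \<in> core R \<delta>" "norm (x - x') \<le> \<epsilon>" and t: "fst x \<in> {0..T}"
      using x by (auto simp: core_nbhd_def dist_norm)
    obtain t' y' where xy: "x' = (t', y')" by fastforce
    have c': "norm y' \<le> R" "\<forall>s\<in>\<sigma>. \<delta> \<le> norm (y' - s)" "F x' = 0"
      using x'(1) unfolding xy core_iff by blast+
    have "norm (F (x' + (x - x')) - F x') \<le> l * norm (x - x')"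
      by (rule l(3)[OF x'(1)]) (use x'(2) \<epsilon>1 in linarith)
    also have "\<dots> \<le> l * \<epsilon>" using x'(2) l(2) by (rule mult_left_mono)
    finally have 1: "norm (F x) \<le> l * \<epsilon>" using c' by simp
    have 2: "norm (snd x - y') \<le> \<epsilon>"
    proof -
      have "norm (snd (x - x')) \<le> norm (x - x')"
        using norm_snd_le[of "snd (x - x')" "fst (x - x')"] unfolding prod.collapse .
      then show ?thesis using x'(2) by (simp add: xy)
    qed
    then have "norm (snd x) \<le> R + 1" using c' \<epsilon>1 norm_triangle_sub[of "snd x" y'] by linarith
    then have 3: "x \<in> ?K" using t by (simp add: mem_Times_iff)
    have "\<delta> \<le> norm (snd x - s) + \<epsilon>" if "s \<in> \<sigma>" for s
    proof -
      have "\<delta> \<le> norm (y' - s)" using c' that by blast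
      also have "\<dots> \<le> norm (snd x - s) + norm (snd x - y')"
        using norm_triangle_ineq4[of "snd x - s" "snd x - y'"] by simp
      finally show ?thesis using 2 by linarith
    qed
    then show ?thesis using 1 3 by blast
  qed
  show ?thesis
  proof (rule that[OF \<epsilon>]; (intro ballI conjI impI)?)
    show "continuous_on (core_nbhd R \<delta> \<epsilon>) \<rho>"
      by (rule continuous_on_subset[OF \<rho>(3)]) (use near \<epsilon>2 order_trans in blast)
    fix x assume x: "x \<in> core_nbhd R \<delta> \<epsilon>"
    have K: "x \<in> ?K" "norm (F x) \<le> \<epsilon>0" using near[OF x] \<epsilon>2 by auto
    show "F (fst x, \<rho> x) = 0" by (rule \<rho>(4)[OF K])
    have n: "norm (\<rho> x - snd x) \<le> c * norm (F x)" by (rule \<rho>(5)[OF K])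
    also have "\<dots> \<le> c * (l * \<epsilon>)" using near[OF x] \<rho>(2) by (intro mult_left_mono) auto
    finally have n': "norm (\<rho> x - snd x) \<le> c * (l * \<epsilon>)" .
    show "\<rho> x \<notin> \<sigma>"
    proof
      assume "\<rho> x \<in> \<sigma>"
      then have "\<delta> \<le> norm (snd x - \<rho> x) + \<epsilon>" using near[OF x] by blast
      then show False using n' \<epsilon>3 by (simp add: norm_minus_commute)
    qed
    show "\<rho> x = snd x" if "F x = 0" using n that by simp
  qed
qed

text \<open>Continuity and avoidance of \<sigma> are left to \<open>homotopic_with_canon\<close>;
  this is the property that every stage of a homotopy has to keep.\<close>

definition is_path :: "(real \<Rightarrow> 'a) \<Rightarrow> bool" where
  "is_path p \<longleftrightarrow> p 0 = 0 \<and> p T = e \<and> (\<forall>t\<in>{0..T}. F (t, p t) = 0)"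

abbreviation path_homotopic :: "(real \<Rightarrow> 'a) \<Rightarrow> (real \<Rightarrow> 'a) \<Rightarrow> bool" where
  "path_homotopic \<equiv> homotopic_with_canon is_path {0..T} (- \<sigma>)"

lemma is_path_cong: "(\<And>t. t \<in> {0..T} \<Longrightarrow> p t = q t) \<Longrightarrow> is_path p = is_path q"
  using T_pos by (auto simp: is_path_def)

end

text \<open>Gathers the bounds that do not depend on the number of grid points, together with the
  retraction. The assumption \<open>z0_core\<close> places the reference path itself in the core,
  since it is an end of the homotopies below.\<close>

locale discretization = boundary_problem F F' F'' E \<sigma> g g' a a' V V' K T e C M A C1 P z0 \<Lambda>
  for F :: "real \<times> 'a::euclidean_space \<Rightarrow> 'a" and F' F'' E \<sigma> g g' a a' V V' K T e C M A C1 P z0 \<Lambda> +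
  fixes S Y R \<delta> \<epsilon> :: real and \<rho> :: "real \<times> 'a \<Rightarrow> 'a"
  assumes S: "\<And>N. 0 < N \<Longrightarrow> action N (sample N) \<le> S"
    and Y_pos: "0 < Y" and \<delta>_pos: "0 < \<delta>" and \<epsilon>_pos: "0 < \<epsilon>"
    and energy_le: "\<And>N z. 0 < N \<Longrightarrow> admissible N z \<Longrightarrow> action N z \<le> S \<Longrightarrow> energy N z \<le> Y"
    and norm_le: "\<And>N z k. 0 < N \<Longrightarrow> admissible N z \<Longrightarrow> action N z \<le> S \<Longrightarrow> k \<le> N \<Longrightarrow> norm (z k) \<le> R"
    and dist_ge: "\<And>N z k s. 0 < N \<Longrightarrow> admissible N z \<Longrightarrow> action N z \<le> S \<Longrightarrow> k \<le> N \<Longrightarrow> s \<in> \<sigma> \<Longrightarrow>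
      \<delta> \<le> norm (z k - s)"
    and z0_core: "\<And>t. t \<in> {0..T} \<Longrightarrow> (t, z0 t) \<in> core R \<delta>"
    and \<rho>_cont: "continuous_on (core_nbhd R \<delta> \<epsilon>) \<rho>"
    and \<rho>_F: "\<And>x. x \<in> core_nbhd R \<delta> \<epsilon> \<Longrightarrow> F (fst x, \<rho> x) = 0"
    and \<rho>_\<sigma>: "\<And>x. x \<in> core_nbhd R \<delta> \<epsilon> \<Longrightarrow> \<rho> x \<notin> \<sigma>"
    and \<rho>_id: "\<And>x. x \<in> core_nbhd R \<delta> \<epsilon> \<Longrightarrow> F x = 0 \<Longrightarrow> \<rho> x = snd x"
begin

abbreviation "Q \<equiv> core R \<delta>"
abbreviation "nbhd \<equiv> core_nbhd R \<delta>"

definition line :: "nat \<Rightarrow> (nat \<Rightarrow> 'a) \<Rightarrow> real \<Rightarrow> 'a" where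
  "line N z = polygon (h N) N z"

text \<open>\<open>sqrt (h N * Y)\<close> bounds a single step of a competitor, so the first
  inequality puts the whole polygon in the tube of radius \<open>\<epsilon> / 2\<close>; the second
  bounds the distance of \<open>z0\<close> from the polygon through its samples.\<close>

definition small :: "nat \<Rightarrow> bool" where
  "small N \<longleftrightarrow> 0 < N \<and> h N + sqrt (h N * Y) \<le> \<epsilon> / 2 \<and> 2 * \<Lambda> * h N \<le> \<epsilon> / 2"

text \<open>The polygon leaves the constraint between grid points, so the class is that of its
  retraction.\<close>

definition good :: "nat \<Rightarrow> (nat \<Rightarrow> 'a) \<Rightarrow> bool" where
  "good N z \<longleftrightarrow> admissible N z \<and> action N z \<le> S \<and> path_homotopic z0 (\<lambda>t. \<rho> (t, line N z t))"

text \<open>Straight-line homotopy followed by \<open>\<rho>\<close>: the segments from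
  \<open>u1\<close> to \<open>u2\<close> stay in the tube of radius \<open>\<epsilon>\<close>, and
  the ends stay fixed because \<open>\<rho>\<close> is the identity on the constraint.
  \<open>p\<close> and \<open>q\<close> are prescribed on \<open>[0, T]\<close> only, so that a path
  equal there to its own retraction can be inserted.\<close>

lemma retract_homotopic:
  assumes u: "continuous_on {0..T} u1" "continuous_on {0..T} u2"
    and ends: "u1 0 = 0" "u1 T = e" "u2 0 = 0" "u2 T = e"
    and near: "\<And>t. t \<in> {0..T} \<Longrightarrow> (t, u1 t) \<in> nbhd (\<epsilon> / 2)"
    and close: "\<And>t. t \<in> {0..T} \<Longrightarrow> norm (u2 t - u1 t) \<le> \<epsilon> / 2"
    and p: "\<And>t. t \<in> {0..T} \<Longrightarrow> p t = \<rho> (t, u1 t)"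
    and q: "\<And>t. t \<in> {0..T} \<Longrightarrow> q t = \<rho> (t, u2 t)"
  shows "path_homotopic p q"
proof -
  let ?w = "\<lambda>x. (snd x, (1 - fst x) *\<^sub>R u1 (snd x) + fst x *\<^sub>R u2 (snd x)) :: real \<times> 'a"
  have w: "?w x \<in> nbhd \<epsilon>" if x: "x \<in> {0..1} \<times> {0..T}" for x
  proof -
    obtain x' where x': "x' \<in> Q" "dist (snd x, u1 (snd x)) x' \<le> \<epsilon> / 2"
      using near[of "snd x"] x by (auto simp: core_nbhd_def mem_Times_iff)
    have eq: "(1 - fst x) *\<^sub>R u1 (snd x) + fst x *\<^sub>R u2 (snd x) - u1 (snd x) = fst x *\<^sub>R (u2 (snd x) - u1 (snd x))"
      by (simp add: algebra_simps)
    have "dist (?w x) (snd x, u1 (snd x)) =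
        dist ((1 - fst x) *\<^sub>R u1 (snd x) + fst x *\<^sub>R u2 (snd x)) (u1 (snd x))"
      by (simp add: dist_Pair_Pair)
    also have "\<dots> = norm (fst x *\<^sub>R (u2 (snd x) - u1 (snd x)))" unfolding dist_norm eq ..
    also have "\<dots> \<le> norm (u2 (snd x) - u1 (snd x))"
      using x by (auto simp: mem_Times_iff mult_left_le_one_le)
    also have "\<dots> \<le> \<epsilon> / 2" using close x by (auto simp: mem_Times_iff)
    finally have "dist (?w x) x' \<le> \<epsilon>"
      using x'(2) dist_triangle[of "?w x" x' "(snd x, u1 (snd x))"] by linarith
    then show ?thesis using x x'(1) by (auto simp: core_nbhd_def mem_Times_iff)
  qed
  have cont_w: "continuous_on ({0..1} \<times> {0..T}) ?w"
    by (intro continuous_on_Pair continuous_on_add continuous_on_scaleR continuous_on_diff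
        continuous_on_const continuous_on_fst continuous_on_snd continuous_on_id
        continuous_on_compose2[OF u(1) continuous_on_snd[OF continuous_on_id]]
        continuous_on_compose2[OF u(2) continuous_on_snd[OF continuous_on_id]]) auto
  have cont: "continuous_on ({0..1} \<times> {0..T}) (\<lambda>x. \<rho> (?w x))"
    by (rule continuous_on_compose2[OF \<rho>_cont cont_w]) (use w in blast)
  have end0: "\<rho> (t, y) = y" if "(t, y) \<in> nbhd \<epsilon>" "F (t, y) = 0" for t y
    using \<rho>_id[OF that] by simp
  have F_ends: "F (0, 0) = 0" "F (T, e) = 0"
    using z0_in(2)[of 0] z0_in(2)[of T] z0_ends T_pos by simp_all
  have path: "is_path (\<lambda>t. \<rho> (?w (r, t)))" if r: "r \<in> {0..1}" for r
    unfolding is_path_def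
  proof (intro conjI ballI)
    have "?w (r, 0) = (0, 0)" "?w (r, T) = (T, e)"
      by (simp_all add: ends scaleR_left_distrib[symmetric])
    then show "\<rho> (?w (r, 0)) = 0" "\<rho> (?w (r, T)) = e"
      using end0[of 0 0] end0[of T e] w[of "(r, 0)"] w[of "(r, T)"] r T_pos F_ends by auto
    show "F (t, \<rho> (?w (r, t))) = 0" if "t \<in> {0..T}" for t
      using \<rho>_F[OF w[of "(r, t)"]] r that by simp
  qed
  show ?thesis
  proof (rule iffD2[OF homotopic_with])
    show "is_path p' = is_path q'" if "\<And>x. x \<in> topspace (top_of_set {0..T}) \<Longrightarrow> p' x = q' x" for p' q'
      using that by (intro is_path_cong) auto
    have "(\<lambda>x. \<rho> (?w x)) \<in> {0..1} \<times> {0..T} \<rightarrow> - \<sigma>" using w \<rho>_\<sigma> by blast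
    then have cm: "continuous_map (prod_topology (top_of_set {0..1}) (top_of_set {0..T})) (top_of_set (- \<sigma>)) (\<lambda>x. \<rho> (?w x))"
      unfolding prod_topology_subtopology_eu continuous_map_subtopology_eu using cont by blast
    define H where "H = (\<lambda>x. \<rho> (?w x))"
    have "\<forall>x\<in>topspace (top_of_set {0..T}). H (0, x) = p x"
      "\<forall>x\<in>topspace (top_of_set {0..T}). H (1, x) = q x"
      by (simp_all add: H_def p q)
    moreover have "\<forall>t\<in>{0..1}. is_path (\<lambda>x. H (t, x))"
      unfolding H_def by (rule ballI) (rule path)
    ultimately have "continuous_map (prod_topology (top_of_set {0..1}) (top_of_set {0..T})) (top_of_set (- \<sigma>)) H \<and>
      (\<forall>x\<in>topspace (top_of_set {0..T}). H (0, x) = p x) \<and>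
      (\<forall>x\<in>topspace (top_of_set {0..T}). H (1, x) = q x) \<and>
      (\<forall>t\<in>{0..1}. is_path (\<lambda>x. H (t, x)))"
      using cm[folded H_def] by (intro conjI)
    then show "\<exists>h. continuous_map (prod_topology (top_of_set {0..1::real}) (top_of_set {0..T})) (top_of_set (- \<sigma>)) h \<and>
      (\<forall>x\<in>topspace (top_of_set {0..T}). h (0, x) = p x) \<and>
      (\<forall>x\<in>topspace (top_of_set {0..T}). h (1, x) = q x) \<and>
      (\<forall>t\<in>{0..1}. is_path (\<lambda>x. h (t, x)))"
      by (rule exI[where x = H])
  qed
qed

lemma admissible_core:
  assumes "0 < N" "admissible N z" "action N z \<le> S" "k \<le> N"
  shows "(real k * h N, z k) \<in> Q"
  using grid_in[OF assms(1,4)] norm_le[OF assms] dist_ge[OF assms] assms(2,4)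
  by (simp add: core_iff admissible_def)

text \<open>A single summand of the energy is at most \<open>Y\<close>, and
  \<open>(h * v)\<^sup>2 = h * (h * v\<^sup>2)\<close>.\<close>

lemma step_le:
  assumes "0 < N" "admissible N z" "action N z \<le> S" "k < N"
  shows "h N * norm (vel N z k) \<le> sqrt (h N * Y)"
proof (rule real_le_rsqrt)
  have "h N * (norm (vel N z k))\<^sup>2 \<le> energy N z"
    unfolding energy_def using assms(4) h_pos[OF assms(1)]
    by (intro member_le_sum) auto
  also have "\<dots> \<le> Y" by (rule energy_le[OF assms(1-3)])
  finally have "h N * (h N * (norm (vel N z k))\<^sup>2) \<le> h N * Y"
    using h_pos[OF assms(1)] by simp
  then show "(h N * norm (vel N z k))\<^sup>2 \<le> h N * Y"
    by (simp add: power_mult_distrib power2_eq_square ac_simps)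
qed

lemma line_ends:
  assumes "0 < N" "admissible N z"
  shows "line N z 0 = 0" "line N z T = e"
  using polygon_grid[OF h_pos[OF assms(1)], of 0 N z] polygon_grid[OF h_pos[OF assms(1)], of N N z]
    h_N[OF assms(1)] assms by (simp_all add: line_def admissible_def)

lemma line_cont: "0 < N \<Longrightarrow> continuous_on {0..T} (line N z)"
  unfolding line_def by (rule continuous_on_polygon) (use h_pos[of N] in simp)

lemma line_near:
  assumes "small N" "admissible N z" "action N z \<le> S" "t \<in> {0..T}"
  shows "(t, line N z t) \<in> nbhd (\<epsilon> / 2)"
proof -
  have N: "0 < N" using assms(1) by (simp add: small_def)
  have tN: "0 \<le> t" "t \<le> real N * h N" unfolding h_N[OF N] using assms(4) by auto
  have st: "norm (z (Suc k) - z k) \<le> sqrt (h N * Y)" if "k < N" for k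
    using step_le[OF N assms(2,3) that] norm_step[OF N, of z k] by simp
  obtain k where k: "k < N" "\<bar>t - real k * h N\<bar> \<le> h N" "norm (line N z t - z k) \<le> sqrt (h N * Y)"
    using polygon_near[where y = z and \<eta> = "sqrt (h N * Y)", OF h_pos[OF N] tN N] st unfolding line_def by blast
  have "dist (t, line N z t) (real k * h N, z k) \<le> norm (t - real k * h N) + norm (line N z t - z k)"
    using norm_Pair_le[of "t - real k * h N" "line N z t - z k"] by (simp add: dist_norm)
  also have "\<dots> \<le> \<epsilon> / 2" using k assms(1) by (simp add: small_def)
  finally show ?thesis
    using admissible_core[OF N assms(2,3), of k] k(1) assms(4) by (auto simp: core_nbhd_def)
qed

text \<open>The class is unchanged by perturbations up to \<open>\<epsilon> / 2\<close>. This is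
  used twice: the limit of a minimising sequence stays in the class, and so do the small variations
  behind the Euler-Lagrange equations.\<close>

lemma good_cong:
  assumes "small N" "good N z" "admissible N z'" "action N z' \<le> S"
    and close: "\<And>k. k \<le> N \<Longrightarrow> norm (z' k - z k) \<le> \<epsilon> / 2"
  shows "good N z'"
proof -
  have N: "0 < N" using assms(1) by (simp add: small_def)
  have z: "admissible N z" "action N z \<le> S" "path_homotopic z0 (\<lambda>t. \<rho> (t, line N z t))"
    using assms(2) by (simp_all add: good_def)
  have "path_homotopic (\<lambda>t. \<rho> (t, line N z t)) (\<lambda>t. \<rho> (t, line N z' t))"
  proof (rule retract_homotopic[OF line_cont[OF N] line_cont[OF N] line_ends[OF N z(1)] line_ends[OF N assms(3)]])
    fix t assume t: "t \<in> {0..T}"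
    show "(t, line N z t) \<in> nbhd (\<epsilon> / 2)" by (rule line_near[OF assms(1) z(1,2) t])
    show "norm (line N z' t - line N z t) \<le> \<epsilon> / 2"
      unfolding line_def
      by (rule polygon_diff_le[OF h_pos[OF N]]) (use t N close in \<open>auto simp: h_N\<close>)
  qed auto
  then show ?thesis using homotopic_with_trans[OF z(3)] assms(3,4) by (simp add: good_def)
qed

lemma good_sample:
  assumes "small N"
  shows "good N (sample N)"
proof -
  have N: "0 < N" using assms by (simp add: small_def)
  note adm = sample_admissible[OF N] and act = S[OF N]
  have "path_homotopic (\<lambda>t. \<rho> (t, line N (sample N) t)) z0"
  proof (rule retract_homotopic[OF line_cont[OF N] z0_cont line_ends[OF N adm] z0_ends line_near[OF assms adm act]])
    fix t assume t: "t \<in> {0..T}"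
    have tN: "0 \<le> t" "t \<le> real N * h N" unfolding h_N[OF N] using t by auto
    obtain k where k: "k < N" "\<bar>t - real k * h N\<bar> \<le> h N" "norm (line N (sample N) t - sample N k) \<le> \<Lambda> * h N"
      using polygon_near[where y = "sample N" and \<eta> = "\<Lambda> * h N", OF h_pos[OF N] tN N] sample_step[OF N]
      unfolding line_def by blast
    have "norm (z0 t - sample N k) \<le> \<Lambda> * \<bar>t - real k * h N\<bar>"
      using z0_lipschitz[OF t grid_in[OF N, of k]] k(1) by (simp add: sample_def)
    also have "\<dots> \<le> \<Lambda> * h N" using k(2) \<Lambda>_nonneg by (rule mult_left_mono)
    finally have "norm (z0 t - line N (sample N) t) \<le> \<Lambda> * h N + \<Lambda> * h N"
      using k(3) norm_triangle_ineq4[of "z0 t - sample N k" "line N (sample N) t - sample N k"] by simp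
    also have "\<dots> \<le> \<epsilon> / 2" using assms by (simp add: small_def)
    finally show "norm (z0 t - line N (sample N) t) \<le> \<epsilon> / 2" .
    have "(t, z0 t) \<in> nbhd \<epsilon>"
      using z0_core[OF t] t \<epsilon>_pos by (auto simp: core_nbhd_def intro!: bexI[of _ "(t, z0 t)"])
    then show "z0 t = \<rho> (t, z0 t)" using \<rho>_id[of "(t, z0 t)"] z0_in(2)[OF t] by simp
  qed auto
  then show ?thesis using adm act homotopic_with_symD by (auto simp: good_def)
qed

lemma action_lower: "0 < N \<Longrightarrow> admissible N z \<Longrightarrow> - offset \<le> action N z"
proof -
  assume N: "0 < N" and z: "admissible N z"
  have "V (real k * h N, z k) \<le> A * (norm (z k))\<^sup>2 + C1 - 0" if "k < N" for k
    using V_bound[of "(real k * h N, z k)"] that z by (simp add: admissible_def)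
  from action_lower_bound[OF N z this] have "\<gamma> / 2 * energy N z \<le> action N z + offset" by simp
  moreover have "0 \<le> \<gamma> / 2 * energy N z" using \<gamma>_pos energy_nonneg[OF N, of z] by simp
  ultimately show "- offset \<le> action N z" by linarith
qed

lemma action_tendsto:
  assumes "0 < N" "\<And>k. k \<le> N \<Longrightarrow> z k \<notin> \<sigma>" and lim: "\<And>k. (\<lambda>n. y n k) \<longlonglongrightarrow> z k"
  shows "(\<lambda>n. action N (y n)) \<longlonglongrightarrow> action N z"
  unfolding action_def
proof (intro tendsto_sum tendsto_mult tendsto_const)
  fix k assume k: "k \<in> {..<N}"
  have x: "(\<lambda>n. (real k * h N, y n k)) \<longlonglongrightarrow> (real k * h N, z k)" by (intro tendsto_Pair tendsto_const lim)
  have v: "(\<lambda>n. vel N (y n) k) \<longlonglongrightarrow> vel N z k"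
    unfolding vel_def by (intro tendsto_scaleR tendsto_const tendsto_diff lim)
  have "(real k * h N, z k) \<in> \<Omega>" using assms(2) k by simp
  then have at: "isCont g (real k * h N, z k)" "isCont a (real k * h N, z k)" "isCont V (real k * h N, z k)"
    using g_cont a_cont V_cont open_\<Omega> continuous_on_eq_continuous_at by blast+
  show "(\<lambda>n. L (real k * h N, y n k) (vel N (y n) k)) \<longlonglongrightarrow> L (real k * h N, z k) (vel N z k)"
    unfolding L_def
    by (intro tendsto_diff tendsto_add tendsto_mult tendsto_const tendsto_inner blinfun.tendsto v
        isCont_tendsto_compose[OF at(1) x] isCont_tendsto_compose[OF at(2) x] isCont_tendsto_compose[OF at(3) x])
qed

text \<open>The direct method in finite dimension: the uniform distance \<open>\<delta>\<close>
  survives in the limit and keeps it off \<sigma>, so the action converges along the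
  subsequence.\<close>

lemma minimizer_exists:
  assumes "small N"
  obtains z where "good N z" "\<And>z'. good N z' \<Longrightarrow> action N z \<le> action N z'"
proof -
  have N: "0 < N" using assms by (simp add: small_def)
  define m where "m = Inf (action N ` {z. good N z})"
  have bdd: "bdd_below (action N ` {z. good N z})"
    using action_lower[OF N] by (intro bdd_belowI2[where m = "- offset"]) (simp add: good_def)
  have ne: "action N ` {z. good N z} \<noteq> {}" using good_sample[OF assms] by blast
  have m: "m \<le> action N z'" if "good N z'" for z'
    unfolding m_def using that by (intro cInf_lower bdd) blast
  have "\<exists>z. good N z \<and> action N z < m + inverse (real (Suc n))" for n
  proof -
    have "m < m + inverse (real (Suc n))" by simp
    then show ?thesis unfolding m_def cInf_less_iff[OF ne bdd] by blast
  qed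
  then obtain y where y: "\<And>n. good N (y n)" "\<And>n. action N (y n) < m + inverse (real (Suc n))" by metis
  have y': "admissible N (y n)" "action N (y n) \<le> S" for n using y(1)[of n] by (simp_all add: good_def)
  have bound: "norm (y n k) \<le> max R (norm e)" for n k
    using norm_le[OF N y', of k n] y'(1)[of n] by (cases "k \<le> N") (auto simp: admissible_def)
  obtain r where r: "strict_mono (r :: nat \<Rightarrow> nat)" "\<And>k. k \<in> UNIV \<Longrightarrow> \<exists>l. (\<lambda>n. y (r n) k) \<longlonglongrightarrow> l"
    using function_convergent_subsequence[of UNIV y, OF countableI_type bound] by blast
  then obtain z where z: "\<And>k. (\<lambda>n. y (r n) k) \<longlonglongrightarrow> z k" by (metis UNIV_I)
  have dist: "\<delta> \<le> norm (z k - s)" if "k \<le> N" "s \<in> \<sigma>" for k s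
    by (rule LIMSEQ_le_const[OF tendsto_norm[OF tendsto_diff[OF z tendsto_const]]])
       (use dist_ge[OF N y' that] in auto)
  have z\<sigma>: "z k \<notin> \<sigma>" if "k \<le> N" for k using dist[OF that, of "z k"] \<delta>_pos by auto
  have adm: "admissible N z"
    unfolding admissible_def
  proof (intro conjI allI impI z\<sigma>)
    show "z 0 = 0" using LIMSEQ_unique[OF z[of 0], of 0] y'(1) by (simp add: admissible_def)
    show "z k = e" if "N \<le> k" for k
      using LIMSEQ_unique[OF z[of k], of e] y'(1) that by (simp add: admissible_def)
    show "F (real k * h N, z k) = 0" if "k \<le> N" for k
    proof -
      have "isCont F (real k * h N, z k)"
        using F_cont[of UNIV] by (simp add: continuous_on_eq_continuous_at)
      then have "(\<lambda>n. F (real k * h N, y (r n) k)) \<longlonglongrightarrow> F (real k * h N, z k)"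
        by (rule isCont_tendsto_compose) (intro tendsto_Pair tendsto_const z)
      then show ?thesis using LIMSEQ_unique[OF _ tendsto_const] y'(1) that by (simp add: admissible_def)
    qed
  qed
  have lim: "(\<lambda>n. action N (y (r n))) \<longlonglongrightarrow> action N z"
    by (rule action_tendsto[OF N z\<sigma> z])
  have "(\<lambda>n. m + inverse (real (Suc n))) \<longlonglongrightarrow> m + 0"
    by (intro tendsto_add tendsto_const LIMSEQ_inverse_real_of_nat)
  then have lim': "(\<lambda>n. m + inverse (real (Suc (r n)))) \<longlonglongrightarrow> m"
    using LIMSEQ_subseq_LIMSEQ[OF _ r(1), of "\<lambda>n. m + inverse (real (Suc n))" m] by (simp add: o_def)
  have zm: "action N z \<le> m"
    by (rule LIMSEQ_le[OF lim lim']) (use y(2) less_imp_le in blast)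
  have zS: "action N z \<le> S" using zm m[OF y(1)[of 0]] y'(2)[of 0] by linarith
  \<comment> \<open>There are finitely many grid points, so pointwise convergence is uniform on them
    and some term of the sequence is close enough for \<open>good_cong\<close>.\<close>
  have "\<forall>\<^sub>F n in sequentially. \<forall>k\<in>{..N}. dist (y (r n) k) (z k) < \<epsilon> / 2"
    by (intro eventually_ball_finite ballI tendstoD[OF z]) (use \<epsilon>_pos in auto)
  then obtain n where n: "\<forall>k\<in>{..N}. dist (y (r n) k) (z k) < \<epsilon> / 2"
    by (auto simp: eventually_sequentially)
  have "good N z"
    by (rule good_cong[OF assms y(1)[of "r n"] adm zS])
       (use n in \<open>auto simp: dist_norm norm_minus_commute less_imp_le\<close>)
  then show ?thesis using that m zm order_trans by blast
qed

lemma minimizer_local: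
  assumes "small N" "good N z" and min: "\<And>z'. good N z' \<Longrightarrow> action N z \<le> action N z'"
    and k: "0 < k" "k < N" and y: "norm (y - z k) < min \<delta> (\<epsilon> / 2)" "F (real k * h N, y) = 0"
  shows "action N z \<le> action N (z(k := y))"
proof (rule ccontr)
  assume less: "\<not> ?thesis"
  have N: "0 < N" using assms(1) by (simp add: small_def)
  have z: "admissible N z" "action N z \<le> S" using assms(2) by (simp_all add: good_def)
  have "y \<notin> \<sigma>"
  proof
    assume "y \<in> \<sigma>"
    then have "\<delta> \<le> norm (z k - y)" using dist_ge[OF N z, of k y] k by simp
    then show False using y(1) by (simp add: norm_minus_commute)
  qed
  then have adm: "admissible N (z(k := y))" using z(1) k y(2) by (simp add: admissible_def)
  \<comment> \<open>A variation with smaller action is automatically below the level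
    \<open>S\<close>, as \<open>good\<close> demands; this is why the argument runs by
    contradiction.\<close>
  have "good N (z(k := y))"
    by (rule good_cong[OF assms(1,2) adm]) (use less z(2) y(1) \<epsilon>_pos in auto)
  then show False using min less by blast
qed

lemma action_update:
  assumes "Suc j < N"
  shows "action N (z(Suc j := y)) - action N z =
    h N * L (real (Suc j) * h N, y) ((z (Suc (Suc j)) - y) /\<^sub>R h N) + h N * L (real j * h N, z j) ((y - z j) /\<^sub>R h N)
    - (h N * L (real (Suc j) * h N, z (Suc j)) ((z (Suc (Suc j)) - z (Suc j)) /\<^sub>R h N)
      + h N * L (real j * h N, z j) ((z (Suc j) - z j) /\<^sub>R h N))"
proof -
  let ?f = "\<lambda>z k. h N * L (real k * h N, z k) (vel N z k)"
  have split: "action N z = ?f z (Suc j) + ?f z j + (\<Sum>k\<in>{..<N} - {j, Suc j}. ?f z k)" for z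
  proof -
    have "action N z = (\<Sum>k\<in>{..<N} - {j, Suc j}. ?f z k) + (\<Sum>k\<in>{j, Suc j}. ?f z k)"
      unfolding action_def by (rule sum.subset_diff) (use assms in auto)
    then show ?thesis by simp
  qed
  have "(\<Sum>k\<in>{..<N} - {j, Suc j}. ?f (z(Suc j := y)) k) = (\<Sum>k\<in>{..<N} - {j, Suc j}. ?f z k)"
    by (rule sum.cong) (auto simp: vel_def)
  then show ?thesis unfolding split by (simp add: vel_def)
qed

lemma minimizer_euler_lagrange:
  assumes "small N" "good N z" and min: "\<And>z'. good N z' \<Longrightarrow> action N z \<le> action N z'"
    and j: "Suc j < N"
  obtains \<mu> where "E \<mu> = 0"
    "h N *\<^sub>R Lz (real (Suc j) * h N, z (Suc j)) (vel N z (Suc j))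
      - (g (real (Suc j) * h N, z (Suc j)) (vel N z (Suc j)) + a (real (Suc j) * h N, z (Suc j)))
      + (g (real j * h N, z j) (vel N z j) + a (real j * h N, z j)) = Bt (real (Suc j) * h N, z (Suc j)) \<mu>"
proof -
  have N: "0 < N" using assms(1) by (simp add: small_def)
  have z: "admissible N z" using assms(2) by (simp_all add: good_def)
  show ?thesis
  proof (rule discrete_euler_lagrange[where h = "h N" and y = "z (Suc j)" and t = "real (Suc j) * h N"
        and xm = "(real j * h N, z j)" and yp = "z (Suc (Suc j))" and ym = "z j" and r = "min \<delta> (\<epsilon> / 2)"])
    show "0 < h N" by (rule h_pos[OF N])
    show "z (Suc j) \<notin> \<sigma>" "snd (real j * h N, z j) \<notin> \<sigma>" "F (real (Suc j) * h N, z (Suc j)) = 0"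
      using z j unfolding admissible_def by (simp_all only: snd_conv) auto
    show "0 < min \<delta> (\<epsilon> / 2)" using \<delta>_pos \<epsilon>_pos by simp
    fix y assume "norm (y - z (Suc j)) < min \<delta> (\<epsilon> / 2)" "F (real (Suc j) * h N, y) = 0"
    then have "action N z \<le> action N (z(Suc j := y))"
      by (intro minimizer_local[OF assms(1,2) min]) (use j in auto)
    then show "h N * L (real (Suc j) * h N, z (Suc j)) ((z (Suc (Suc j)) - z (Suc j)) /\<^sub>R h N)
        + h N * L (real j * h N, z j) ((z (Suc j) - z j) /\<^sub>R h N)
      \<le> h N * L (real (Suc j) * h N, y) ((z (Suc (Suc j)) - y) /\<^sub>R h N)
        + h N * L (real j * h N, z j) ((y - z j) /\<^sub>R h N)"
      using action_update[OF j, of z y] by linarith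
  qed (use that in \<open>simp add: vel_def\<close>)
qed

end

lemma polygon_fst: "fst (polygon h N y t) = polygon h N (\<lambda>k. fst (y k)) t"
  by (simp add: polygon_def fst_sum)

section \<open>Passage to the limit as the step tends to zero\<close>

context boundary_problem
begin

lemma h_tendsto_0: "h \<longlonglongrightarrow> 0"
  unfolding h_def
  by (intro tendsto_divide_0[OF tendsto_const] filterlim_at_top_imp_at_infinity filterlim_real_sequentially)

lemma grid_point_step: "0 < N \<Longrightarrow> (real (Suc k) * h N, z (Suc k)) = (real k * h N, z k) + h N *\<^sub>R (1, vel N z k)"
  using step_vel[of N z k] by (simp add: algebra_simps)

lemma grid_point_back: "0 < N \<Longrightarrow> (real k * h N, z k) = (real (Suc k) * h N, z (Suc k)) - h N *\<^sub>R (1, vel N z k)"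
  by (simp add: step_vel[of N z k] algebra_simps)

end

context discretization
begin

lemma eventually_fine:
  assumes "0 < d"
  obtains N0 where "\<And>N. N0 \<le> N \<Longrightarrow> small N \<and> h N + sqrt (h N * Y) < d"
proof -
  have "(\<lambda>N. h N + sqrt (h N * Y)) \<longlonglongrightarrow> 0 + sqrt (0 * Y)"
    by (intro tendsto_add tendsto_real_sqrt tendsto_mult tendsto_const h_tendsto_0)
  then have l1: "(\<lambda>N. h N + sqrt (h N * Y)) \<longlonglongrightarrow> 0" by simp
  have l2: "(\<lambda>N. 2 * \<Lambda> * h N) \<longlonglongrightarrow> 0"
    using tendsto_mult_right_zero[OF h_tendsto_0] .
  have half: "0 < \<epsilon> / 2" using \<epsilon>_pos by simp
  have "\<forall>\<^sub>F N in sequentially. small N \<and> h N + sqrt (h N * Y) < d"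
    using order_tendstoD(2)[OF l1 assms] order_tendstoD(2)[OF l1 half] order_tendstoD(2)[OF l2 half]
      eventually_gt_at_top[of "0::nat"]
    by eventually_elim (simp add: small_def)
  then show ?thesis using that by (auto simp: eventually_sequentially)
qed

text \<open>Each estimate feeds the next: the energy makes \<open>h\<close> times the velocity
  small, which permits the quadratic jump bound; its sum gives the velocity bound \<open>Rv\<close>;
  with \<open>Rv\<close> inserted, the jump bound becomes the Lipschitz constant \<open>C3\<close>;
  and these two are what consistency with \<open>accel\<close> presupposes.\<close>

lemma minimizer_sequence:
  obtains N :: "nat \<Rightarrow> nat" and z :: "nat \<Rightarrow> nat \<Rightarrow> 'a" and Rv C3 :: real where
    "\<forall>n. small (N n)" "filterlim N at_top sequentially" "\<forall>n. good (N n) (z n)" "0 \<le> Rv" "0 \<le> C3"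
    "\<forall>n k. k < N n \<longrightarrow> norm (vel (N n) (z n) k) \<le> Rv"
    "\<forall>n k. Suc k < N n \<longrightarrow> norm (vel (N n) (z n) (Suc k) - vel (N n) (z n) k) \<le> C3 * h (N n)"
    "\<forall>e'>0. \<exists>h0>0. \<forall>n k. h (N n) < h0 \<longrightarrow> Suc k < N n \<longrightarrow>
        norm (vel (N n) (z n) (Suc k) - vel (N n) (z n) k
          - h (N n) *\<^sub>R accel (real (Suc k) * h (N n), z n (Suc k)) (vel (N n) (z n) (Suc k))) \<le> e' * h (N n)"
proof -
  note A = compact_core[of R \<delta>] core_subset[OF \<delta>_pos, of R] core_F
  obtain d C0 where d: "0 < d" and C0: "0 \<le> C0" and step:
    "\<forall>h x v vm. discrete_motion h x v vm \<longrightarrow> x \<in> Q \<longrightarrow> h * norm (1::real, v) < d \<longrightarrow>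
      h * norm (1::real, vm) < d \<longrightarrow> norm (v - vm) \<le> C0 * h * (1 + (norm v)\<^sup>2 + (norm vm)\<^sup>2)"
    by (rule discrete_step_bound[OF A])
  obtain N0 where N0: "\<And>N. N0 \<le> N \<Longrightarrow> small N \<and> h N + sqrt (h N * Y) < d"
    using eventually_fine[OF d] by blast
  define N where "N n = N0 + n" for n
  have sm: "small (N n)" and fine: "h (N n) + sqrt (h (N n) * Y) < d" for n
    using N0[of "N n"] by (simp_all add: N_def)
  have Npos: "0 < N n" for n using sm[of n] by (simp add: small_def)
  note hp = h_pos[OF Npos]
  have "\<exists>z. good (N n) z \<and> (\<forall>z'. good (N n) z' \<longrightarrow> action (N n) z \<le> action (N n) z')" for n
    using minimizer_exists[OF sm[of n]] by metis
  then obtain z where good: "\<And>n. good (N n) (z n)"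
    and min: "\<And>n z'. good (N n) z' \<Longrightarrow> action (N n) (z n) \<le> action (N n) z'" by metis
  have adm: "admissible (N n) (z n)" "action (N n) (z n) \<le> S" for n
    using good[of n] by (simp_all add: good_def)
  let ?v = "\<lambda>n. vel (N n) (z n)"
  let ?x = "\<lambda>n k. (real k * h (N n), z n k)"
  have xQ: "?x n k \<in> Q" if "k \<le> N n" for n k
    by (rule admissible_core[OF Npos adm that])
  have hv: "h (N n) * norm (1::real, ?v n k) < d" if "k < N n" for n k
  proof -
    have "h (N n) * norm (1::real, ?v n k) \<le> h (N n) * (1 + norm (?v n k))"
      using norm_Pair_le[of "1::real" "?v n k"] hp[of n] by (intro mult_left_mono) auto
    also have "\<dots> \<le> h (N n) + sqrt (h (N n) * Y)"
      using step_le[OF Npos adm that] by (simp add: distrib_left)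
    finally show ?thesis using fine[of n] by linarith
  qed
  have dm: "discrete_motion (h (N n)) (?x n (Suc k)) (?v n (Suc k)) (?v n k)" if k: "Suc k < N n" for n k
  proof -
    have "F (?x n (Suc (Suc k))) = 0" "F (?x n k) = 0"
      by (rule core_F[OF xQ], use k in simp)+
    then show ?thesis
      unfolding discrete_motion_def grid_point_back[OF Npos[of n], of k "z n", symmetric]
        grid_point_step[OF Npos[of n], of "Suc k" "z n", symmetric]
      using minimizer_euler_lagrange[OF sm[of n] good[of n] min k] hp[of n] by metis
  qed
  have sb: "norm (?v n (Suc k) - ?v n k) \<le> C0 * h (N n) * (1 + (norm (?v n (Suc k)))\<^sup>2 + (norm (?v n k))\<^sup>2)"
    if k: "Suc k < N n" for n k
    by (rule step[rule_format, OF dm[OF k] xQ hv hv]) (use k in simp_all)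
  \<comment> \<open>The bound of \<open>discrete_velocity_bound\<close> for energy \<open>Y\<close>
    and \<open>N * h = T\<close>.\<close>
  define Rv where "Rv = sqrt (Y / T) + C0 * (T + 2 * Y)"
  have Rv: "0 \<le> Rv" using C0 T_pos Y_pos by (simp add: Rv_def)
  have vR: "norm (?v n k) \<le> Rv" if "k < N n" for n k
  proof -
    have "norm (?v n k) \<le> sqrt (Y / (real (N n) * h (N n))) + C0 * (real (N n) * h (N n) + 2 * Y)"
    proof (rule discrete_velocity_bound[where v = "?v n" and h = "h (N n)" and N = "N n" and C = C0 and E = Y])
      show "(\<Sum>k<N n. h (N n) * (norm (?v n k))\<^sup>2) \<le> Y"
        using energy_le[OF Npos adm] by (simp only: energy_def)
    qed (rule hp Npos C0 that sb | assumption)+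
    then show ?thesis unfolding h_N[OF Npos] Rv_def .
  qed
  define C3 where "C3 = C0 * (1 + Rv\<^sup>2 + Rv\<^sup>2)"
  have C3: "0 \<le> C3" using C0 by (simp add: C3_def)
  have vd: "norm (?v n (Suc k) - ?v n k) \<le> C3 * h (N n)" if k: "Suc k < N n" for n k
  proof -
    have "(norm (?v n (Suc k)))\<^sup>2 \<le> Rv\<^sup>2" "(norm (?v n k))\<^sup>2 \<le> Rv\<^sup>2"
      using vR k by (auto intro!: power_mono)
    then have "C0 * h (N n) * (1 + (norm (?v n (Suc k)))\<^sup>2 + (norm (?v n k))\<^sup>2) \<le> C0 * h (N n) * (1 + Rv\<^sup>2 + Rv\<^sup>2)"
      using C0 hp[of n] by (intro mult_left_mono) auto
    then show ?thesis using sb[OF k] by (simp add: C3_def ac_simps)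
  qed
  show ?thesis
  proof (rule that[of N z Rv C3])
    show "filterlim N at_top sequentially"
      unfolding N_def by (rule filterlim_at_top_mono[OF filterlim_ident]) simp
    show "\<forall>n. small (N n)" "\<forall>n. good (N n) (z n)" using sm good by blast+
    show "0 \<le> Rv" "0 \<le> C3" by fact+
    show "\<forall>n k. k < N n \<longrightarrow> norm (?v n k) \<le> Rv" using vR by blast
    show "\<forall>n k. Suc k < N n \<longrightarrow> norm (?v n (Suc k) - ?v n k) \<le> C3 * h (N n)" using vd by blast
    show "\<forall>e'>0. \<exists>h0>0. \<forall>n k. h (N n) < h0 \<longrightarrow> Suc k < N n \<longrightarrow>
        norm (?v n (Suc k) - ?v n k - h (N n) *\<^sub>R accel (?x n (Suc k)) (?v n (Suc k))) \<le> e' * h (N n)"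
    proof (intro allI impI)
    fix e' :: real assume e': "0 < e'"
    obtain h0 where h0: "0 < h0" and con:
      "\<forall>h x v vm. discrete_motion h x v vm \<longrightarrow> h < h0 \<longrightarrow> x \<in> Q \<longrightarrow> norm v \<le> Rv \<longrightarrow> norm vm \<le> Rv \<longrightarrow>
        norm (v - vm) \<le> C3 * h \<longrightarrow> norm (v - vm - h *\<^sub>R accel x v) \<le> e' * h"
      by (rule discrete_step_consistent[OF A Rv C3 e'])
    show "\<exists>h0>0. \<forall>n k. h (N n) < h0 \<longrightarrow> Suc k < N n \<longrightarrow>
        norm (?v n (Suc k) - ?v n k - h (N n) *\<^sub>R accel (?x n (Suc k)) (?v n (Suc k))) \<le> e' * h (N n)"
    proof (intro exI[of _ h0] conjI allI impI h0)
      fix n k assume n: "h (N n) < h0" and k: "Suc k < N n"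
      show "norm (?v n (Suc k) - ?v n k - h (N n) *\<^sub>R accel (?x n (Suc k)) (?v n (Suc k))) \<le> e' * h (N n)"
        by (rule con[rule_format, OF dm[OF k] n xQ vR vR vd[OF k]]) (use k in simp_all)
    qed
    qed
  qed
qed

lemma interval_solution:
  obtains z v where "\<forall>t\<in>{0..T}. (t, z t) \<in> Q" "z 0 = 0" "z T = e"
    "\<forall>t\<in>{0..T}. (z has_vector_derivative v t) (at t within {0..T})"
    "\<forall>t\<in>{0..T}. (v has_vector_derivative accel (t, z t) (v t)) (at t within {0..T})"
    "path_homotopic z0 z"
proof -
  obtain N :: "nat \<Rightarrow> nat" and z :: "nat \<Rightarrow> nat \<Rightarrow> 'a" and Rv C3 :: real where
    sm': "\<forall>n. small (N n)" and Nlim: "filterlim N at_top sequentially" and good': "\<forall>n. good (N n) (z n)"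
    and R: "0 \<le> Rv" "0 \<le> C3"
    and vR': "\<forall>n k. k < N n \<longrightarrow> norm (vel (N n) (z n) k) \<le> Rv"
    and vd': "\<forall>n k. Suc k < N n \<longrightarrow> norm (vel (N n) (z n) (Suc k) - vel (N n) (z n) k) \<le> C3 * h (N n)"
    and con: "\<forall>e'>0. \<exists>h0>0. \<forall>n k. h (N n) < h0 \<longrightarrow> Suc k < N n \<longrightarrow>
        norm (vel (N n) (z n) (Suc k) - vel (N n) (z n) k
          - h (N n) *\<^sub>R accel (real (Suc k) * h (N n), z n (Suc k)) (vel (N n) (z n) (Suc k))) \<le> e' * h (N n)"
    by (rule minimizer_sequence)
  note sm = sm'[rule_format] and good = good'[rule_format] and vR = vR'[rule_format] and vd = vd'[rule_format]
  have Npos: "0 < N n" for n using sm[of n] by (simp add: small_def)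
  note hp = h_pos[OF Npos]
  have adm: "admissible (N n) (z n)" "action (N n) (z n) \<le> S" for n
    using good[of n] by (simp_all add: good_def)
  let ?v = "\<lambda>n. vel (N n) (z n)"
  let ?x = "\<lambda>n k. (real k * h (N n), z n k)"
  have xQ: "?x n k \<in> Q" if "k \<le> N n" for n k
    by (rule admissible_core[OF Npos adm that])
  have acc: "continuous_on (Q \<times> cball 0 r) (\<lambda>p. accel (fst p) (snd p))" for r
    by (rule continuous_on_subset[OF accel_cont]) (use core_F core_subset[OF \<delta>_pos] in force)
  have "compact ((\<lambda>p. accel (fst p) (snd p)) ` (Q \<times> cball 0 Rv))"
    by (rule compact_continuous_image[OF acc compact_Times[OF compact_core compact_cball]])
  then have "bounded ((\<lambda>p. accel (fst p) (snd p)) ` (Q \<times> cball 0 Rv))" by (rule compact_imp_bounded)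
  then obtain M0 where M0: "0 < M0" "\<forall>y\<in>(\<lambda>p. accel (fst p) (snd p)) ` (Q \<times> cball 0 Rv). norm y \<le> M0"
    unfolding bounded_pos by blast
  have M0': "norm (accel x v) \<le> M0" if "x \<in> Q" "norm v \<le> Rv" for x v
  proof -
    have "accel x v \<in> (\<lambda>p. accel (fst p) (snd p)) ` (Q \<times> cball 0 Rv)"
      by (rule image_eqI[of _ _ "(x, v)"]) (use that in auto)
    from bspec[OF M0(2) this] show ?thesis .
  qed
  \<comment> \<open>Velocities are meaningful only below index \<open>N\<close>; one explicit Euler
    step supplies the value at \<open>N\<close>, so that position and velocity form a single
    sequence on the whole grid.\<close>
  define w where "w n k = (if k < N n then ?v n k
      else ?v n (N n - 1) + h (N n) *\<^sub>R accel (?x n (N n - 1)) (?v n (N n - 1)))" for n k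
  define y where "y n k = (z n k, w n k)" for n k
  \<comment> \<open>The radius for velocities exceeds \<open>Rv\<close> to leave room for the
    extrapolated last value.\<close>
  define D where "D = (\<lambda>q. (fst (fst q), (snd (fst q), snd q))) ` (Q \<times> cball (0::'a) (Rv + T * M0))"
  define X where "X p = (snd (snd p), accel (fst p, fst (snd p)) (snd (snd p)))" for p :: "real \<times> 'a \<times> 'a"
  have D_iff: "(t, (q, u)) \<in> D \<longleftrightarrow> (t, q) \<in> Q \<and> norm u \<le> Rv + T * M0" for t q and u :: 'a
    unfolding D_def by (force simp: image_iff)
  have hT: "h (N n) \<le> T" for n
    using grid_in[OF Npos[of n], of 1] Npos[of n] by simp
  have wR: "norm (w n k) \<le> Rv + T * M0" for n k
  proof (cases "k < N n")
    case True
    then show ?thesis using vR[OF True] M0(1) T_pos by (simp add: w_def add_increasing2)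
  next
    case False
    have 1: "norm (?v n (N n - 1)) \<le> Rv" "norm (accel (?x n (N n - 1)) (?v n (N n - 1))) \<le> M0"
      using vR[of "N n - 1" n] M0'[OF xQ vR, of "N n - 1" n "N n - 1" n] Npos[of n] by auto
    have "norm (h (N n) *\<^sub>R accel (?x n (N n - 1)) (?v n (N n - 1))) \<le> T * M0"
      unfolding norm_scaleR using 1(2) hT[of n] hp[of n] M0(1) by (intro mult_mono) auto
    then show ?thesis using 1(1) False unfolding w_def
      by (simp del: norm_scaleR) (meson add_mono norm_triangle_le)
  qed
  have wd: "norm (w n (Suc k) - w n k) \<le> (C3 + M0) * h (N n)" if k: "k < N n" for n k
  proof (cases "Suc k < N n")
    case True
    then show ?thesis using vd[OF True] M0(1) hp[of n] k
      by (simp add: w_def distrib_right add_increasing2)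
  next
    case False
    then have "k = N n - 1" using k by simp
    then have "norm (w n (Suc k) - w n k) = h (N n) * norm (accel (?x n k) (?v n k))"
      using False k hp[of n] by (simp add: w_def)
    also have "\<dots> \<le> h (N n) * M0"
      using M0'[OF xQ vR[OF k], of k] k hp[of n] by (intro mult_left_mono) auto
    also have "\<dots> \<le> (C3 + M0) * h (N n)" using R hp[of n] by (simp add: algebra_simps)
    finally show ?thesis .
  qed
  have zd: "norm (z n (Suc k) - z n k) \<le> Rv * h (N n)" if k: "k < N n" for n k
    unfolding norm_step[OF Npos[of n], of "z n" k] using vR[OF k] hp[of n] by (simp add: mult.commute)
  define Cy where "Cy = Rv + (C3 + M0)"
  have Cy: "0 \<le> Cy" using R M0(1) by (simp add: Cy_def)
  have yd: "norm (y n (Suc k) - y n k) \<le> Cy * h (N n)" if k: "k < N n" for n k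
    using norm_Pair_le[of "z n (Suc k) - z n k" "w n (Suc k) - w n k"] zd[OF k] wd[OF k]
    by (simp add: y_def Cy_def distrib_right)
  have hN: "(\<lambda>n. h (N n)) \<longlonglongrightarrow> 0" by (rule filterlim_compose[OF h_tendsto_0 Nlim])
  obtain U r where r: "strict_mono (r :: nat \<Rightarrow> nat)"
    and UD': "\<forall>t\<in>{0..T}. (t, U t) \<in> D"
    and Ud': "\<forall>t\<in>{0..T}. (U has_vector_derivative X (t, U t)) (at t within {0..T})"
    and Ulim': "\<forall>e'>0. \<exists>n0. \<forall>n\<ge>n0. \<forall>t\<in>{0..T}. norm (polygon (h (N (r n))) (N (r n)) (y (r n)) t - U t) < e'"
  proof (rule difference_scheme_limit[where T = T and D = D and X = X and N = N and h = "\<lambda>n. h (N n)" and y = y and C = Cy])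
    show "0 < T" by (rule T_pos)
    show "compact D"
      unfolding D_def
      by (rule compact_continuous_image[OF _ compact_Times[OF compact_core compact_cball]])
         (intro continuous_on_Pair continuous_on_fst continuous_on_snd continuous_on_id)
    show "continuous_on D X"
    proof -
      have "continuous_on D (\<lambda>p. accel (fst ((fst p, fst (snd p)), snd (snd p))) (snd ((fst p, fst (snd p)), snd (snd p))))"
        by (rule continuous_on_compose2[OF acc[of "Rv + T * M0"]])
           (auto intro!: continuous_on_Pair continuous_on_fst continuous_on_snd continuous_on_id simp: D_iff)
      then show ?thesis
        unfolding X_def by (intro continuous_on_Pair continuous_on_snd continuous_on_id) simp_all
    qed
    show "0 < N n" for n by (rule Npos)
    show "filterlim N at_top sequentially" by (rule Nlim)
    show "h (N n) = T / real (N n)" for n by (simp add: h_def)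
    show "(real k * h (N n), y n k) \<in> D" if "k \<le> N n" for n k
      unfolding y_def D_iff using xQ[OF that] wR by blast
    show "norm (y n (Suc k) - y n k) \<le> Cy * h (N n)" if "k < N n" for n k by (rule yd[OF that])
    fix e' :: real assume e': "0 < e'"
    then have "0 < e' / 2" by simp
    then obtain h0 where h0: "0 < h0" "\<And>n k. h (N n) < h0 \<Longrightarrow> Suc k < N n \<Longrightarrow>
        norm (?v n (Suc k) - ?v n k - h (N n) *\<^sub>R accel (?x n (Suc k)) (?v n (Suc k))) \<le> e' / 2 * h (N n)"
      using con by blast
    have "(\<lambda>n. (1 + Cy) * h (N n)) \<longlonglongrightarrow> 0" "(\<lambda>n. C3 * h (N n)) \<longlonglongrightarrow> 0"
      by (rule tendsto_mult_right_zero[OF hN])+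
    then have "\<forall>\<^sub>F n in sequentially. (1 + Cy) * h (N n) < e'" "\<forall>\<^sub>F n in sequentially. C3 * h (N n) < e' / 2"
      using order_tendstoD(2) e' \<open>0 < e' / 2\<close> by blast+
    then show "\<forall>\<^sub>F n in sequentially. \<forall>k<N n. \<exists>p\<in>D. dist p (real k * h (N n), y n k) \<le> e' \<and>
        norm (y n (Suc k) - y n k - h (N n) *\<^sub>R X p) \<le> e' * h (N n)"
      using order_tendstoD(2)[OF hN h0(1)]
    proof eventually_elim
      case (elim n)
      show ?case
      proof (intro allI impI)
        fix k assume k: "k < N n"
        have zk: "z n (Suc k) - z n k = h (N n) *\<^sub>R ?v n k" using step_vel[OF Npos[of n], of "z n" k] by simp
        show "\<exists>p\<in>D. dist p (real k * h (N n), y n k) \<le> e' \<and>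
          norm (y n (Suc k) - y n k - h (N n) *\<^sub>R X p) \<le> e' * h (N n)"
        proof (cases "Suc k < N n")
          case True
          \<comment> \<open>The discrete equation yields the acceleration at the later grid point,
            so the residual is taken there; in the position component this leaves \<open>h\<close>
            times a velocity jump, of order \<open>h\<^sup>2\<close>.\<close>
          let ?p = "(real (Suc k) * h (N n), y n (Suc k))"
          have pD: "?p \<in> D" unfolding y_def D_iff using xQ[of "Suc k" n] True wR by auto
          have "dist ?p (real k * h (N n), y n k) \<le> norm (real (Suc k) * h (N n) - real k * h (N n)) + norm (y n (Suc k) - y n k)"
            unfolding dist_norm by (simp only: diff_Pair norm_Pair_le)
          also have "\<dots> \<le> h (N n) + Cy * h (N n)"
            using yd[OF k] hp[of n] by (intro add_mono) (auto simp: algebra_simps)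
          also have "\<dots> \<le> e'" using elim(1) by (simp add: algebra_simps)
          finally have 1: "dist ?p (real k * h (N n), y n k) \<le> e'" .
          have "y n (Suc k) - y n k - h (N n) *\<^sub>R X ?p = (h (N n) *\<^sub>R (?v n k - ?v n (Suc k)),
              ?v n (Suc k) - ?v n k - h (N n) *\<^sub>R accel (?x n (Suc k)) (?v n (Suc k)))"
            using True k zk by (simp add: y_def X_def w_def scaleR_diff_right)
          then have "norm (y n (Suc k) - y n k - h (N n) *\<^sub>R X ?p) \<le> norm (h (N n) *\<^sub>R (?v n k - ?v n (Suc k))) +
              norm (?v n (Suc k) - ?v n k - h (N n) *\<^sub>R accel (?x n (Suc k)) (?v n (Suc k)))"
            by (simp only: norm_Pair_le)
          moreover have "norm (h (N n) *\<^sub>R (?v n k - ?v n (Suc k))) = h (N n) * norm (?v n (Suc k) - ?v n k)"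
            using hp[of n] by (simp add: norm_minus_commute)
          moreover have "h (N n) * norm (?v n (Suc k) - ?v n k) \<le> h (N n) * (e' / 2)"
            using vd[OF True] elim(2) hp[of n] by (intro mult_left_mono) auto
          moreover have "h (N n) * (e' / 2) + e' / 2 * h (N n) = e' * h (N n)" by simp
          moreover note h0(2)[OF elim(3) True]
          ultimately have "norm (y n (Suc k) - y n k - h (N n) *\<^sub>R X ?p) \<le> e' * h (N n)" by linarith
          then show ?thesis using 1 by (intro bexI[of _ ?p] conjI pD)
        next
          case False
          then have kN: "k = N n - 1" using k by simp
          \<comment> \<open>The extrapolated last step has residual zero at the grid point
            itself.\<close>
          let ?p = "(real k * h (N n), y n k)"
          have pD: "?p \<in> D" unfolding y_def D_iff using xQ[of k n] k wR by auto
          have "w n (Suc k) - w n k = h (N n) *\<^sub>R accel (?x n k) (?v n k)" "w n k = ?v n k"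
            unfolding w_def kN[symmetric] using False k by simp_all
          then have "y n (Suc k) - y n k - h (N n) *\<^sub>R X ?p = 0"
            by (simp add: y_def X_def zk zero_prod_def)
          then have "norm (y n (Suc k) - y n k - h (N n) *\<^sub>R X ?p) \<le> e' * h (N n)"
            using e' hp[of n] by simp
          moreover have "dist ?p (real k * h (N n), y n k) \<le> e'" using e' by simp
          ultimately show ?thesis by (intro bexI[of _ ?p] conjI pD)
        qed
      qed
    qed
  qed
  note UD = UD'[rule_format] and Ud = Ud'[rule_format] and Ulim = Ulim'[rule_format]
  define zs where "zs t = fst (U t)" for t
  define vs where "vs t = snd (U t)" for t
  have Ueq: "U t = (zs t, vs t)" for t by (simp add: zs_def vs_def)
  have zQ: "(t, zs t) \<in> Q" if "t \<in> {0..T}" for t using UD[OF that] unfolding Ueq D_iff by blast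
  have dz: "(zs has_vector_derivative vs t) (at t within {0..T})" if "t \<in> {0..T}" for t
    using bounded_linear.has_vector_derivative[OF bounded_linear_fst Ud[OF that]]
    by (simp add: X_def zs_def[abs_def] vs_def[abs_def])
  have dv: "(vs has_vector_derivative accel (t, zs t) (vs t)) (at t within {0..T})" if "t \<in> {0..T}" for t
    using bounded_linear.has_vector_derivative[OF bounded_linear_snd Ud[OF that]]
    by (simp add: X_def zs_def[abs_def] vs_def[abs_def])
  have lineq: "line (N n) (z n) t = fst (polygon (h (N n)) (N n) (y n) t)" for n t
    by (simp add: line_def polygon_fst y_def)
  have close: "\<exists>n0. \<forall>n\<ge>n0. \<forall>t\<in>{0..T}. norm (line (N (r n)) (z (r n)) t - zs t) < e'" if e': "0 < e'" for e'
  proof -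
    have le: "norm (fst p) \<le> norm p" for p :: "'a \<times> 'a" by (cases p) (simp add: norm_fst_le)
    obtain n0 where n0: "\<And>n t. n \<ge> n0 \<Longrightarrow> t \<in> {0..T} \<Longrightarrow>
        norm (polygon (h (N (r n))) (N (r n)) (y (r n)) t - U t) < e'"
      using Ulim[OF e'] by blast
    have "norm (line (N (r n)) (z (r n)) t - zs t) < e'" if "n \<ge> n0" "t \<in> {0..T}" for n t
      using le[of "polygon (h (N (r n))) (N (r n)) (y (r n)) t - U t"] n0[OF that]
      by (simp add: lineq zs_def)
    then show ?thesis by blast
  qed
  have ends: "zs 0 = 0" "zs T = e"
  proof -
    have dc: "dist (zs t) c < e'" if c: "\<And>n. line (N n) (z n) t = c" and t: "t \<in> {0..T}" and e': "0 < e'" for t c e'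
    proof -
      obtain n where "norm (line (N (r n)) (z (r n)) t - zs t) < e'" using close[OF e'] t by blast
      then show ?thesis unfolding c by (simp add: dist_norm norm_minus_commute)
    qed
    have zc: "zs t = c" if "\<And>n. line (N n) (z n) t = c" "t \<in> {0..T}" for t c
    proof (rule ccontr)
      assume "zs t \<noteq> c"
      then have "0 < dist (zs t) c" by simp
      from dc[OF that this] show False by simp
    qed
    show "zs 0 = 0" by (rule zc[OF line_ends(1)[OF Npos adm(1)]]) (use T_pos in simp)
    show "zs T = e" by (rule zc[OF line_ends(2)[OF Npos adm(1)]]) (use T_pos in simp)
  qed
  have zcont: "continuous_on {0..T} zs"
    using dz has_vector_derivative_continuous continuous_on_eq_continuous_within by blast
  have hom: "path_homotopic z0 zs"
  proof -
    have "0 < \<epsilon> / 2" using \<epsilon>_pos by simp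
    from close[OF this] obtain n where n: "\<And>t. t \<in> {0..T} \<Longrightarrow> norm (line (N (r n)) (z (r n)) t - zs t) < \<epsilon> / 2"
      by blast
    \<comment> \<open>The limit satisfies the constraint, so it is its own retraction, and one
      sufficiently close polygon passes its class on.\<close>
    have "path_homotopic (\<lambda>t. \<rho> (t, line (N (r n)) (z (r n)) t)) zs"
    proof (rule retract_homotopic[OF line_cont[OF Npos] zcont line_ends[OF Npos adm(1)] ends line_near[OF sm adm]])
      fix t assume t: "t \<in> {0..T}"
      show "norm (zs t - line (N (r n)) (z (r n)) t) \<le> \<epsilon> / 2"
        using n[OF t] by (simp add: norm_minus_commute)
      have "(t, zs t) \<in> nbhd \<epsilon>"
        using zQ[OF t] t \<epsilon>_pos by (auto simp: core_nbhd_def intro!: bexI[of _ "(t, zs t)"])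
      then show "zs t = \<rho> (t, zs t)" using \<rho>_id[of "(t, zs t)"] core_F[OF zQ[OF t]] by simp
    qed auto
    then show ?thesis using good[of "r n"] homotopic_with_trans by (auto simp: good_def)
  qed
  show ?thesis
    by (rule that[of zs vs, OF _ ends _ _ hom]; intro ballI zQ dz dv)
qed

end

context boundary_problem
begin

theorem boundary_solution:
  obtains z v where "\<forall>t\<in>{0..T}. z t \<notin> \<sigma> \<and> F (t, z t) = 0" "z 0 = 0" "z T = e"
    "\<forall>t\<in>{0..T}. (z has_vector_derivative v t) (at t within {0..T})"
    "\<forall>t\<in>{0..T}. (v has_vector_derivative accel (t, z t) (v t)) (at t within {0..T})"
    "path_homotopic z0 z"
proof -
  obtain S where S: "\<And>N. 0 < N \<Longrightarrow> action N (sample N) \<le> S"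
    using sample_action_bounded by blast
  obtain Y R0 \<delta>0 where Y: "0 < Y" "0 < \<delta>0"
    and apriori: "\<forall>N z. 0 < N \<longrightarrow> admissible N z \<longrightarrow> action N z \<le> S \<longrightarrow>
      energy N z \<le> Y \<and> (\<forall>k\<le>N. norm (z k) \<le> R0 \<and> (\<forall>s\<in>\<sigma>. \<delta>0 \<le> norm (z k - s)))"
    by (rule a_priori_bounds[of S])
  have cz: "compact (z0 ` {0..T})" by (rule compact_continuous_image[OF z0_cont compact_Icc])
  obtain R1 where R1: "\<forall>y\<in>z0 ` {0..T}. norm y \<le> R1"
    using compact_imp_bounded[OF cz] unfolding bounded_iff by blast
  have "z0 ` {0..T} \<inter> \<sigma> = {}" using z0_in(1) by blast
  then obtain \<delta>1 where \<delta>1: "0 < \<delta>1" "\<forall>y\<in>z0 ` {0..T}. \<forall>s\<in>\<sigma>. \<delta>1 \<le> dist y s"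
    using separate_compact_closed[OF cz \<sigma>_closed] by blast
  \<comment> \<open>\<open>R\<close> and \<open>\<delta>\<close> are adjusted so that the core
    contains the whole reference path, which the a priori bounds see only at its samples.\<close>
  define R where "R = max R0 R1"
  define \<delta> where "\<delta> = min \<delta>0 \<delta>1"
  have \<delta>: "0 < \<delta>" using Y \<delta>1 by (simp add: \<delta>_def)
  obtain \<epsilon> \<rho> where \<epsilon>: "0 < \<epsilon>" and \<rho>: "continuous_on (core_nbhd R \<delta> \<epsilon>) \<rho>"
    and \<rho>': "\<forall>x\<in>core_nbhd R \<delta> \<epsilon>. F (fst x, \<rho> x) = 0 \<and> \<rho> x \<notin> \<sigma> \<and> (F x = 0 \<longrightarrow> \<rho> x = snd x)"
    by (rule tubular_retraction[OF \<delta>, of R])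
  interpret discretization F F' F'' E \<sigma> g g' a a' V V' K T e C M A C1 P z0 \<Lambda> S Y R \<delta> \<epsilon> \<rho>
  proof unfold_locales
    show "energy N z \<le> Y" if "0 < N" "admissible N z" "action N z \<le> S" for N z
      using apriori that by blast
    show "norm (z k) \<le> R" if "0 < N" "admissible N z" "action N z \<le> S" "k \<le> N" for N z k
    proof -
      have "norm (z k) \<le> R0" using apriori that by blast
      then show ?thesis by (simp add: R_def)
    qed
    show "\<delta> \<le> norm (z k - s)" if "0 < N" "admissible N z" "action N z \<le> S" "k \<le> N" "s \<in> \<sigma>" for N z k s
    proof -
      have "\<delta>0 \<le> norm (z k - s)" using apriori that by blast
      then show ?thesis by (simp add: \<delta>_def)
    qed
    show "(t, z0 t) \<in> core R \<delta>" if t: "t \<in> {0..T}" for t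
    proof -
      have "norm (z0 t) \<le> R1" using R1 t by blast
      then have "norm (z0 t) \<le> R" by (simp add: R_def)
      moreover have "\<delta> \<le> norm (z0 t - s)" if "s \<in> \<sigma>" for s
      proof -
        have "\<delta>1 \<le> dist (z0 t) s" using \<delta>1(2) t that by blast
        then show ?thesis by (simp add: \<delta>_def dist_norm)
      qed
      ultimately show ?thesis using z0_in(2)[OF t] t by (simp add: core_iff)
    qed
    show "F (fst x, \<rho> x) = 0" "\<rho> x \<notin> \<sigma>" if "x \<in> core_nbhd R \<delta> \<epsilon>" for x
      using \<rho>' that by blast+
    show "\<rho> x = snd x" if "x \<in> core_nbhd R \<delta> \<epsilon>" "F x = 0" for x
      using \<rho>' that by blast
  qed (fact S Y(1) \<delta> \<epsilon> \<rho>)+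
  obtain z v where z: "\<forall>t\<in>{0..T}. (t, z t) \<in> core R \<delta>" and ends: "z 0 = 0" "z T = e"
    and d: "\<forall>t\<in>{0..T}. (z has_vector_derivative v t) (at t within {0..T})"
    "\<forall>t\<in>{0..T}. (v has_vector_derivative accel (t, z t) (v t)) (at t within {0..T})"
    and hom: "path_homotopic z0 z"
    by (rule interval_solution)
  have "\<forall>t\<in>{0..T}. z t \<notin> \<sigma> \<and> F (t, z t) = 0"
  proof
    fix t assume "t \<in> {0..T}"
    then have "(t, z t) \<in> core R \<delta>" using z by blast
    then show "z t \<notin> \<sigma> \<and> F (t, z t) = 0" using core_subset[OF \<delta>, of R] core_F by blast
  qed
  then show ?thesis by (rule that[OF _ ends d hom])
qed

end

section \<open>Odd quasi-periodic extension\<close>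

text \<open>
  A path on \<open>[0, T]\<close> from \<open>0\<close> to \<open>e\<close> extends uniquely to an odd curve with
  \<open>z (t + 2 T) = z t + 2 e\<close>. Here \<open>fold_time T\<close> is the distance to the lattice \<open>2 T \<int>\<close>.
\<close>

definition fold_time :: "real \<Rightarrow> real \<Rightarrow> real" where
  "fold_time T t = T / pi * arccos (cos (pi * t / T))"

text \<open>Subtracting the linear part leaves a path that vanishes at both ends; the sign of the
  sine extends it to an odd function of period \<open>2 * T\<close>. Explicit formulas with
  \<open>arccos\<close>, \<open>cos\<close> and \<open>sin\<close> make joint continuity with a
  homotopy parameter accessible.\<close>

definition odd_ext :: "real \<Rightarrow> 'a::real_normed_vector \<Rightarrow> (real \<Rightarrow> 'a) \<Rightarrow> real \<Rightarrow> 'a" where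
  "odd_ext T e u t = (t / T) *\<^sub>R e +
    (if sin (pi * t / T) \<le> 0 then - (u (fold_time T t) - (fold_time T t / T) *\<^sub>R e)
     else u (fold_time T t) - (fold_time T t / T) *\<^sub>R e)"

lemma fold_time_eq:
  assumes "0 < T" "s \<in> {0..T}"
  shows "fold_time T (2 * of_int m * T + s) = s" "fold_time T (2 * of_int m * T - s) = s"
proof -
  have "0 \<le> pi * s / T" "pi * s / T \<le> pi" using assms by (auto simp: field_simps)
  then have acos: "arccos (cos (pi * s / T)) = pi * s / T" by (rule arccos_cos)
  have eq: "pi * (2 * of_int m * T + s) / T = pi * s / T + 2 * pi * of_int m"
    "pi * (2 * of_int m * T - s) / T = - (pi * s / T) + 2 * pi * of_int m"
    using assms(1) by (simp_all add: field_simps)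
  have per: "cos (x + 2 * pi * of_int m) = cos x" for x :: real
    by (simp add: cos_add)
  show "fold_time T (2 * of_int m * T + s) = s" "fold_time T (2 * of_int m * T - s) = s"
    unfolding fold_time_def eq per cos_minus acos using assms(1) by simp_all
qed

lemma sin_grid_shift:
  assumes "0 < T"
  shows "sin (pi * (2 * of_int m * T + s) / T) = sin (pi * s / T)"
    "sin (pi * (2 * of_int m * T - s) / T) = - sin (pi * s / T)"
proof -
  have eq: "pi * (2 * of_int m * T + s) / T = pi * s / T + 2 * pi * of_int m"
    "pi * (2 * of_int m * T - s) / T = - (pi * s / T) + 2 * pi * of_int m"
    using assms(1) by (simp_all add: field_simps)
  have per: "sin (x + 2 * pi * of_int m) = sin x" for x :: real
    by (simp add: sin_add)
  show "sin (pi * (2 * of_int m * T + s) / T) = sin (pi * s / T)"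
    "sin (pi * (2 * of_int m * T - s) / T) = - sin (pi * s / T)"
    unfolding eq per by simp_all
qed

lemma fold_time_symmetry:
  assumes "0 < T"
  shows "fold_time T (2 * of_int m * T + s) = fold_time T s" "fold_time T (2 * of_int m * T - s) = fold_time T s"
proof -
  have eq: "pi * (2 * of_int m * T + s) / T = pi * s / T + 2 * pi * of_int m"
    "pi * (2 * of_int m * T - s) / T = - (pi * s / T) + 2 * pi * of_int m"
    using assms(1) by (simp_all add: field_simps)
  have per: "cos (x + 2 * pi * of_int m) = cos x" for x :: real
    by (simp add: cos_add)
  show "fold_time T (2 * of_int m * T + s) = fold_time T s" "fold_time T (2 * of_int m * T - s) = fold_time T s"
    unfolding fold_time_def eq per cos_minus by simp_all
qed

lemma fold_time_cases:
  fixes T t :: real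
  assumes "0 < T"
  obtains m :: int and s where "s \<in> {0..T}" "t = 2 * of_int m * T + s \<or> t = 2 * of_int m * T - s"
proof -
  \<comment> \<open>The nearest point of the lattice, at distance at most \<open>T\<close>.\<close>
  define m where "m = round (t / (2 * T))"
  have "\<bar>of_int m - t / (2 * T)\<bar> \<le> 1 / 2" unfolding m_def by (rule of_int_round_abs_le)
  then have "\<bar>of_int m - t / (2 * T)\<bar> * (2 * T) \<le> 1 / 2 * (2 * T)"
    using assms by (intro mult_right_mono) auto
  moreover have "\<bar>of_int m - t / (2 * T)\<bar> * (2 * T) = \<bar>(of_int m - t / (2 * T)) * (2 * T)\<bar>"
    using assms by (simp add: abs_mult)
  moreover have "(of_int m - t / (2 * T)) * (2 * T) = 2 * of_int m * T - t"
    using assms by (simp add: field_simps)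
  ultimately have "\<bar>2 * of_int m * T - t\<bar> \<le> T" by simp
  then show ?thesis
    by (intro that[of "\<bar>2 * of_int m * T - t\<bar>" m]) (auto simp: abs_if)
qed

lemma fold_time_in:
  assumes "0 < T"
  shows "fold_time T t \<in> {0..T}"
proof -
  obtain m :: int and s where "s \<in> {0..T}" "t = 2 * of_int m * T + s \<or> t = 2 * of_int m * T - s"
    using fold_time_cases[OF assms] by blast
  then show ?thesis using fold_time_eq[OF assms] by auto
qed

lemma fold_time_cont:
  fixes f :: "'b::t2_space \<Rightarrow> real"
  assumes "T \<noteq> 0" "continuous_on S f"
  shows "continuous_on S (\<lambda>x. fold_time T (f x))"
proof -
  have "continuous_on S (\<lambda>x. pi * f x / T)"
    using assms by (intro continuous_on_divide continuous_on_mult continuous_on_const) auto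
  then have "continuous_on S (\<lambda>x. arccos (cos (pi * f x / T)))"
    by (intro continuous_on_arccos continuous_on_cos) auto
  then show ?thesis unfolding fold_time_def by (rule continuous_on_mult_left)
qed

lemma odd_ext_eq:
  assumes T: "0 < T" and u: "u 0 = 0" "u T = e" and s: "s \<in> {0..T}"
  shows "odd_ext T e u (2 * of_int m * T + s) = (2 * of_int m) *\<^sub>R e + u s"
    and "odd_ext T e u (2 * of_int m * T - s) = (2 * of_int m) *\<^sub>R e - u s"
proof -
  have r: "0 \<le> pi * s / T" "pi * s / T \<le> pi" using s T by (auto simp: field_simps)
  have sin0: "0 \<le> sin (pi * s / T)" by (rule sin_ge_zero[OF r])
  have d: "(2 * of_int m * T + s) / T = 2 * of_int m + s / T" "(2 * of_int m * T - s) / T = 2 * of_int m - s / T"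
    using T by (simp_all add: field_simps)
  have zero: "u s = (s / T) *\<^sub>R e" if "sin (pi * s / T) = 0"
  proof -
    have "s = 0 \<or> s = T"
    proof (rule ccontr)
      assume "\<not> ?thesis"
      then have "0 < pi * s / T" "pi * s / T < pi" using s T by (auto simp: field_simps)
      then have "0 < sin (pi * s / T)" by (rule sin_gt_zero)
      then show False using that by simp
    qed
    then show ?thesis using u T by auto
  qed
  show "odd_ext T e u (2 * of_int m * T + s) = (2 * of_int m) *\<^sub>R e + u s"
    unfolding odd_ext_def fold_time_eq[OF T s] sin_grid_shift[OF T] d
    using sin0 zero by (cases "sin (pi * s / T) = 0") (auto simp: scaleR_left_distrib)
  show "odd_ext T e u (2 * of_int m * T - s) = (2 * of_int m) *\<^sub>R e - u s"
    unfolding odd_ext_def fold_time_eq[OF T s] sin_grid_shift[OF T] d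
    using sin0 by (simp add: scaleR_left_diff_distrib)
qed

lemma odd_ext_minus:
  assumes "0 < T" "u 0 = 0" "u T = e"
  shows "odd_ext T e u (- t) = - odd_ext T e u t"
proof -
  obtain m :: int and s where s: "s \<in> {0..T}" and t: "t = 2 * of_int m * T + s \<or> t = 2 * of_int m * T - s"
    using fold_time_cases[OF assms(1)] by blast
  have "2 * of_int (- m) * T - s = - (2 * of_int m * T + s)" "2 * of_int (- m) * T + s = - (2 * of_int m * T - s)"
    by simp_all
  then show ?thesis
    using t odd_ext_eq[OF assms s, of m] odd_ext_eq[OF assms s, of "- m"] by auto
qed

lemma odd_ext_shift:
  assumes "0 < T" "u 0 = 0" "u T = e"
  shows "odd_ext T e u (t + 2 * of_int k * T) = odd_ext T e u t + (2 * of_int k) *\<^sub>R e"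
proof -
  obtain m :: int and s where s: "s \<in> {0..T}" and t: "t = 2 * of_int m * T + s \<or> t = 2 * of_int m * T - s"
    using fold_time_cases[OF assms(1)] by blast
  from t show ?thesis
  proof
    assume t: "t = 2 * of_int m * T + s"
    have eq: "t + 2 * of_int k * T = 2 * of_int (m + k) * T + s" by (simp add: t algebra_simps)
    show ?thesis unfolding eq odd_ext_eq[OF assms s] unfolding t odd_ext_eq[OF assms s]
      by (simp add: scaleR_left_distrib distrib_left)
  next
    assume t: "t = 2 * of_int m * T - s"
    have eq: "t + 2 * of_int k * T = 2 * of_int (m + k) * T - s" by (simp add: t algebra_simps)
    show ?thesis unfolding eq odd_ext_eq[OF assms s] unfolding t odd_ext_eq[OF assms s]
      by (simp add: scaleR_left_distrib distrib_left)
  qed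
qed

text \<open>Applied to the given odd curve, which is thereby recovered from its restriction to
  \<open>[0, T]\<close>.\<close>

lemma odd_ext_unique:
  assumes "0 < T" "u 0 = 0" "u T = e" and u: "\<And>t. t \<in> {0..T} \<Longrightarrow> u t = w t"
    and w: "\<And>t. w (- t) = - w t" "\<And>t. w (t + 2 * T) = w t + 2 *\<^sub>R e"
  shows "odd_ext T e u = w"
proof
  fix t
  have nat: "w (t + 2 * real n * T) = w t + (2 * real n) *\<^sub>R e" for n t
  proof (induction n)
    case (Suc n)
    have "t + 2 * real (Suc n) * T = (t + 2 * real n * T) + 2 * T" by (simp add: algebra_simps)
    then have "w (t + 2 * real (Suc n) * T) = w (t + 2 * real n * T) + 2 *\<^sub>R e" by (metis w(2))
    also have "\<dots> = w t + ((2 * real n) *\<^sub>R e + 2 *\<^sub>R e)" unfolding Suc by (rule add.assoc)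
    also have "(2 * real n) *\<^sub>R e + 2 *\<^sub>R e = (2 * real (Suc n)) *\<^sub>R e"
      unfolding scaleR_left_distrib[symmetric] by simp
    finally show ?case .
  qed simp
  have int: "w (t + 2 * of_int k * T) = w t + (2 * of_int k) *\<^sub>R e" for k t
  proof (cases "0 \<le> k")
    case True
    then show ?thesis using nat[of t "nat k"] by simp
  next
    case False
    then have "w ((t + 2 * of_int k * T) + 2 * real (nat (- k)) * T) = w (t + 2 * of_int k * T) - (2 * of_int k) *\<^sub>R e"
      by (subst nat) simp
    moreover have "(t + 2 * of_int k * T) + 2 * real (nat (- k)) * T = t" using False by simp
    ultimately show ?thesis by simp
  qed
  obtain m :: int and s where s: "s \<in> {0..T}" and t: "t = 2 * of_int m * T + s \<or> t = 2 * of_int m * T - s"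
    using fold_time_cases[OF assms(1)] by blast
  have "2 * of_int m * T + s = s + 2 * of_int m * T" "2 * of_int m * T - s = - s + 2 * of_int m * T" by simp_all
  then have "w (2 * of_int m * T + s) = u s + (2 * of_int m) *\<^sub>R e"
    "w (2 * of_int m * T - s) = - u s + (2 * of_int m) *\<^sub>R e"
    by (simp_all only: int w(1) u[OF s])
  then show "odd_ext T e u t = w t" using t odd_ext_eq[OF assms(1-3) s, of m] by auto
qed

lemma odd_ext_cont:
  fixes H :: "'b::t2_space \<Rightarrow> real \<Rightarrow> 'a::real_normed_vector"
  assumes T: "0 < T" and H: "continuous_on (A \<times> {0..T}) (\<lambda>p. H (fst p) (snd p))"
    and ends: "\<And>r. r \<in> A \<Longrightarrow> H r 0 = 0" "\<And>r. r \<in> A \<Longrightarrow> H r T = e"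
  shows "continuous_on (A \<times> UNIV) (\<lambda>p. odd_ext T e (H (fst p)) (snd p))"
proof -
  let ?d = "\<lambda>p. H (fst p) (fold_time T (snd p)) - (fold_time T (snd p) / T) *\<^sub>R e"
  have ft: "continuous_on S (\<lambda>p. fold_time T (snd p))" for S :: "('b \<times> real) set"
    using T by (intro fold_time_cont continuous_on_snd continuous_on_id) auto
  have d: "continuous_on (A \<times> UNIV) ?d"
  proof (intro continuous_on_diff continuous_on_scaleR continuous_on_divide continuous_on_const ft)
    show "continuous_on (A \<times> UNIV) (\<lambda>p. H (fst p) (fold_time T (snd p)))"
      using continuous_on_compose2[OF H, of "A \<times> UNIV" "\<lambda>p. (fst p, fold_time T (snd p))"]
        fold_time_in[OF T] by (force intro!: continuous_on_Pair continuous_on_fst continuous_on_id ft)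
  qed (use T in auto)
  have c: "continuous_on (A \<times> UNIV) (\<lambda>p. if sin (pi * snd p / T) \<le> 0 then - ?d p else ?d p)"
  proof (rule continuous_on_cases_le)
    show "continuous_on {x \<in> A \<times> UNIV. sin (pi * snd x / T) \<le> 0} (\<lambda>p. - ?d p)"
      by (rule continuous_on_subset[OF continuous_on_minus[OF d]]) auto
    show "continuous_on {x \<in> A \<times> UNIV. 0 \<le> sin (pi * snd x / T)} ?d"
      by (rule continuous_on_subset[OF d]) auto
    show "continuous_on (A \<times> UNIV) (\<lambda>p. sin (pi * snd p / T))"
      using T by (intro continuous_on_sin continuous_on_divide continuous_on_mult continuous_on_const
          continuous_on_snd continuous_on_id) auto
    \<comment> \<open>Where the sine vanishes the folded time is 0 or \<open>T\<close>; there the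
      path equals its linear part, so the two branches agree.\<close>
    fix p assume p: "p \<in> A \<times> UNIV" "sin (pi * snd p / T) = 0"
    have "cos (pi * snd p / T) = 1 \<or> cos (pi * snd p / T) = -1"
      using sin_cos_squared_add[of "pi * snd p / T"] p(2) by (simp add: power2_eq_1_iff)
    then have "fold_time T (snd p) = 0 \<or> fold_time T (snd p) = T" by (auto simp: fold_time_def)
    then have "?d p = 0" using ends p(1) T by auto
    then show "- ?d p = ?d p" by simp
  qed
  have "continuous_on (A \<times> UNIV) (\<lambda>p. (snd p / T) *\<^sub>R e)"
    using T by (intro continuous_on_scaleR continuous_on_divide continuous_on_const continuous_on_snd continuous_on_id) auto
  then show ?thesis unfolding odd_ext_def using c by (rule continuous_on_add)
qed

lemma has_vector_derivative_within_union:
  assumes "(f has_vector_derivative d) (at x within A)" "(f has_vector_derivative d) (at x within B)"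
  shows "(f has_vector_derivative d) (at x within A \<union> B)"
proof -
  have lim: "((\<lambda>y. norm (f y - f x - (y - x) *\<^sub>R d) / norm (y - x)) \<longlongrightarrow> 0) (at x within S)"
    if "(f has_vector_derivative d) (at x within S)" for S
    using that unfolding has_vector_derivative_def has_derivative_iff_norm by simp
  show ?thesis
    unfolding has_vector_derivative_def has_derivative_iff_norm
    by (intro conjI bounded_linear_scaleR_left Lim_Un[OF lim[OF assms(1)] lim[OF assms(2)]])
qed

text \<open>
  The derivative of an odd quasi-periodic \<open>f\<close> and an even periodic \<open>f'\<close> need only be checked on \<open>[0, T]\<close>,
  and one-sidedly at its ends: the reflected and shifted copies of the interval cover the line.
\<close>

lemma has_vector_derivative_by_symmetry:
  fixes f :: "real \<Rightarrow> 'a::real_normed_vector"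
  assumes T: "0 < T"
    and base: "\<And>t. t \<in> {0..T} \<Longrightarrow> (f has_vector_derivative d t) (at t within {0..T})"
    and plus: "\<And>(m::int) t. \<exists>c. \<forall>s. f (2 * of_int m * T + s) = c + f s"
    and minus: "\<And>(m::int) t. \<exists>c. \<forall>s. f (2 * of_int m * T - s) = c + \<kappa> *\<^sub>R f s"
    and dplus: "\<And>(m::int) t. t \<in> {0..T} \<Longrightarrow> d (2 * of_int m * T + t) = d t"
    and dminus: "\<And>(m::int) t. t \<in> {0..T} \<Longrightarrow> d (2 * of_int m * T - t) = - \<kappa> *\<^sub>R d t"
  shows "(f has_vector_derivative d t) (at t)"
proof -
  have P: "(f has_vector_derivative d t) (at t within {2 * of_int m * T..2 * of_int m * T + T})"
    if t: "t \<in> {2 * of_int m * T..2 * of_int m * T + T}" for m :: int and t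
  proof -
    obtain c where c: "\<And>s. f (2 * of_int m * T + s) = c + f s" using plus[of m] by blast
    have im: "(\<lambda>y. y - 2 * of_int m * T) ` {2 * of_int m * T..2 * of_int m * T + T} \<subseteq> {0..T}" by auto
    have s: "t - 2 * of_int m * T \<in> {0..T}" using t by auto
    have "((f \<circ> (\<lambda>y. y - 2 * of_int m * T)) has_vector_derivative (1 *\<^sub>R d (t - 2 * of_int m * T)))
        (at t within {2 * of_int m * T..2 * of_int m * T + T})"
      by (rule vector_diff_chain_within[OF _ has_vector_derivative_within_subset[OF base[OF s] im]])
         (auto intro!: derivative_eq_intros)
    then have "((\<lambda>y. c + (f \<circ> (\<lambda>y. y - 2 * of_int m * T)) y) has_vector_derivative (0 + 1 *\<^sub>R d (t - 2 * of_int m * T)))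
        (at t within {2 * of_int m * T..2 * of_int m * T + T})"
      by (intro has_vector_derivative_add has_vector_derivative_const)
    moreover have "(\<lambda>y. c + (f \<circ> (\<lambda>y. y - 2 * of_int m * T)) y) = f"
    proof
      show "c + (f \<circ> (\<lambda>y. y - 2 * of_int m * T)) y = f y" for y
        using c[of "y - 2 * of_int m * T"] by simp
    qed
    moreover have "d (t - 2 * of_int m * T) = d t" using dplus[OF s, of m] by simp
    ultimately show ?thesis by simp
  qed
  have M: "(f has_vector_derivative d t) (at t within {2 * of_int m * T - T..2 * of_int m * T})"
    if t: "t \<in> {2 * of_int m * T - T..2 * of_int m * T}" for m :: int and t
  proof -
    obtain c where c: "\<And>s. f (2 * of_int m * T - s) = c + \<kappa> *\<^sub>R f s" using minus[of m] by blast
    have im: "(\<lambda>y. 2 * of_int m * T - y) ` {2 * of_int m * T - T..2 * of_int m * T} \<subseteq> {0..T}" by auto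
    have s: "2 * of_int m * T - t \<in> {0..T}" using t by auto
    have "((f \<circ> (\<lambda>y. 2 * of_int m * T - y)) has_vector_derivative ((- 1) *\<^sub>R d (2 * of_int m * T - t)))
        (at t within {2 * of_int m * T - T..2 * of_int m * T})"
      by (rule vector_diff_chain_within[OF _ has_vector_derivative_within_subset[OF base[OF s] im]])
         (auto intro!: derivative_eq_intros)
    then have "((\<lambda>y. c + \<kappa> *\<^sub>R (f \<circ> (\<lambda>y. 2 * of_int m * T - y)) y) has_vector_derivative
        (0 + \<kappa> *\<^sub>R ((- 1) *\<^sub>R d (2 * of_int m * T - t)))) (at t within {2 * of_int m * T - T..2 * of_int m * T})"
      by (intro has_vector_derivative_add has_vector_derivative_const
          bounded_linear.has_vector_derivative[OF bounded_linear_scaleR_right])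
    moreover have "(\<lambda>y. c + \<kappa> *\<^sub>R (f \<circ> (\<lambda>y. 2 * of_int m * T - y)) y) = f"
    proof
      show "c + \<kappa> *\<^sub>R (f \<circ> (\<lambda>y. 2 * of_int m * T - y)) y = f y" for y
        using c[of "2 * of_int m * T - y"] by simp
    qed
    moreover have "- \<kappa> *\<^sub>R d (2 * of_int m * T - t) = d t" using dminus[OF s, of m] by simp
    ultimately show ?thesis by simp
  qed
  obtain m :: int and s where s: "s \<in> {0..T}" and t: "t = 2 * of_int m * T + s \<or> t = 2 * of_int m * T - s"
    using fold_time_cases[OF T] by blast
  have int: "(f has_vector_derivative d t) (at t)"
    if "(f has_vector_derivative d t) (at t within {a..b})" "a < t" "t < b" for a b
    using that by (simp add: at_within_Icc_at)
  define p where "p = 2 * of_int m * T"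
  have "p - T \<le> t" "t \<le> p + T" using s t by (auto simp: p_def)
  \<comment> \<open>At the three junctions the one-sided derivatives of two neighbouring copies are
    glued; elsewhere \<open>t\<close> is interior to one copy. At \<open>p + T\<close> and
    \<open>p - T\<close> the neighbouring copy belongs to the lattice index \<open>m + 1\<close> and
    \<open>m - 1\<close>.\<close>
  then have "t = p \<or> t = p + T \<or> t = p - T \<or> (p < t \<and> t < p + T) \<or> (p - T < t \<and> t < p)" by linarith
  then consider "t = p" | "t = p + T" | "t = p - T" | "p < t" "t < p + T" | "p - T < t" "t < p" by blast
  then show ?thesis
  proof cases
    case 1
    have "(f has_vector_derivative d t) (at t within {p - T..p} \<union> {p..p + T})"
      using P[of t m] M[of t m] 1 T unfolding p_def
      by (intro has_vector_derivative_within_union) auto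
    moreover have "{p - T..p} \<union> {p..p + T} = {p - T..p + T}" using T by auto
    ultimately show ?thesis using int[of "p - T" "p + T"] 1 T by simp
  next
    case 2
    have eq: "2 * of_int (m + 1) * T = p + T + T" by (simp add: p_def algebra_simps)
    have eq': "p + T + T - T = p + T" by simp
    have A: "(f has_vector_derivative d t) (at t within {p..p + T})"
      by (rule P[of t m, folded p_def]) (use 2 T in auto)
    have B: "(f has_vector_derivative d t) (at t within {p + T..p + T + T})"
      by (rule M[of t "m + 1", unfolded eq eq']) (use 2 T in auto)
    note has_vector_derivative_within_union[OF A B]
    moreover have "{p..p + T} \<union> {p + T..p + T + T} = {p..p + T + T}" using T by auto
    ultimately show ?thesis using int[of p "p + T + T"] 2 T by simp
  next
    case 3
    have eq: "2 * of_int (m - 1) * T = p - T - T" by (simp add: p_def algebra_simps)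
    have eq': "p - T - T + T = p - T" by simp
    have A: "(f has_vector_derivative d t) (at t within {p - T - T..p - T})"
      by (rule P[of t "m - 1", unfolded eq eq']) (use 3 T in auto)
    have B: "(f has_vector_derivative d t) (at t within {p - T..p})"
      by (rule M[of t m, folded p_def]) (use 3 T in auto)
    note has_vector_derivative_within_union[OF A B]
    moreover have "{p - T - T..p - T} \<union> {p - T..p} = {p - T - T..p}" using T by auto
    ultimately show ?thesis using int[of "p - T - T" p] 3 T by simp
  next
    case 4
    then show ?thesis using P[of t m] int[of p "p + T"] unfolding p_def by auto
  next
    case 5
    then show ?thesis using M[of t m] int[of "p - T" p] unfolding p_def by auto
  qed
qed

lemma derivative_affine_symmetry:
  fixes f :: "'a::real_normed_vector \<Rightarrow> 'b::real_normed_vector"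
  assumes "open U" "x \<in> U"
    and fx: "(f has_derivative f') (at x)" and fy: "(f has_derivative f'') (at (\<iota> *\<^sub>R x + b))"
    and sym: "\<And>x. x \<in> U \<Longrightarrow> f (\<iota> *\<^sub>R x + b) = \<kappa> *\<^sub>R f x"
  shows "f'' (\<iota> *\<^sub>R \<xi>) = \<kappa> *\<^sub>R f' \<xi>"
proof -
  have "((\<lambda>x. f (\<iota> *\<^sub>R x + b)) has_derivative (\<lambda>\<xi>. f'' (\<iota> *\<^sub>R \<xi>))) (at x)"
    by (rule has_derivative_compose[where f = "\<lambda>x. \<iota> *\<^sub>R x + b", OF _ fy]) (auto intro!: derivative_eq_intros)
  then have 1: "((\<lambda>x. \<kappa> *\<^sub>R f x) has_derivative (\<lambda>\<xi>. f'' (\<iota> *\<^sub>R \<xi>))) (at x)"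
    by (rule has_derivative_transform_within_open[OF _ assms(1,2)]) (simp add: sym)
  have 2: "((\<lambda>x. \<kappa> *\<^sub>R f x) has_derivative (\<lambda>\<xi>. \<kappa> *\<^sub>R f' \<xi>)) (at x)"
    by (rule has_derivative_scaleR_right[OF fx])
  show ?thesis using has_derivative_unique[OF 1 2] by metis
qed

section \<open>Symmetric systems\<close>

context mechanical_system
begin

text \<open>Covers the reflection, with \<open>\<iota> = -1\<close>, and the shift, with
  \<open>\<iota> = 1\<close>, at once. That \<open>F\<close> is multiplied by \<open>\<iota>\<close>
  says, for the reflection, that the constraint functions are odd.\<close>

definition invariant :: "real \<Rightarrow> real \<times> 'a \<Rightarrow> bool" where
  "invariant \<iota> b \<longleftrightarrow> \<iota> * \<iota> = 1 \<and>
    (\<forall>x. snd x \<notin> \<sigma> \<longrightarrow> snd (\<iota> *\<^sub>R x + b) \<notin> \<sigma> \<and> g (\<iota> *\<^sub>R x + b) = g x \<and> a (\<iota> *\<^sub>R x + b) = a x \<and> V (\<iota> *\<^sub>R x + b) = V x) \<and>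
    (\<forall>x. F (\<iota> *\<^sub>R x + b) = \<iota> *\<^sub>R F x)"

lemma invariantD:
  assumes "invariant \<iota> b"
  shows "\<iota> * \<iota> = 1" "F (\<iota> *\<^sub>R x + b) = \<iota> *\<^sub>R F x"
    "snd x \<notin> \<sigma> \<Longrightarrow> snd (\<iota> *\<^sub>R x + b) \<notin> \<sigma>" "snd x \<notin> \<sigma> \<Longrightarrow> g (\<iota> *\<^sub>R x + b) = g x"
    "snd x \<notin> \<sigma> \<Longrightarrow> a (\<iota> *\<^sub>R x + b) = a x" "snd x \<notin> \<sigma> \<Longrightarrow> V (\<iota> *\<^sub>R x + b) = V x"
  using assms unfolding invariant_def by blast+

lemma invariant_comp:
  assumes "invariant \<iota> b" "invariant \<iota>' b'"
  shows "invariant (\<iota> * \<iota>') (\<iota> *\<^sub>R b' + b)"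
proof -
  have eq: "(\<iota> * \<iota>') *\<^sub>R x + (\<iota> *\<^sub>R b' + b) = \<iota> *\<^sub>R (\<iota>' *\<^sub>R x + b') + b" for x
    by (simp add: scaleR_add_right)
  have one: "(\<iota> * \<iota>') * (\<iota> * \<iota>') = 1"
    using assms unfolding invariant_def by (metis mult.left_commute mult.assoc mult.right_neutral)
  show ?thesis
    unfolding invariant_def eq
  proof (intro conjI allI impI one)
    fix x :: "real \<times> 'a"
    show "F (\<iota> *\<^sub>R (\<iota>' *\<^sub>R x + b') + b) = (\<iota> * \<iota>') *\<^sub>R F x"
      unfolding invariantD(2)[OF assms(1)] invariantD(2)[OF assms(2)] by (rule scaleR_scaleR)
    assume x: "snd x \<notin> \<sigma>"
    note x' = invariantD(3)[OF assms(2) x]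
    show "snd (\<iota> *\<^sub>R (\<iota>' *\<^sub>R x + b') + b) \<notin> \<sigma>" by (rule invariantD(3)[OF assms(1) x'])
    show "g (\<iota> *\<^sub>R (\<iota>' *\<^sub>R x + b') + b) = g x" "a (\<iota> *\<^sub>R (\<iota>' *\<^sub>R x + b') + b) = a x"
      "V (\<iota> *\<^sub>R (\<iota>' *\<^sub>R x + b') + b) = V x"
      using invariantD(4-6)[OF assms(1) x'] invariantD(4-6)[OF assms(2) x] by (simp_all only:)
  qed
qed

lemma invariant_shifts:
  assumes "invariant 1 c" "invariant (- 1) 0"
  shows "invariant 1 (of_int m *\<^sub>R c)" "invariant (- 1) (of_int m *\<^sub>R c)"
proof -
  have id: "invariant 1 0" by (simp add: invariant_def)
  \<comment> \<open>Conjugation by the reflection inverts the shift.\<close>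
  have neg: "invariant 1 (- c)"
    using invariant_comp[OF invariant_comp[OF assms(2,1)] assms(2)] by simp
  have nat: "invariant 1 (real n *\<^sub>R d)" if "invariant 1 d" for n d
  proof (induction n)
    case 0 then show ?case using id by simp
  next
    case (Suc n)
    then show ?case using invariant_comp[OF that Suc] by (simp add: scaleR_left_distrib add.commute)
  qed
  show 1: "invariant 1 (of_int m *\<^sub>R c)"
  proof (cases "0 \<le> m")
    case True
    then show ?thesis using nat[OF assms(1), of "nat m"] by simp
  next
    case False
    then show ?thesis using nat[OF neg, of "nat (- m)"] by simp
  qed
  show "invariant (- 1) (of_int m *\<^sub>R c)" using invariant_comp[OF 1 assms(2)] by simp
qed

text \<open>Time and position are both multiplied by \<open>\<iota>\<close>, so velocities are
  unchanged and accelerations change by \<open>\<iota>\<close>. In the linear system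
  \<open>g\<close>, \<open>B\<close> and \<open>Bt\<close> are unchanged, while each component of
  \<open>force\<close> gains a factor \<open>\<iota>\<close>.\<close>

lemma response_invariant:
  assumes inv: "invariant \<iota> b" and x: "snd x \<notin> \<sigma>" "F x = 0"
  shows "response (\<iota> *\<^sub>R x + b) v = \<iota> *\<^sub>R response x v"
proof -
  have \<iota>: "\<iota> * \<iota> = 1" and sym: "\<And>x. snd x \<notin> \<sigma> \<Longrightarrow> snd (\<iota> *\<^sub>R x + b) \<notin> \<sigma>"
    "\<And>x. snd x \<notin> \<sigma> \<Longrightarrow> g (\<iota> *\<^sub>R x + b) = g x" "\<And>x. snd x \<notin> \<sigma> \<Longrightarrow> a (\<iota> *\<^sub>R x + b) = a x"
    "\<And>x. snd x \<notin> \<sigma> \<Longrightarrow> V (\<iota> *\<^sub>R x + b) = V x" and Fs: "\<And>x. F (\<iota> *\<^sub>R x + b) = \<iota> *\<^sub>R F x"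
    using inv unfolding invariant_def by blast+
  let ?y = "\<iota> *\<^sub>R x + b"
  have xO: "x \<in> \<Omega>" and y: "snd ?y \<notin> \<sigma>" "F ?y = 0" using x sym(1)[OF x(1)] Fs[of x] by (simp_all add: mem_Times_iff)
  have flip: "f' \<xi> = \<iota> *\<^sub>R f'' \<xi>"
    if "\<And>\<xi>. f' (\<iota> *\<^sub>R \<xi>) = 1 *\<^sub>R f'' \<xi>" "linear f''" for f' f'' :: "real \<times> 'a \<Rightarrow> 'c::real_vector" and \<xi>
    using that(1)[of "\<iota> *\<^sub>R \<xi>"] linear_scale[OF that(2), of \<iota> \<xi>] by (simp add: \<iota>)
  have g1: "g' ?y \<xi> = \<iota> *\<^sub>R g' x \<xi>" for \<xi>
  proof (rule flip)
    show "g' ?y (\<iota> *\<^sub>R \<xi>) = 1 *\<^sub>R g' x \<xi>" for \<xi>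
      by (rule derivative_affine_symmetry[OF open_\<Omega> xO g_deriv[OF x(1)] g_deriv[OF y(1)]])
         (simp add: mem_Times_iff sym)
  qed (simp add: blinfun.bounded_linear_right bounded_linear.linear)
  have a1: "a' ?y \<xi> = \<iota> *\<^sub>R a' x \<xi>" for \<xi>
  proof (rule flip)
    show "a' ?y (\<iota> *\<^sub>R \<xi>) = 1 *\<^sub>R a' x \<xi>" for \<xi>
      by (rule derivative_affine_symmetry[OF open_\<Omega> xO a_deriv[OF x(1)] a_deriv[OF y(1)]])
         (simp add: mem_Times_iff sym)
  qed (simp add: blinfun.bounded_linear_right bounded_linear.linear)
  have V1: "V' ?y \<xi> = \<iota> *\<^sub>R V' x \<xi>" for \<xi>
  proof (rule flip)
    show "V' ?y (\<iota> *\<^sub>R \<xi>) = 1 *\<^sub>R V' x \<xi>" for \<xi>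
      by (rule derivative_affine_symmetry[OF open_\<Omega> xO V_deriv[OF x(1)] V_deriv[OF y(1)]])
         (simp add: mem_Times_iff sym)
  qed (simp add: blinfun.bounded_linear_right bounded_linear.linear)
  have F1: "F' (\<iota> *\<^sub>R x + b) = 1 *\<^sub>R F' x" for x
  proof (rule blinfun_eqI)
    fix \<xi>
    have "F' (\<iota> *\<^sub>R x + b) (\<iota> *\<^sub>R (\<iota> *\<^sub>R \<xi>)) = \<iota> *\<^sub>R F' x (\<iota> *\<^sub>R \<xi>)"
      by (rule derivative_affine_symmetry[OF open_UNIV UNIV_I F_deriv F_deriv Fs])
    then show "F' (\<iota> *\<^sub>R x + b) \<xi> = (1 *\<^sub>R F' x) \<xi>" by (simp add: \<iota> blinfun.scaleR_right)
  qed
  have F2: "F'' ?y \<xi> = \<iota> *\<^sub>R F'' x \<xi>" for \<xi>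
  proof (rule flip)
    show "F'' ?y (\<iota> *\<^sub>R \<xi>) = 1 *\<^sub>R F'' x \<xi>" for \<xi>
      by (rule derivative_affine_symmetry[OF open_UNIV UNIV_I F'_deriv F'_deriv F1])
  qed (simp add: blinfun.bounded_linear_right bounded_linear.linear)
  have B1: "B ?y = B x" "Bt ?y = Bt x" by (auto simp: B_def Bt_def F1)
  have L1: "Lz ?y v = \<iota> *\<^sub>R Lz x v"
    unfolding Lz_def scaleR_sum_right scaleR_scaleR g1 a1 V1
    by (rule sum.cong) (simp_all add: blinfun.scaleR_left algebra_simps)
  have f1: "force ?y v = \<iota> *\<^sub>R force x v"
    unfolding force_def L1 g1 a1 F2 by (simp add: blinfun.scaleR_left scaleR_diff_right)
  have s1: "saddle ?y p = saddle x p" for p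
    unfolding saddle_def B1 sym(2)[OF x(1)] ..
  have "saddle ?y (\<iota> *\<^sub>R response x v) = \<iota> *\<^sub>R saddle x (response x v)"
    unfolding s1 by (rule linear_scale[OF linear_saddle])
  also have "saddle x (response x v) = force x v" using response_unique[OF x, of "response x v" v] by simp
  finally have "saddle ?y (\<iota> *\<^sub>R response x v) = force ?y v" unfolding f1 .
  then show ?thesis using response_unique[OF y, of "\<iota> *\<^sub>R response x v" v] by simp
qed

lemma accel_invariant:
  assumes "invariant \<iota> b" "snd x \<notin> \<sigma>" "F x = 0"
  shows "accel (\<iota> *\<^sub>R x + b) v = \<iota> *\<^sub>R accel x v"
  using response_invariant[OF assms] by (simp add: accel_def)

text \<open>The first equation of motion turned back into the derivative of the momentum
  \<open>g v + a\<close>, the form in which \<open>is_solution\<close> asks for it.\<close>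

lemma momentum_derivative:
  assumes "snd (t, z t) \<notin> \<sigma>" "F (t, z t) = 0"
    and z: "(z has_vector_derivative v t) (at t)"
    and v: "(v has_vector_derivative accel (t, z t) (v t)) (at t)"
  shows "((\<lambda>s. g (s, z s) (v s) + a (s, z s)) has_vector_derivative
    Lz (t, z t) (v t) + Bt (t, z t) (multiplier (t, z t) (v t))) (at t)"
proof -
  let ?x = "(t, z t)"
  have X: "((\<lambda>s. (s, z s)) has_derivative (\<lambda>r. r *\<^sub>R (1, v t))) (at t)"
    using has_derivative_Pair[OF has_derivative_ident z[unfolded has_vector_derivative_def]] by simp
  have gX: "((\<lambda>s. g (s, z s)) has_derivative (\<lambda>r. g' ?x (r *\<^sub>R (1, v t)))) (at t)"
    by (rule has_derivative_compose[OF X g_deriv[OF assms(1)]])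
  have aX: "((\<lambda>s. a (s, z s)) has_derivative (\<lambda>r. a' ?x (r *\<^sub>R (1, v t)))) (at t)"
    by (rule has_derivative_compose[OF X a_deriv[OF assms(1)]])
  have "((\<lambda>s. g (s, z s) (v s) + a (s, z s)) has_derivative
      (\<lambda>r. (g ?x (r *\<^sub>R accel ?x (v t)) + g' ?x (r *\<^sub>R (1, v t)) (v t)) + a' ?x (r *\<^sub>R (1, v t)))) (at t)"
    by (rule has_derivative_add[OF blinfun.FDERIV[OF gX v[unfolded has_vector_derivative_def]] aX])
  moreover have "(g ?x (r *\<^sub>R accel ?x (v t)) + g' ?x (r *\<^sub>R (1, v t)) (v t)) + a' ?x (r *\<^sub>R (1, v t))
     = r *\<^sub>R (g ?x (accel ?x (v t)) + g' ?x (1, v t) (v t) + a' ?x (1, v t))" for r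
    unfolding blinfun.scaleR_right blinfun.scaleR_left scaleR_add_right ..
  moreover have "g ?x (accel ?x (v t)) + g' ?x (1, v t) (v t) + a' ?x (1, v t)
      = Lz ?x (v t) + Bt ?x (multiplier ?x (v t))"
    using equations_of_motion(1)[OF assms(1,2), of "v t"] by (simp add: algebra_simps)
  ultimately show ?thesis unfolding has_vector_derivative_def by (simp only:)
qed

lemma has_derivative_L_velocity:
  assumes "snd x \<notin> \<sigma>"
  shows "(L x has_derivative (\<lambda>u. (g x w + a x) \<bullet> u)) (at w)"
  using has_derivative_L[OF has_derivative_const[of x] has_derivative_ident, of w] assms
  by (simp add: blinfun.zero_left blinfun.zero_right)

lemma has_derivative_L_position:
  assumes "y \<notin> \<sigma>"
  shows "((\<lambda>y. L (t, y) w) has_derivative (\<lambda>u. Lz (t, y) w \<bullet> u)) (at y)"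
  using has_derivative_L[OF has_derivative_Pair[OF has_derivative_const[of t] has_derivative_ident]
      has_derivative_const[of w], of y] assms
  by (simp add: inner_Lz)

end

context boundary_problem
begin

lemma grid_of_int_invariant:
  assumes inv: "invariant 1 (2 * T, 2 *\<^sub>R e)" "invariant (- 1) 0"
  shows "invariant 1 (2 * of_int m * T, (2 * of_int m) *\<^sub>R e)"
    and "invariant (- 1) (2 * of_int m * T, (2 * of_int m) *\<^sub>R e)"
  using invariant_shifts[OF inv, of m] by (simp_all add: ac_simps)

lemma odd_ext_in_constraint:
  assumes inv: "invariant 1 (2 * T, 2 *\<^sub>R e)" "invariant (- 1) 0"
    and ends: "p 0 = 0" "p T = e"
    and base: "\<And>t. t \<in> {0..T} \<Longrightarrow> p t \<notin> \<sigma>" "\<And>t. t \<in> {0..T} \<Longrightarrow> F (t, p t) = 0"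
  shows "odd_ext T e p t \<notin> \<sigma> \<and> F (t, odd_ext T e p t) = 0"
proof -
  obtain m :: int and s where s: "s \<in> {0..T}" and t: "t = 2 * of_int m * T + s \<or> t = 2 * of_int m * T - s"
    using fold_time_cases[OF T_pos] by blast
  from t show ?thesis
  proof
    assume t: "t = 2 * of_int m * T + s"
    have "(t, odd_ext T e p t) = 1 *\<^sub>R (s, p s) + (2 * of_int m * T, (2 * of_int m) *\<^sub>R e)"
      unfolding t odd_ext_eq[OF T_pos ends s] by (simp add: add.commute)
    then show ?thesis
      using invariantD(2,3)[OF grid_of_int_invariant(1)[OF inv, of m], of "(s, p s)"] base[OF s]
      by (metis scaleR_zero_right snd_conv)
  next
    assume t: "t = 2 * of_int m * T - s"
    have "(t, odd_ext T e p t) = (- 1) *\<^sub>R (s, p s) + (2 * of_int m * T, (2 * of_int m) *\<^sub>R e)"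
      unfolding t odd_ext_eq[OF T_pos ends s] by simp
    then show ?thesis
      using invariantD(2,3)[OF grid_of_int_invariant(2)[OF inv, of m], of "(s, p s)"] base[OF s]
      by (metis scaleR_zero_right snd_conv)
  qed
qed

text \<open>The position is odd up to shifts (\<open>\<kappa> = -1\<close>) and the velocity even
  and periodic (\<open>\<kappa> = 1\<close>), so one-sided derivatives at the ends of
  \<open>[0, T]\<close> match those of the reflected copies; for the velocity this rests on the
  invariance of \<open>accel\<close>.\<close>

theorem symmetric_solution:
  assumes inv: "invariant 1 (2 * T, 2 *\<^sub>R e)" "invariant (- 1) 0"
  obtains z v u where "z = odd_ext T e u" "u 0 = 0" "u T = e" "path_homotopic z0 u"
    "\<forall>t. z t \<notin> \<sigma> \<and> F (t, z t) = 0"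
    "\<forall>t. (z has_vector_derivative v t) (at t)"
    "\<forall>t. (v has_vector_derivative accel (t, z t) (v t)) (at t)"
proof -
  obtain u w where u: "\<forall>t\<in>{0..T}. u t \<notin> \<sigma> \<and> F (t, u t) = 0" and ends: "u 0 = 0" "u T = e"
    and d: "\<forall>t\<in>{0..T}. (u has_vector_derivative w t) (at t within {0..T})"
    "\<forall>t\<in>{0..T}. (w has_vector_derivative accel (t, u t) (w t)) (at t within {0..T})"
    and hom: "path_homotopic z0 u"
    by (rule boundary_solution)
  define z where "z = odd_ext T e u"
  define v where "v t = w (fold_time T t)" for t
  have zu: "z t = u t" and vw: "v t = w t" if "t \<in> {0..T}" for t
    using odd_ext_eq(1)[OF T_pos ends that, of 0] fold_time_eq(1)[OF T_pos that, of 0]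
    by (simp_all add: z_def v_def)
  have zp: "z (2 * of_int m * T + s) = (2 * of_int m) *\<^sub>R e + z s" for m s
    using odd_ext_shift[OF T_pos ends, of s m] by (simp add: z_def add.commute)
  have zm: "z (2 * of_int m * T - s) = (2 * of_int m) *\<^sub>R e + (- 1) *\<^sub>R z s" for m s
    using zp[of m "- s"] odd_ext_minus[OF T_pos ends, of s] by (simp add: z_def)
  have vp: "v (2 * of_int m * T + s) = v s" "v (2 * of_int m * T - s) = v s" for m s
    by (simp_all add: v_def fold_time_symmetry[OF T_pos])
  note inv' = grid_of_int_invariant[OF inv]
  have pt: "(2 * of_int m * T + s, z (2 * of_int m * T + s)) = 1 *\<^sub>R (s, z s) + (2 * of_int m * T, (2 * of_int m) *\<^sub>R e)"
    "(2 * of_int m * T - s, z (2 * of_int m * T - s)) = (- 1) *\<^sub>R (s, z s) + (2 * of_int m * T, (2 * of_int m) *\<^sub>R e)" for m s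
    unfolding zp zm by (simp_all add: add.commute)
  have base: "z t \<notin> \<sigma>" "F (t, z t) = 0" if "t \<in> {0..T}" for t
    using u that zu[OF that] by auto
  have on: "z t \<notin> \<sigma> \<and> F (t, z t) = 0" for t
    unfolding z_def by (rule odd_ext_in_constraint[OF inv ends]) (use u in auto)
  have dz: "(z has_vector_derivative v t) (at t)" for t
  proof (rule has_vector_derivative_by_symmetry[OF T_pos, where \<kappa> = "- 1"])
    fix t assume t: "t \<in> {0..T}"
    show "(z has_vector_derivative v t) (at t within {0..T})"
      unfolding vw[OF t]
      by (rule has_vector_derivative_transform[OF t _ d(1)[rule_format, OF t]]) (simp add: zu)
    show "v (2 * of_int m * T + t) = v t" "v (2 * of_int m * T - t) = - (- 1) *\<^sub>R v t" for m :: int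
      by (simp_all add: vp)
  next
    show "\<exists>c. \<forall>s. z (2 * of_int m * T + s) = c + z s" for m :: int using zp by blast
    show "\<exists>c. \<forall>s. z (2 * of_int m * T - s) = c + (- 1) *\<^sub>R z s" for m :: int using zm by blast
  qed
  have dv: "(v has_vector_derivative accel (t, z t) (v t)) (at t)" for t
  proof (rule has_vector_derivative_by_symmetry[OF T_pos, where \<kappa> = 1 and d = "\<lambda>t. accel (t, z t) (v t)"])
    fix t assume t: "t \<in> {0..T}"
    show "(v has_vector_derivative accel (t, z t) (v t)) (at t within {0..T})"
      unfolding vw[OF t] zu[OF t]
      by (rule has_vector_derivative_transform[OF t _ d(2)[rule_format, OF t]]) (simp add: vw)
    have b: "snd (t, z t) \<notin> \<sigma>" "F (t, z t) = 0" using base[OF t] by simp_all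
    show "accel (2 * of_int m * T + t, z (2 * of_int m * T + t)) (v (2 * of_int m * T + t)) = accel (t, z t) (v t)" for m :: int
      unfolding pt vp accel_invariant[OF inv'(1) b] by simp
    show "accel (2 * of_int m * T - t, z (2 * of_int m * T - t)) (v (2 * of_int m * T - t)) = - 1 *\<^sub>R accel (t, z t) (v t)" for m :: int
      unfolding pt vp accel_invariant[OF inv'(2) b] by simp
  next
    show "\<exists>c. \<forall>s. v (2 * of_int m * T + s) = c + v s" for m :: int
      by (rule exI[of _ 0]) (simp add: vp)
    show "\<exists>c. \<forall>s. v (2 * of_int m * T - s) = c + 1 *\<^sub>R v s" for m :: int
      by (rule exI[of _ 0]) (simp add: vp)
  qed
  show ?thesis
    by (rule that[of z u v]) (use z_def ends hom on dz dv in simp_all)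
qed

end

section \<open>Regularity classes, partial derivatives and periodicity\<close>

lemma C1_on_continuous:
  assumes "C1_on S h"
  shows "continuous_on S h"
proof -
  obtain h' where h': "\<And>x. x \<in> S \<Longrightarrow> (h has_derivative blinfun_apply (h' x)) (at x)"
    using assms unfolding C1_on_def by blast
  show ?thesis
    by (rule has_derivative_continuous_on) (rule has_derivative_at_withinI, rule h')
qed

lemma C2_on_imp_C1_on: "C2_on S h \<Longrightarrow> C1_on S h"
  unfolding C2_on_def using C1_on_continuous C1_on_def by blast

lemma C1_on_add:
  assumes "C1_on S h" "C1_on S k"
  shows "C1_on S (\<lambda>x. h x + k x)"
proof -
  obtain h' k' where h: "\<And>x. x \<in> S \<Longrightarrow> (h has_derivative blinfun_apply (h' x)) (at x)" "continuous_on S h'"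
    and k: "\<And>x. x \<in> S \<Longrightarrow> (k has_derivative blinfun_apply (k' x)) (at x)" "continuous_on S k'"
    using assms unfolding C1_on_def by blast
  show ?thesis
    unfolding C1_on_def
    by (intro exI[of _ "\<lambda>x. h' x + k' x"] conjI ballI continuous_on_add h k)
       (simp add: plus_blinfun.rep_eq has_derivative_add[OF h(1) k(1)])
qed

lemma C1_on_bounded_linear:
  assumes "bounded_linear f" "C1_on S h"
  shows "C1_on S (\<lambda>x. f (h x))"
proof -
  obtain h' where h: "\<And>x. x \<in> S \<Longrightarrow> (h has_derivative blinfun_apply (h' x)) (at x)" "continuous_on S h'"
    using assms(2) unfolding C1_on_def by blast
  have eq: "blinfun_apply (Blinfun f o\<^sub>L h' x) = (\<lambda>\<xi>. f (h' x \<xi>))" for x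
    by (auto simp: bounded_linear_Blinfun_apply[OF assms(1)])
  show ?thesis
    unfolding C1_on_def
    by (intro exI[of _ "\<lambda>x. Blinfun f o\<^sub>L h' x"] conjI ballI
        bounded_bilinear.continuous_on[OF bounded_bilinear_blinfun_compose] continuous_on_const h)
       (simp only: eq bounded_linear.has_derivative[OF assms(1) h(1)])
qed

lemma C1_on_zero: "C1_on S (\<lambda>x. 0)"
  unfolding C1_on_def by (intro exI[of _ "\<lambda>x. 0"]) (simp add: zero_blinfun.rep_eq)

lemma C1_on_sum: "(\<And>i. i \<in> I \<Longrightarrow> C1_on S (h i)) \<Longrightarrow> C1_on S (\<lambda>x. \<Sum>i\<in>I. h i x)"
  by (induction I rule: infinite_finite_induct) (auto simp: C1_on_zero intro: C1_on_add)

lemma C2_on_add: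
  assumes "C2_on S h" "C2_on S k"
  shows "C2_on S (\<lambda>x. h x + k x)"
proof -
  obtain h' k' where h: "\<And>x. x \<in> S \<Longrightarrow> (h has_derivative blinfun_apply (h' x)) (at x)" "C1_on S h'"
    and k: "\<And>x. x \<in> S \<Longrightarrow> (k has_derivative blinfun_apply (k' x)) (at x)" "C1_on S k'"
    using assms unfolding C2_on_def by blast
  show ?thesis
    unfolding C2_on_def
    by (intro exI[of _ "\<lambda>x. h' x + k' x"] conjI ballI C1_on_add h k)
       (simp add: plus_blinfun.rep_eq has_derivative_add[OF h(1) k(1)])
qed

lemma C2_on_bounded_linear:
  assumes "bounded_linear f" "C2_on S h"
  shows "C2_on S (\<lambda>x. f (h x))"
proof -
  obtain h' where h: "\<And>x. x \<in> S \<Longrightarrow> (h has_derivative blinfun_apply (h' x)) (at x)" "C1_on S h'"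
    using assms(2) unfolding C2_on_def by blast
  have eq: "blinfun_apply (Blinfun f o\<^sub>L h' x) = (\<lambda>\<xi>. f (h' x \<xi>))" for x
    by (auto simp: bounded_linear_Blinfun_apply[OF assms(1)])
  show ?thesis
    unfolding C2_on_def
    by (intro exI[of _ "\<lambda>x. Blinfun f o\<^sub>L h' x"] conjI ballI h
        C1_on_bounded_linear[OF bounded_bilinear.bounded_linear_right[OF bounded_bilinear_blinfun_compose]])
       (simp only: eq bounded_linear.has_derivative[OF assms(1) h(1)])
qed

lemma C2_on_zero: "C2_on S (\<lambda>x. 0)"
  unfolding C2_on_def by (intro exI[of _ "\<lambda>x. 0"]) (simp add: zero_blinfun.rep_eq C1_on_zero)

lemma C2_on_sum: "(\<And>i. i \<in> I \<Longrightarrow> C2_on S (h i)) \<Longrightarrow> C2_on S (\<lambda>x. \<Sum>i\<in>I. h i x)"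
  by (induction I rule: infinite_finite_induct) (auto simp: C2_on_zero intro: C2_on_add)

lemma C1_on_curve:
  assumes "\<And>t. (z has_vector_derivative v t) (at t)" "continuous_on UNIV v"
  shows "C1_on UNIV z"
  unfolding C1_on_def
proof (intro exI[of _ "\<lambda>t. blinfun_scaleR_left (v t)"] conjI ballI)
  show "(z has_derivative blinfun_apply (blinfun_scaleR_left (v t))) (at t)" for t
    using assms(1)[of t] by (simp add: has_vector_derivative_def blinfun_scaleR_left.rep_eq)
  show "continuous_on UNIV (\<lambda>t. blinfun_scaleR_left (v t))"
    by (rule bounded_linear.continuous_on[OF bounded_linear_blinfun_scaleR_left assms(2)])
qed

lemma C2_on_curve:
  assumes "\<And>t. (z has_vector_derivative v t) (at t)" "\<And>t. (v has_vector_derivative w t) (at t)"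
    "continuous_on UNIV w"
  shows "C2_on UNIV z"
  unfolding C2_on_def
proof (intro exI[of _ "\<lambda>t. blinfun_scaleR_left (v t)"] conjI ballI)
  show "(z has_derivative blinfun_apply (blinfun_scaleR_left (v t))) (at t)" for t
    using assms(1)[of t] by (simp add: has_vector_derivative_def blinfun_scaleR_left.rep_eq)
  show "C1_on UNIV (\<lambda>t. blinfun_scaleR_left (v t))"
    by (rule C1_on_bounded_linear[OF bounded_linear_blinfun_scaleR_left C1_on_curve[OF assms(2,3)]])
qed

lemma C1_on_lipschitz:
  fixes z :: "real \<Rightarrow> 'a::real_normed_vector"
  assumes "C1_on UNIV z"
  obtains c where "\<forall>s\<in>{a..b}. \<forall>t\<in>{a..b}. norm (z s - z t) \<le> c * \<bar>s - t\<bar>"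
proof -
  obtain z' where z: "\<And>t. (z has_derivative blinfun_apply (z' t)) (at t)" "continuous_on UNIV z'"
    using assms unfolding C1_on_def by blast
  have "compact (z' ` {a..b})"
    by (rule compact_continuous_image[OF continuous_on_subset[OF z(2)] compact_Icc]) simp
  then have "bounded (z' ` {a..b})" by (rule compact_imp_bounded)
  then obtain c where c: "\<forall>y\<in>z' ` {a..b}. norm y \<le> c"
    unfolding bounded_iff by blast
  have "norm (z s - z t) \<le> c * norm (s - t)" if "s \<in> {a..b}" "t \<in> {a..b}" for s t
  proof (rule differentiable_bound[where S = "{a..b}" and f' = "\<lambda>t. blinfun_apply (z' t)"])
    show "(z has_derivative blinfun_apply (z' x)) (at x within {a..b})" for x
      by (rule has_derivative_at_withinI[OF z(1)])
    show "onorm (blinfun_apply (z' x)) \<le> c" if "x \<in> {a..b}" for x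
      unfolding norm_blinfun.rep_eq[symmetric] using c that by blast
  qed (use that in auto)
  then have "\<forall>s\<in>{a..b}. \<forall>t\<in>{a..b}. norm (z s - z t) \<le> c * \<bar>s - t\<bar>"
    unfolding real_norm_def by blast
  then show ?thesis by (rule that)
qed

lemma partial_eq:
  assumes "(h has_derivative D) (at z)"
  shows "partial i h z = D (axis i 1)"
proof -
  have lin: "linear D" by (rule has_derivative_linear[OF assms])
  have "((\<lambda>s. h (z + s *\<^sub>R axis i 1)) has_derivative (\<lambda>s. D (s *\<^sub>R axis i 1))) (at 0)"
    by (rule has_derivative_compose[where f = "\<lambda>s. z + s *\<^sub>R axis i 1" and g = h])
       (auto intro!: derivative_eq_intros simp: assms)
  moreover have "(\<lambda>s. D (s *\<^sub>R axis i 1)) = (*) (D (axis i 1))"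
    by (auto simp: linear_scale[OF lin] mult.commute)
  ultimately have "((\<lambda>s. h (z + s *\<^sub>R axis i 1)) has_real_derivative D (axis i 1)) (at 0)"
    unfolding has_field_derivative_def by simp
  then show ?thesis unfolding partial_def by (rule DERIV_imp_deriv)
qed

lemma ang_shift_add: "ang_shift ang (p + q) = ang_shift ang p + ang_shift ang q"
  by (simp add: ang_shift_def vec_eq_iff distrib_left)

text \<open>The integer vectors whose shift preserves \<open>h t\<close> form a group; it contains
  the unit vectors, trivially so at indices outside \<open>ang\<close>.\<close>

lemma tz_periodic_ang_shift:
  assumes per: "tz_periodic \<omega> ang D h" and D: "\<And>z p. z \<in> D \<Longrightarrow> z + ang_shift ang p \<in> D"
    and z: "z \<in> D"
  shows "h t (z + ang_shift ang p) = h t z"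
proof -
  define Per where "Per q \<longleftrightarrow> (\<forall>z\<in>D. h t (z + ang_shift ang q) = h t z)" for q
  have "ang_shift ang 0 = 0" by (simp add: ang_shift_def vec_eq_iff)
  then have zero: "Per 0" by (simp add: Per_def)
  have add: "Per (q + r)" if "Per q" "Per r" for q r
    using that D unfolding Per_def ang_shift_add by (metis add.assoc)
  have minus: "Per (- q)" if "Per q" for q
  proof -
    have inv: "z + ang_shift ang (- q) + ang_shift ang q = z" for z
      unfolding add.assoc ang_shift_add[symmetric] by (simp add: ang_shift_def vec_eq_iff)
    show ?thesis unfolding Per_def
    proof
      fix z assume "z \<in> D"
      then have "h t (z + ang_shift ang (- q) + ang_shift ang q) = h t (z + ang_shift ang (- q))"
        using that D unfolding Per_def by blast
      then show "h t (z + ang_shift ang (- q)) = h t z" unfolding inv by simp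
    qed
  qed
  have one: "Per (axis j 1)" for j
  proof (cases "j \<in> ang")
    case True
    have "ang_shift ang (axis j 1) = (2 * pi) *\<^sub>R axis j 1"
      using True by (simp add: ang_shift_def vec_eq_iff axis_def)
    then show ?thesis using per True by (simp add: Per_def tz_periodic_def)
  next
    case False
    have "ang_shift ang (axis j 1) = 0"
      using False by (simp add: ang_shift_def vec_eq_iff axis_def)
    then show ?thesis by (simp add: Per_def)
  qed
  have nat: "Per (axis j (int n))" for j n
  proof (induction n)
    case 0
    then show ?case using zero by (simp add: axis_def zero_vec_def[symmetric])
  next
    case (Suc n)
    have "axis j (int (Suc n)) = axis j (int n) + axis j 1" by (simp add: axis_def vec_eq_iff)
    then show ?case using add[OF Suc one] by simp
  qed
  have int: "Per (axis j n)" for j n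
  proof (cases "0 \<le> n")
    case True
    then show ?thesis using nat[of j "nat n"] by simp
  next
    case False
    have "axis j n = - axis j (int (nat (- n)))" using False by (simp add: axis_def vec_eq_iff)
    show ?thesis unfolding \<open>axis j n = _\<close> by (rule minus[OF nat])
  qed
  have "Per (\<Sum>j\<in>I. axis j (p $ j))" for I
    by (induction I rule: infinite_finite_induct) (auto intro: add int zero)
  moreover have "(\<Sum>j\<in>UNIV. axis j (p $ j)) = p"
    by (simp add: vec_eq_iff axis_def)
  ultimately have "Per p" by metis
  then show ?thesis using z by (simp add: Per_def)
qed

text \<open>\<open>constraint_rank\<close> is the dimension of a set, in which equal gradients
  coincide; dimension \<open>l\<close> therefore forces the family to be injective as well as
  independent.\<close>

lemma dim_eq_card_imp_independent_family:
  fixes G :: "nat \<Rightarrow> 'a::euclidean_space"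
  assumes dim: "dim {G j |j. j < l} = l" and zero: "(\<Sum>j<l. c j *\<^sub>R G j) = 0" and j: "j < l"
  shows "c j = 0"
proof -
  let ?S = "G ` {..<l}"
  have S: "{G j |j. j < l} = ?S" by auto
  have "dim ?S \<le> card ?S" by (rule dim_le_card') simp
  moreover have "card ?S \<le> l" using card_image_le[of "{..<l}" G] by simp
  ultimately have card: "card ?S = l" using dim[unfolded S] by linarith
  then have inj: "inj_on G {..<l}" by (intro eq_card_imp_inj_on) simp_all
  have ind: "independent ?S"
  proof -
    have c: "card ?S = dim ?S" unfolding card dim[unfolded S] ..
    from card_eq_dim[OF subset_refl c finite_imageI[OF finite_lessThan]]
    show ?thesis using span_superset[of ?S] by (rule iffD2)
  qed
  have "(\<Sum>v\<in>?S. c (the_inv_into {..<l} G v) *\<^sub>R v) =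
      (\<Sum>j<l. ((\<lambda>v. c (the_inv_into {..<l} G v) *\<^sub>R v) \<circ> G) j)"
    by (rule sum.reindex[OF inj])
  also have "\<dots> = (\<Sum>j<l. c j *\<^sub>R G j)"
    by (rule sum.cong[OF refl]) (simp add: the_inv_into_f_f[OF inj])
  also note zero
  finally have eq: "(\<Sum>v\<in>?S. c (the_inv_into {..<l} G v) *\<^sub>R v) = 0" .
  have "G j \<in> ?S" using j by simp
  from independentD[where u = "\<lambda>v. c (the_inv_into {..<l} G v)", OF ind finite_imageI[OF finite_lessThan] subset_refl eq this]
  have "c (the_inv_into {..<l} G (G j)) = 0" .
  moreover have "the_inv_into {..<l} G (G j) = j" by (rule the_inv_into_f_f[OF inj]) (use j in simp)
  ultimately show ?thesis by simp
qed

context boundary_problem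
begin

lemma odd_ext_homotopic:
  assumes inv: "invariant 1 (2 * T, 2 *\<^sub>R e)" "invariant (- 1) 0"
    and hom: "path_homotopic p q"
    and P: "\<And>y. continuous_on UNIV y \<Longrightarrow> (\<And>t. y t \<notin> \<sigma> \<and> F (t, y t) = 0) \<Longrightarrow>
      (\<And>t. y (t + 2 * T) = y t + 2 *\<^sub>R e) \<Longrightarrow> Pr y"
  shows "homotopic_with_canon Pr UNIV (- \<sigma>) (odd_ext T e p) (odd_ext T e q)"
proof -
  obtain H :: "real \<times> real \<Rightarrow> 'a"
    where cm: "continuous_map (prod_topology (top_of_set {0..1}) (top_of_set {0..T})) (top_of_set (- \<sigma>)) H"
    and H0: "\<And>t. H (0, t) = p t" and H1: "\<And>t. H (1, t) = q t"
    and path: "\<And>r. r \<in> {0..1} \<Longrightarrow> is_path (\<lambda>t. H (r, t))"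
    using hom unfolding homotopic_with_def by blast
  have cont: "continuous_on ({0..1} \<times> {0..T}) H" and avoid: "H \<in> {0..1} \<times> {0..T} \<rightarrow> - \<sigma>"
    using cm unfolding prod_topology_subtopology_eu continuous_map_subtopology_eu by blast+
  define Z where "Z = (\<lambda>x. odd_ext T e (\<lambda>t. H (fst x, t)) (snd x))"
  have ends: "H (r, 0) = 0" "H (r, T) = e" if "r \<in> {0..1}" for r
    using path[OF that] by (simp_all add: is_path_def)
  have on: "Z (r, t) \<notin> \<sigma> \<and> F (t, Z (r, t)) = 0" if r: "r \<in> {0..1}" for r t
    unfolding Z_def fst_conv snd_conv
  proof (rule odd_ext_in_constraint[OF inv ends[OF r]])
    fix t assume t: "t \<in> {0..T}"
    show "H (r, t) \<notin> \<sigma>" using avoid r t by blast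
    show "F (t, H (r, t)) = 0" using path[OF r] t by (simp add: is_path_def)
  qed
  have "continuous_on ({0..1} \<times> {0..T}) (\<lambda>x. H (fst x, snd x))" using cont by simp
  from odd_ext_cont[OF T_pos this ends] have contZ: "continuous_on ({0..1} \<times> UNIV) Z"
    unfolding Z_def by blast
  have PZ: "Pr (\<lambda>t. Z (r, t))" if r: "r \<in> {0..1}" for r
  proof (rule P)
    show "continuous_on UNIV (\<lambda>t. Z (r, t))"
      by (rule continuous_on_compose2[OF contZ continuous_on_Pair[OF continuous_on_const continuous_on_id]])
         (use r in auto)
    show "Z (r, t) \<notin> \<sigma> \<and> F (t, Z (r, t)) = 0" for t by (rule on[OF r])
    show "Z (r, t + 2 * T) = Z (r, t) + 2 *\<^sub>R e" for t
      using odd_ext_shift[OF T_pos ends[OF r], of t 1] by (simp add: Z_def)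
  qed
  have "continuous_map (prod_topology (top_of_set {0..1}) (top_of_set UNIV)) (top_of_set (- \<sigma>)) Z"
    unfolding prod_topology_subtopology_eu continuous_map_subtopology_eu
    using contZ on by (auto simp: Pi_iff)
  moreover have "\<forall>t. Z (0, t) = odd_ext T e p t" "\<forall>t. Z (1, t) = odd_ext T e q t"
    by (simp_all add: Z_def H0 H1)
  moreover have "\<forall>r\<in>{0..1}. Pr (\<lambda>t. Z (r, t))" using PZ by blast
  ultimately show ?thesis unfolding homotopic_with_def by blast
qed

end

section \<open>The main theorem\<close>

theorem theorem2p1:
  fixes \<omega> C M A K P C\<^sub>1 :: real
    and ang :: "'k::finite set"
    and \<sigma> :: "(real ^ 'k) set"
    and g :: "real \<Rightarrow> real ^ 'k \<Rightarrow> real ^ 'k ^ 'k"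
    and a :: "real \<Rightarrow> real ^ 'k \<Rightarrow> real ^ 'k"
    and V :: "real \<Rightarrow> real ^ 'k \<Rightarrow> real"
    and l :: nat
    and f :: "nat \<Rightarrow> real \<Rightarrow> real ^ 'k \<Rightarrow> real"
    and \<nu> :: "int ^ 'k"
    and z\<^sub>0 :: "real \<Rightarrow> real ^ 'k"
  assumes \<omega>_pos: "\<omega> > 0"
    and \<sigma>_discrete: "\<And>z. \<not> z islimpt \<sigma>"
    and \<sigma>_uminus: "\<And>z. z \<in> \<sigma> \<Longrightarrow> - z \<in> \<sigma>"
    and \<sigma>_shift: "\<And>z p. z \<in> \<sigma> \<Longrightarrow> z + ang_shift ang p \<in> \<sigma>"
    and g_sym: "\<And>t z i j. z \<notin> \<sigma> \<Longrightarrow> g t z $ i $ j = g t z $ j $ i"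
    and g_C2: "\<And>i j. C2_on (UNIV \<times> - \<sigma>) (\<lambda>(t, z). g t z $ i $ j)"
    and a_C2: "\<And>i. C2_on (UNIV \<times> - \<sigma>) (\<lambda>(t, z). a t z $ i)"
    and V_C2: "C2_on (UNIV \<times> - \<sigma>) (\<lambda>(t, z). V t z)"
    and g_periodic: "tz_periodic \<omega> ang (- \<sigma>) g"
    and a_periodic: "tz_periodic \<omega> ang (- \<sigma>) a"
    and V_periodic: "tz_periodic \<omega> ang (- \<sigma>) V"
    and constants_pos: "C > 0" "M > 0" "A > 0" "K > 0" "P > 0"
    and a_bound: "\<And>t z. z \<notin> \<sigma> \<Longrightarrow> norm (a t z) \<le> C + M * norm z"
    and g_bound: "\<And>t z \<xi>. z \<notin> \<sigma> \<Longrightarrow>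
        1/2 * (\<Sum>i\<in>UNIV. \<Sum>j\<in>UNIV. g t z $ i $ j * \<xi> $ i * \<xi> $ j) \<ge> K * (norm \<xi>)\<^sup>2"
    and V_bound: "\<And>t z s. z \<notin> \<sigma> \<Longrightarrow> s \<in> \<sigma> \<Longrightarrow>
        V t z \<le> A * (norm z)\<^sup>2 - P / (norm (z - s))\<^sup>2 + C\<^sub>1"
    and V_bound_empty: "\<And>t z. \<sigma> = {} \<Longrightarrow> V t z \<le> A * (norm z)\<^sup>2 + C\<^sub>1"
    and l_less: "l < CARD('k)"
    and f_C2: "\<And>j. j < l \<Longrightarrow> C2_on UNIV (\<lambda>(t, z). f j t z)"
    and f_periodic: "\<And>j. j < l \<Longrightarrow> tz_periodic \<omega> ang UNIV (f j)"
    and f_rank: "\<And>t z. z \<in> constraint_set l f t \<Longrightarrow> constraint_rank l f t z = l"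
    and f_parity: "(\<forall>j<l. \<forall>t z. f j (- t) (- z) = - f j t z) \<or>
        (\<forall>j<l. \<forall>t z. f j (- t) (- z) = f j t z)"
    and \<sigma>_constraint: "\<And>t. \<sigma> \<subseteq> constraint_set l f t"
    and g_even: "\<And>t z i j. z \<notin> \<sigma> \<Longrightarrow> g (- t) (- z) $ i $ j = g t z $ i $ j"
    and a_even: "\<And>t z i. z \<notin> \<sigma> \<Longrightarrow> a (- t) (- z) $ i = a t z $ i"
    and V_even: "\<And>t z. z \<notin> \<sigma> \<Longrightarrow> V (- t) (- z) = V t z"
    and coercive: "K - M * \<omega> / sqrt 2 - A * \<omega>\<^sup>2 / 2 > 0"
    and curves_nonvoid: "curves \<omega> ang \<sigma> l f \<nu> \<noteq> {}"
    and z\<^sub>0_curve: "z\<^sub>0 \<in> curves \<omega> ang \<sigma> l f \<nu>"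
    and z\<^sub>0_C1: "C1_on UNIV z\<^sub>0"
    and z\<^sub>0_odd: "\<And>t. z\<^sub>0 (- t) = - z\<^sub>0 t"
    and away_from_\<sigma>: "\<sigma> \<noteq> {} \<Longrightarrow>
        Inf {(SUP t\<in>{0..\<omega>}. norm (z t - s)) |z s. z \<in> curve_class \<omega> ang \<sigma> l f \<nu> z\<^sub>0 \<and> s \<in> \<sigma>} > 0"
  shows "\<exists>z. is_solution (Lagrangian g a V) \<sigma> l f z \<and>
             z \<in> curve_class \<omega> ang \<sigma> l f \<nu> z\<^sub>0 \<and>
             (\<forall>t. z (- t) = - z t)"
proof -
  let ?D = "UNIV \<times> - \<sigma> :: (real \<times> (real ^ 'k)) set"
  define T where "T = \<omega> / 2"
  define e where "e = (1/2) *\<^sub>R ang_shift ang \<nu>"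
  have T: "0 < T" using \<omega>_pos by (simp add: T_def)
  have T2: "2 * T = \<omega>" and e2: "2 *\<^sub>R e = ang_shift ang \<nu>" by (simp_all add: T_def e_def)
  have \<sigma>_closed: "closed \<sigma>" using \<sigma>_discrete by (simp add: closed_limpt)
  have cur: "continuous_on UNIV z\<^sub>0" "\<And>t. z\<^sub>0 t \<notin> \<sigma>" "\<And>t. z\<^sub>0 (t + \<omega>) = z\<^sub>0 t + ang_shift ang \<nu>"
    "\<And>t. z\<^sub>0 t \<in> constraint_set l f t"
    using z\<^sub>0_curve unfolding curves_def by blast+
  have z00: "z\<^sub>0 0 = 0"
  proof -
    have "z\<^sub>0 0 = - z\<^sub>0 0" using z\<^sub>0_odd[of 0] unfolding minus_zero .
    then have "z\<^sub>0 0 $ i = - (z\<^sub>0 0 $ i)" for i by (metis vector_uminus_component)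
    then have "z\<^sub>0 0 $ i = 0" for i by (simp only: equal_neg_zero)
    then show ?thesis by (simp add: vec_eq_iff)
  qed
  have z0T: "z\<^sub>0 T = e"
  proof -
    have "- T + \<omega> = T" by (simp add: T_def)
    then have "z\<^sub>0 T = - z\<^sub>0 T + ang_shift ang \<nu>" using cur(3)[of "- T"] unfolding z\<^sub>0_odd by simp
    then have "z\<^sub>0 T $ i = - (z\<^sub>0 T $ i) + ang_shift ang \<nu> $ i" for i
      by (metis vector_add_component vector_uminus_component)
    then have "ang_shift ang \<nu> $ i = 2 * z\<^sub>0 T $ i" for i by (simp add: field_simps)
    then have "e $ i = z\<^sub>0 T $ i" for i unfolding e_def vector_scaleR_component by simp
    then show ?thesis by (simp add: vec_eq_iff)
  qed
  have f_deriv: "\<exists>D. ((\<lambda>(t, z). f j t z) has_derivative D) (at x)" if "j < l" for j x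
    using f_C2[OF that] unfolding C2_on_def by blast
  \<comment> \<open>In the other case all gradients vanish at the origin, while
    \<open>z\<^sub>0 0 = 0\<close> puts the origin in the constraint set, where the rank is
    \<open>l > 0\<close>.\<close>
  have f_odd: "f j (- t) (- z) = - f j t z" if j: "j < l" for j t z
  proof (rule ccontr)
    assume "\<not> ?thesis"
    then have even: "\<And>j t z. j < l \<Longrightarrow> f j (- t) (- z) = f j t z" using f_parity j by blast
    have "partial k (f i 0) 0 = 0" if i: "i < l" for i k
    proof -
      obtain D where D: "((\<lambda>x. f i (fst x) (snd x)) has_derivative D) (at (0, 0))"
        using f_deriv[OF i, of "(0, 0)"] by (auto simp: case_prod_unfold)
      then have D': "((\<lambda>x. f i (fst x) (snd x)) has_derivative D) (at ((- 1) *\<^sub>R (0, 0) + 0))" by simp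
      have D1: "D ((- 1) *\<^sub>R \<xi>) = 1 *\<^sub>R D \<xi>" for \<xi>
        by (rule derivative_affine_symmetry[OF open_UNIV UNIV_I D D']) (simp add: even[OF i])
      have D0: "D \<xi> = 0" for \<xi>
        using D1[of \<xi>] linear_neg[OF has_derivative_linear[OF D], of \<xi>] by simp
      have "((\<lambda>y. (0 :: real, y)) has_derivative (\<lambda>u. (0, u))) (at (0 :: real ^ 'k))"
        by (rule has_derivative_Pair[OF has_derivative_const has_derivative_ident])
      from has_derivative_compose[OF this, where g = "\<lambda>x. f i (fst x) (snd x)" and g' = D] D
      have "(f i 0 has_derivative (\<lambda>u. D (0, u))) (at 0)" by simp
      then show ?thesis by (simp add: partial_eq D0)
    qed
    then have "{(\<chi> k. partial k (f i 0) 0) |i. i < l} \<subseteq> {0}" by (auto simp: vec_eq_iff)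
    then have "constraint_rank l f 0 0 = 0" unfolding constraint_rank_def by (simp add: dim_eq_0)
    moreover have "constraint_rank l f 0 0 = l" by (rule f_rank) (use cur(4)[of 0] z00 in simp)
    ultimately show False using j by simp
  qed
  have D_shift: "z + ang_shift ang p \<in> - \<sigma>" if "z \<in> - \<sigma>" for z p
  proof
    assume "z + ang_shift ang p \<in> \<sigma>"
    then have "(z + ang_shift ang p) + ang_shift ang (- p) \<in> \<sigma>" by (rule \<sigma>_shift)
    moreover have "(z + ang_shift ang p) + ang_shift ang (- p) = z"
      unfolding add.assoc ang_shift_add[symmetric] by (simp add: ang_shift_def vec_eq_iff)
    ultimately show False using that by simp
  qed
  have \<sigma>_neg: "- z \<notin> \<sigma>" if "z \<notin> \<sigma>" for z using \<sigma>_uminus[of "- z"] that by auto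
  \<comment> \<open>Chooses the coordinates in which the constraint functions are stored:
    \<open>f j\<close> becomes component \<open>idx j\<close> of \<open>Fm\<close>, the remaining
    components are zero, and \<open>E\<close> projects onto them.\<close>
  obtain idx :: "nat \<Rightarrow> 'k" where "bij_betw idx {0..<CARD('k)} UNIV"
    using ex_bij_betw_nat_finite[of "UNIV :: 'k set"] by auto
  then have idx: "inj_on idx {..<l}"
    by (rule inj_on_subset[OF bij_betw_imp_inj_on]) (use l_less in auto)
  define J where "J = idx ` {..<l}"
  define Fm :: "real \<times> (real ^ 'k) \<Rightarrow> real ^ 'k"
    where "Fm x = (\<Sum>j<l. (case x of (t, z) \<Rightarrow> f j t z) *\<^sub>R axis (idx j) 1)" for x
  define E :: "real ^ 'k \<Rightarrow> real ^ 'k" where "E w = (\<chi> i. if i \<in> J then 0 else w $ i)" for w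
  \<comment> \<open>Elementary matrices as bounded linear maps: \<open>gm\<close> becomes a finite
    sum of scalar functions times constants and inherits their smoothness.\<close>
  define Gb :: "'k \<Rightarrow> 'k \<Rightarrow> (real ^ 'k) \<Rightarrow>\<^sub>L (real ^ 'k)"
    where "Gb i j = Blinfun (\<lambda>v. (v $ j) *\<^sub>R axis i 1)" for i j
  define gm where "gm x = (\<Sum>i\<in>UNIV. \<Sum>j\<in>UNIV. (case x of (t, z) \<Rightarrow> g t z $ i $ j) *\<^sub>R Gb i j)" for x
  define am :: "real \<times> (real ^ 'k) \<Rightarrow> real ^ 'k"
    where "am x = (\<Sum>i\<in>UNIV. (case x of (t, z) \<Rightarrow> a t z $ i) *\<^sub>R axis i 1)" for x
  define Vm where "Vm x = (case x of (t, z) \<Rightarrow> V t z)" for x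
  have blg: "bounded_linear (\<lambda>v::real^'k. (v $ j) *\<^sub>R (axis i 1 :: real ^ 'k))" for i j
    by (intro bounded_linear_scaleR_const bounded_linear_vec_nth)
  have Gb: "Gb i j v = (v $ j) *\<^sub>R axis i 1" for i j v
    unfolding Gb_def by (simp add: bounded_linear_Blinfun_apply[OF blg])
  have gm_inner: "gm x v \<bullet> w = (\<Sum>i\<in>UNIV. \<Sum>j\<in>UNIV. g (fst x) (snd x) $ i $ j * w $ i * v $ j)" for x v w
    by (simp add: gm_def blinfun.sum_left blinfun.scaleR_left Gb inner_sum_left inner_axis'
        case_prod_unfold ac_simps)
  have am_eq: "am x = a (fst x) (snd x)" for x
    using basis_expansion[of "a (fst x) (snd x)"] by (simp add: am_def case_prod_unfold scalar_mult_eq_scaleR)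
  have Fm_idx: "Fm x $ idx j = f j (fst x) (snd x)" if "j < l" for x j
  proof -
    have "Fm x $ idx j = (\<Sum>i<l. if i = j then f i (fst x) (snd x) else 0)"
      unfolding Fm_def sum_component
    proof (rule sum.cong[OF refl])
      fix i assume "i \<in> {..<l}"
      then have "idx i = idx j \<longleftrightarrow> i = j" using inj_on_eq_iff[OF idx] that by simp
      then show "((case x of (t, z) \<Rightarrow> f i t z) *\<^sub>R axis (idx i) 1) $ idx j = (if i = j then f i (fst x) (snd x) else 0)"
        by (auto simp: axis_def case_prod_unfold)
    qed
    then show ?thesis using that by simp
  qed
  have Fm_out: "Fm x $ k = 0" if "k \<notin> J" for x k
    unfolding Fm_def sum_component by (rule sum.neutral) (use that in \<open>auto simp: axis_def J_def\<close>)
  have Fm0: "Fm (t, z) = 0 \<longleftrightarrow> z \<in> constraint_set l f t" for t z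
  proof
    assume "Fm (t, z) = 0"
    then show "z \<in> constraint_set l f t" using Fm_idx[of _ "(t, z)"] by (auto simp: constraint_set_def)
  next
    assume z: "z \<in> constraint_set l f t"
    have "Fm (t, z) $ k = 0" for k
    proof (cases "k \<in> J")
      case True
      then obtain j where "j < l" "k = idx j" by (auto simp: J_def)
      then show ?thesis using Fm_idx[of j "(t, z)"] z by (simp add: constraint_set_def)
    qed (rule Fm_out)
    then show "Fm (t, z) = 0" by (simp add: vec_eq_iff)
  qed
  have "C2_on UNIV Fm"
    unfolding Fm_def by (intro C2_on_sum C2_on_bounded_linear[OF bounded_linear_scaleR_left] f_C2) simp
  then obtain Fm' where Fm': "\<And>x. (Fm has_derivative blinfun_apply (Fm' x)) (at x)" "C1_on UNIV Fm'"
    unfolding C2_on_def by blast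
  then obtain Fm'' where Fm'': "\<And>x. (Fm' has_derivative blinfun_apply (Fm'' x)) (at x)" "continuous_on UNIV Fm''"
    unfolding C1_on_def by blast
  have "C1_on ?D gm"
    unfolding gm_def
    by (intro C1_on_sum C1_on_bounded_linear[OF bounded_linear_scaleR_left] C2_on_imp_C1_on g_C2)
  then obtain gm' where gm': "\<And>x. x \<in> ?D \<Longrightarrow> (gm has_derivative blinfun_apply (gm' x)) (at x)" "continuous_on ?D gm'"
    unfolding C1_on_def by blast
  have "C1_on ?D am"
    unfolding am_def
    by (intro C1_on_sum C1_on_bounded_linear[OF bounded_linear_scaleR_left] C2_on_imp_C1_on a_C2)
  then obtain am' where am': "\<And>x. x \<in> ?D \<Longrightarrow> (am has_derivative blinfun_apply (am' x)) (at x)" "continuous_on ?D am'"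
    unfolding C1_on_def by blast
  have "C1_on ?D Vm"
    unfolding Vm_def by (rule C2_on_imp_C1_on[OF V_C2])
  then obtain Vm' where Vm': "\<And>x. x \<in> ?D \<Longrightarrow> (Vm has_derivative blinfun_apply (Vm' x)) (at x)" "continuous_on ?D Vm'"
    unfolding C1_on_def by blast
  have partial_f: "partial k (f j t) z = Fm' (t, z) (0, axis k 1) $ idx j" if j: "j < l" for j k t z
  proof -
    have "((\<lambda>y. Fm (t, y)) has_derivative (\<lambda>u. Fm' (t, z) (0, u))) (at z)"
      by (rule has_derivative_compose[OF has_derivative_Pair[OF has_derivative_const has_derivative_ident] Fm'(1)])
    from bounded_linear.has_derivative[OF bounded_linear_vec_nth this, of "idx j"]
    have "(f j t has_derivative (\<lambda>u. Fm' (t, z) (0, u) $ idx j)) (at z)" by (simp add: Fm_idx[OF j])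
    then show ?thesis by (rule partial_eq)
  qed
  have Fm'_out: "Fm' x \<xi> $ k = 0" if k: "k \<notin> J" for x \<xi> k
  proof -
    have "((\<lambda>x. Fm x $ k) has_derivative (\<lambda>\<xi>. Fm' x \<xi> $ k)) (at x)"
      by (rule bounded_linear.has_derivative[OF bounded_linear_vec_nth Fm'(1)])
    moreover have "((\<lambda>x. Fm x $ k) has_derivative (\<lambda>\<xi>. 0)) (at x)" by (simp add: Fm_out[OF k])
    ultimately show ?thesis using has_derivative_unique by metis
  qed
  have inner_J: "w \<bullet> \<mu> = (\<Sum>j<l. \<mu> $ idx j * w $ idx j)" if "\<And>k. k \<notin> J \<Longrightarrow> w $ k = 0" for w \<mu> :: "real ^ 'k"
  proof -
    have "w \<bullet> \<mu> = (\<Sum>k\<in>J. w $ k * \<mu> $ k)"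
      unfolding inner_vec_def inner_real_def by (rule sum.mono_neutral_right) (use that in auto)
    also have "\<dots> = (\<Sum>j<l. w $ idx j * \<mu> $ idx j)" unfolding J_def by (simp add: sum.reindex[OF idx])
    finally show ?thesis by (simp add: mult.commute)
  qed
  obtain \<Lambda> where \<Lambda>: "\<forall>s\<in>{0..T}. \<forall>t\<in>{0..T}. norm (z\<^sub>0 s - z\<^sub>0 t) \<le> \<Lambda> * \<bar>s - t\<bar>"
    using C1_on_lipschitz[OF z\<^sub>0_C1] by blast
  have V_upper: "V t z \<le> A * (norm z)\<^sup>2 + C\<^sub>1" if z: "z \<notin> \<sigma>" for t z
  proof (cases "\<sigma> = {}")
    case False
    then obtain s where "s \<in> \<sigma>" by blast
    then have "V t z \<le> A * (norm z)\<^sup>2 - P / (norm (z - s))\<^sup>2 + C\<^sub>1" using V_bound z by blast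
    moreover have "0 \<le> P / (norm (z - s))\<^sup>2" using constants_pos by simp
    ultimately show ?thesis by linarith
  qed (use V_bound_empty in blast)
  \<comment> \<open>With \<open>T = \<omega> / 2\<close> the losses are
    \<open>M * \<omega> / 2\<close> and \<open>A * \<omega>\<^sup>2 / 4\<close>, at most those
    allowed for in \<open>coercive\<close>.\<close>
  have coer: "0 < K - M * T - A * T\<^sup>2"
  proof -
    have "sqrt 2 \<le> 2" by (rule real_le_lsqrt) auto
    then have "M * \<omega> / 2 \<le> M * \<omega> / sqrt 2" using constants_pos \<omega>_pos by (intro divide_left_mono) auto
    moreover have "A * T\<^sup>2 = A * \<omega>\<^sup>2 / 4" "M * T = M * \<omega> / 2" by (simp_all add: T_def power_divide)
    moreover have "0 \<le> A * \<omega>\<^sup>2" using constants_pos by simp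
    ultimately show ?thesis using coercive by linarith
  qed
  have "bounded_linear E"
    unfolding E_def linear_conv_bounded_linear[symmetric] by (rule linearI) (auto simp: vec_eq_iff)
  then interpret E: bounded_linear E .
  interpret boundary_problem Fm Fm' Fm'' E \<sigma> gm gm' am am' Vm Vm' K T e C M A C\<^sub>1 P z\<^sub>0 \<Lambda>
  proof unfold_locales
    show "E u \<bullet> v = u \<bullet> E v" for u v
      unfolding inner_vec_def E_def by (rule sum.cong) auto
    show "E (Fm x) = 0" for x by (simp add: E_def vec_eq_iff Fm_out)
    show "\<mu> = 0" if x: "Fm x = 0" and orth: "\<And>w. Fm' x (0, w) \<bullet> \<mu> = 0" and "E \<mu> = 0" for x \<mu>
    proof -
      obtain t z where tz: "x = (t, z)" by fastforce
      \<comment> \<open>Read in coordinates, \<open>orth\<close> says that the combination of the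
        gradients with coefficients \<open>\<mu> $ idx j\<close> vanishes.\<close>
      have "(\<Sum>j<l. \<mu> $ idx j *\<^sub>R (\<chi> k. partial k (f j t) z)) $ i = 0" for i
      proof -
        have "(\<Sum>j<l. \<mu> $ idx j *\<^sub>R (\<chi> k. partial k (f j t) z)) $ i = (\<Sum>j<l. \<mu> $ idx j * partial i (f j t) z)"
          by (simp add: sum_component)
        also have "\<dots> = (\<Sum>j<l. \<mu> $ idx j * Fm' x (0, axis i 1) $ idx j)"
          by (rule sum.cong[OF refl]) (simp add: partial_f tz)
        also have "\<dots> = Fm' x (0, axis i 1) \<bullet> \<mu>" by (rule inner_J[symmetric]) (rule Fm'_out)
        finally show ?thesis unfolding orth .
      qed
      then have "(\<Sum>j<l. \<mu> $ idx j *\<^sub>R (\<chi> k. partial k (f j t) z)) = 0" unfolding vec_eq_iff zero_index by blast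
      moreover have "dim {(\<chi> k. partial k (f j t) z) |j. j < l} = l"
        using f_rank[of z t] x Fm0 unfolding tz constraint_rank_def by blast
      ultimately have "\<mu> $ idx j = 0" if "j < l" for j
        using dim_eq_card_imp_independent_family[where c = "\<lambda>j. \<mu> $ idx j" and l = l
            and G = "\<lambda>j. \<chi> k. partial k (f j t) z" and j = j] that by blast
      then have "\<mu> $ k = 0" if "k \<in> J" for k using that unfolding J_def by blast
      moreover have "\<mu> $ k = 0" if "k \<notin> J" for k
      proof -
        have "E \<mu> $ k = \<mu> $ k" using that by (simp add: E_def)
        then show ?thesis using \<open>E \<mu> = 0\<close> by simp
      qed
      ultimately show ?thesis unfolding vec_eq_iff zero_index by blast
    qed
    show "gm x v \<bullet> w = v \<bullet> gm x w" if "snd x \<notin> \<sigma>" for x v w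
      unfolding inner_commute[of v "gm x w"] gm_inner
      by (subst sum.swap, intro sum.cong refl, subst g_sym[OF that]) simp
    show "K * (norm v)\<^sup>2 \<le> 1 / 2 * (gm x v \<bullet> v)" if "snd x \<notin> \<sigma>" for x v
      using g_bound[OF that, of v "fst x"] by (simp add: gm_inner)
    show "norm (am x) \<le> C + M * norm (snd x)" if "snd x \<notin> \<sigma>" for x
      using a_bound[OF that] by (simp add: am_eq)
    show "Vm x \<le> A * (norm (snd x))\<^sup>2 + C\<^sub>1" if "snd x \<notin> \<sigma>" for x
      using V_upper[OF that] by (simp add: Vm_def case_prod_unfold)
    show "Vm x \<le> A * (norm (snd x))\<^sup>2 + C\<^sub>1 - P / (norm (snd x - s))\<^sup>2" if "snd x \<notin> \<sigma>" "s \<in> \<sigma>" for x s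
      using V_bound[OF that, of "fst x"] by (simp add: Vm_def case_prod_unfold)
    show "Fm (t, z\<^sub>0 t) = 0" if "t \<in> {0..T}" for t using cur(4) Fm0 by blast
    show "norm (z\<^sub>0 s - z\<^sub>0 t) \<le> \<Lambda> * \<bar>s - t\<bar>" if "s \<in> {0..T}" "t \<in> {0..T}" for s t
      using \<Lambda> that by blast
    show "(gm has_derivative blinfun_apply (gm' x)) (at x)" "(am has_derivative blinfun_apply (am' x)) (at x)"
      "(Vm has_derivative blinfun_apply (Vm' x)) (at x)" if "snd x \<notin> \<sigma>" for x
      using gm'(1)[of x] am'(1)[of x] Vm'(1)[of x] that by (simp_all add: mem_Times_iff)
    show "0 \<le> C" "0 \<le> M" "0 \<le> A" "0 < P" "0 < K" using constants_pos by simp_all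
  qed (rule \<sigma>_closed Fm' Fm'' gm' am' Vm' T coer z00 z0T cur)+
  have inv_shift: "invariant 1 (2 * T, 2 *\<^sub>R e)"
    unfolding invariant_def T2 e2
  proof (intro conjI allI impI)
    fix x :: "real \<times> (real ^ 'k)"
    have eq: "1 *\<^sub>R x + (\<omega>, ang_shift ang \<nu>) = (fst x + \<omega>, snd x + ang_shift ang \<nu>)" by (simp add: prod_eq_iff)
    have "f j (fst x + \<omega>) (snd x + ang_shift ang \<nu>) = f j (fst x) (snd x)" if "j < l" for j
      using tz_periodic_ang_shift[OF f_periodic[OF that], of "snd x" "fst x + \<omega>" \<nu>] f_periodic[OF that]
      by (simp add: tz_periodic_def)
    then have "(\<Sum>j<l. f j (fst x + \<omega>) (snd x + ang_shift ang \<nu>) *\<^sub>R axis (idx j) 1 :: real ^ 'k) =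
        (\<Sum>j<l. f j (fst x) (snd x) *\<^sub>R axis (idx j) 1)"
      by (intro sum.cong[OF refl]) simp
    then show "Fm (1 *\<^sub>R x + (\<omega>, ang_shift ang \<nu>)) = 1 *\<^sub>R Fm x"
      unfolding eq by (simp add: Fm_def case_prod_unfold)
    assume x: "snd x \<notin> \<sigma>"
    then have x': "snd x \<in> - \<sigma>" by simp
    have s: "snd x + ang_shift ang \<nu> \<in> - \<sigma>" by (rule D_shift[OF x'])
    then show "snd (1 *\<^sub>R x + (\<omega>, ang_shift ang \<nu>)) \<notin> \<sigma>" unfolding eq by simp
    have g1: "g (fst x + \<omega>) (snd x + ang_shift ang \<nu>) = g (fst x) (snd x)"
      using tz_periodic_ang_shift[OF g_periodic D_shift x', of "fst x + \<omega>" \<nu>] g_periodic x'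
      by (simp add: tz_periodic_def)
    have a1: "a (fst x + \<omega>) (snd x + ang_shift ang \<nu>) = a (fst x) (snd x)"
      using tz_periodic_ang_shift[OF a_periodic D_shift x', of "fst x + \<omega>" \<nu>] a_periodic x'
      by (simp add: tz_periodic_def)
    have V1: "V (fst x + \<omega>) (snd x + ang_shift ang \<nu>) = V (fst x) (snd x)"
      using tz_periodic_ang_shift[OF V_periodic D_shift x', of "fst x + \<omega>" \<nu>] V_periodic x'
      by (simp add: tz_periodic_def)
    show "gm (1 *\<^sub>R x + (\<omega>, ang_shift ang \<nu>)) = gm x" unfolding eq by (simp add: gm_def case_prod_unfold g1)
    show "am (1 *\<^sub>R x + (\<omega>, ang_shift ang \<nu>)) = am x" unfolding eq by (simp add: am_eq a1)
    show "Vm (1 *\<^sub>R x + (\<omega>, ang_shift ang \<nu>)) = Vm x" unfolding eq by (simp add: Vm_def case_prod_unfold V1)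
  qed simp
  have inv_minus: "invariant (- 1) 0"
    unfolding invariant_def
  proof (intro conjI allI impI)
    fix x :: "real \<times> (real ^ 'k)"
    have eq: "(- 1) *\<^sub>R x + 0 = (- fst x, - snd x)" by (simp add: prod_eq_iff)
    show "Fm ((- 1) *\<^sub>R x + 0) = (- 1) *\<^sub>R Fm x"
    proof -
      have "(\<Sum>j<l. f j (- fst x) (- snd x) *\<^sub>R axis (idx j) 1 :: real ^ 'k) =
          (\<Sum>j<l. - (f j (fst x) (snd x) *\<^sub>R axis (idx j) 1))"
        by (rule sum.cong[OF refl]) (simp add: f_odd)
      then show ?thesis unfolding eq by (simp add: Fm_def case_prod_unfold sum_negf)
    qed
    assume x: "snd x \<notin> \<sigma>"
    show "snd ((- 1) *\<^sub>R x + 0) \<notin> \<sigma>" using \<sigma>_neg[OF x] by simp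
    show "gm ((- 1) *\<^sub>R x + 0) = gm x" unfolding eq by (simp add: gm_def case_prod_unfold g_even[OF x])
    show "am ((- 1) *\<^sub>R x + 0) = am x" unfolding eq by (simp add: am_eq vec_eq_iff a_even[OF x])
    show "Vm ((- 1) *\<^sub>R x + 0) = Vm x" unfolding eq by (simp add: Vm_def case_prod_unfold V_even[OF x])
  qed simp
  obtain z v u where z_ext: "z = odd_ext T e u" and u: "u 0 = 0" "u T = e" and hom: "path_homotopic z\<^sub>0 u"
    and on: "\<forall>t. z t \<notin> \<sigma> \<and> Fm (t, z t) = 0"
    and dz: "\<forall>t. (z has_vector_derivative v t) (at t)"
    and dv: "\<forall>t. (v has_vector_derivative accel (t, z t) (v t)) (at t)"
    by (rule symmetric_solution[OF inv_shift inv_minus])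
  have z_odd: "z (- t) = - z t" for t unfolding z_ext by (rule odd_ext_minus[OF T u])
  have curvesI: "y \<in> curves \<omega> ang \<sigma> l f \<nu>"
    if "continuous_on UNIV y" "\<And>t. y t \<notin> \<sigma> \<and> Fm (t, y t) = 0" "\<And>t. y (t + 2 * T) = y t + 2 *\<^sub>R e" for y
    using that unfolding curves_def T2 e2 by (simp add: Fm0)
  \<comment> \<open>The extension of the reference path is the given curve, so the extended homotopy
    starts at the curve whose class is prescribed.\<close>
  have z0_ext: "odd_ext T e z\<^sub>0 = z\<^sub>0"
    by (rule odd_ext_unique[OF T z00 z0T]) (simp_all add: z\<^sub>0_odd T2 e2 cur(3))
  have "homotopic_with_canon (\<lambda>y. y \<in> curves \<omega> ang \<sigma> l f \<nu>) UNIV (- \<sigma>) (odd_ext T e z\<^sub>0) (odd_ext T e u)"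
  proof (rule odd_ext_homotopic[OF inv_shift inv_minus hom])
    fix y :: "real \<Rightarrow> real ^ 'k"
    assume A: "continuous_on UNIV y" "\<And>t. y t \<notin> \<sigma> \<and> Fm (t, y t) = 0" "\<And>t. y (t + 2 * T) = y t + 2 *\<^sub>R e"
    show "y \<in> curves \<omega> ang \<sigma> l f \<nu>" by (rule curvesI[OF A])
  qed
  then have homZ: "homotopic_with_canon (\<lambda>y. y \<in> curves \<omega> ang \<sigma> l f \<nu>) UNIV (- \<sigma>) z\<^sub>0 z"
    unfolding z0_ext z_ext .
  have "z \<in> curve_class \<omega> ang \<sigma> l f \<nu> z\<^sub>0"
    using homotopic_with_imp_property[OF homZ] homZ unfolding curve_class_def by blast
  moreover have "is_solution (Lagrangian g a V) \<sigma> l f z"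
  proof -
    have zc: "continuous_on UNIV z"
      by (intro continuous_at_imp_continuous_on ballI has_vector_derivative_continuous[OF dz[rule_format]])
    have vc: "continuous_on UNIV v"
      by (intro continuous_at_imp_continuous_on ballI has_vector_derivative_continuous[OF dv[rule_format]])
    have pair: "continuous_on UNIV (\<lambda>t. ((t, z t), v t))"
      by (intro continuous_on_Pair continuous_on_id zc vc)
    have sub: "(\<lambda>t. ((t, z t), v t)) ` UNIV \<subseteq> {p. snd (fst p) \<notin> \<sigma> \<and> Fm (fst p) = 0}"
      using on by auto
    have acc: "continuous_on UNIV (\<lambda>t. accel (t, z t) (v t))"
      using continuous_on_compose2[OF accel_cont pair sub] by simp
    have mul: "continuous_on UNIV (\<lambda>t. multiplier (t, z t) (v t))"
      using continuous_on_compose2[OF multiplier_cont pair sub] by simp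
    have LL: "Lagrangian g a V t y w = L (t, y) w" for t y w
      unfolding Lagrangian_def L_def gm_inner am_eq Vm_def by (simp add: inner_vec_def)
    have vd: "vector_derivative z (at t) = v t" for t using dz by (simp add: vector_derivative_at)
    have EL: "\<exists>D. ((\<lambda>s. partial i (\<lambda>v. Lagrangian g a V s (z s) v) (vector_derivative z (at s))) has_real_derivative D) (at t) \<and>
        D - partial i (\<lambda>y. Lagrangian g a V t y (vector_derivative z (at t))) (z t)
          = (\<Sum>j<l. multiplier (t, z t) (v t) $ idx j * partial i (f j t) (z t))" for t i
    proof -
      have s: "snd (s, z s) \<notin> \<sigma>" "Fm (s, z s) = 0" for s using on by simp_all
      have 1: "partial i (\<lambda>v. Lagrangian g a V s (z s) v) (vector_derivative z (at s))
          = (gm (s, z s) (v s) + am (s, z s)) $ i" for s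
      proof -
        have "partial i (L (s, z s)) (v s) = (gm (s, z s) (v s) + am (s, z s)) \<bullet> axis i 1"
          by (rule partial_eq[OF has_derivative_L_velocity[OF s(1)]])
        then show ?thesis by (simp add: LL vd inner_axis)
      qed
      have 2: "partial i (\<lambda>y. Lagrangian g a V t y (vector_derivative z (at t))) (z t) = Lz (t, z t) (v t) $ i"
      proof -
        have "partial i (\<lambda>y. L (t, y) (v t)) (z t) = Lz (t, z t) (v t) \<bullet> axis i 1"
          by (rule partial_eq[OF has_derivative_L_position]) (use s(1)[of t] in simp)
        then show ?thesis by (simp add: LL vd inner_axis)
      qed
      have "((\<lambda>s. gm (s, z s) (v s) + am (s, z s)) has_vector_derivative
          Lz (t, z t) (v t) + Bt (t, z t) (multiplier (t, z t) (v t))) (at t)"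
        by (rule momentum_derivative[OF s]) (use dz dv in blast)+
      from bounded_linear.has_vector_derivative[OF bounded_linear_vec_nth this, of i]
      have 3: "((\<lambda>s. (gm (s, z s) (v s) + am (s, z s)) $ i) has_real_derivative
          (Lz (t, z t) (v t) + Bt (t, z t) (multiplier (t, z t) (v t))) $ i) (at t)"
        by (simp add: has_real_derivative_iff_has_vector_derivative)
      \<comment> \<open>\<open>Bt\<close> of the multiplier is the combination of the gradients with
        its components \<open>idx j\<close>, since \<open>Fm'\<close> has no components outside
        \<open>J\<close>.\<close>
      have "Bt (t, z t) (multiplier (t, z t) (v t)) $ i = Bt (t, z t) (multiplier (t, z t) (v t)) \<bullet> axis i 1"
        by (simp add: inner_axis)
      also have "\<dots> = Fm' (t, z t) (0, axis i 1) \<bullet> multiplier (t, z t) (v t)"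
        unfolding inner_Bt B_def ..
      also have "\<dots> = (\<Sum>j<l. multiplier (t, z t) (v t) $ idx j * Fm' (t, z t) (0, axis i 1) $ idx j)"
        by (rule inner_J) (rule Fm'_out)
      also have "\<dots> = (\<Sum>j<l. multiplier (t, z t) (v t) $ idx j * partial i (f j t) (z t))"
        by (rule sum.cong) (simp_all add: partial_f)
      finally have 4: "Bt (t, z t) (multiplier (t, z t) (v t)) $ i = \<dots>" .
      show ?thesis
        unfolding 1 2
        by (rule exI[of _ "(Lz (t, z t) (v t) + Bt (t, z t) (multiplier (t, z t) (v t))) $ i"])
           (intro conjI 3, simp add: 4)
    qed
    show ?thesis
      unfolding is_solution_def
    proof (intro conjI allI)
      show "C2_on UNIV z" by (rule C2_on_curve[OF _ _ acc]) (use dz dv in blast)+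
      show "z t \<notin> \<sigma>" for t using on by blast
      show "\<exists>\<alpha>. (\<forall>j<l. continuous_on UNIV (\<alpha> j)) \<and>
       (\<forall>t. z t \<in> constraint_set l f t \<and>
         (\<forall>i. \<exists>D.
            ((\<lambda>s. partial i (\<lambda>v. Lagrangian g a V s (z s) v) (vector_derivative z (at s))) has_real_derivative D) (at t) \<and>
            D - partial i (\<lambda>y. Lagrangian g a V t y (vector_derivative z (at t))) (z t)
              = (\<Sum>j<l. \<alpha> j t * partial i (f j t) (z t))))"
      \<comment> \<open>The multiplier of \<open>f j\<close> is component \<open>idx j\<close> of
        the vector \<open>multiplier\<close>; it is continuous in time because the curve stays where
        \<open>multiplier\<close> is continuous.\<close>
      proof (rule exI[of _ "\<lambda>j t. multiplier (t, z t) (v t) $ idx j"], intro conjI allI impI)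
        show "continuous_on UNIV (\<lambda>t. multiplier (t, z t) (v t) $ idx j)" for j
          by (rule bounded_linear.continuous_on[OF bounded_linear_vec_nth mul])
        show "z t \<in> constraint_set l f t" for t using on Fm0 by blast
      qed (rule EL)
    qed
  qed
  ultimately show ?thesis using z_odd by blast
qed

end
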